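(* Every spreading model of $Z(\mathcal T^2)$ is isomorphic to $\ell_2$.
   Context: $\omega$ is the space of all complex sequences with pointwise convergence; $c_{00}$ is the space of finitely supported sequences. Spreading model: let $(x_j)$ be a bounded sequence in a Banach space $Y$ without convergent subsequences. By Brunel and Sucheston there is a subsequence $(x'_j)$ such that for all $n$ and scalars $a_1,\dots,a_n$ there is a number $L(a_1,\dots,a_n)$ with: for every $\varepsilon>0$ there is $\nu$ with $\big|\,\|\sum_{j=1}^n a_jx'_{k_j}\|-L(a_1,\dots,a_n)\big|<\varepsilon$ whenever $\nu\le k_1<\dots<k_n$. The completion of $c_{00}$ under the norm $\|\sum_{j=1}^n a_je_j\|:=L(a_1,\dots,a_n)$ is a spreading model of $Y$ (generated by $(x_j)$). Tsirelson's space. For $x\in c_{00}$ let $\|x\|_0=\max_j|x_j|$ and $\|x\|_{n+1}=\max\{\|x\|_n,\frac12\max\sum_{j=1}^k\|A_jx\|_n\}$, where the inner maximum is over all $k$ and finite subsets $k\le A_1<\dots<A_k$ of $\mathbb N$ ($A_j<A_{j+1}$ means $\max A_j<\min A_{j+1}$; $A_jx$ is the restriction of $x$ to $A_j$). $\mathcal T$ is the completion of $c_{00}$ under $\|x\|=\lim_n\|x\|_n$. $\mathcal T^2$ (2-convexification) is the completion of $c_{00}$ under $\|x\|_{\mathcal T^2}=\|\,|x|^2\,\|_{\mathcal T}^{1/2}$. The space $Z(X)$. Let $X$ be a space with an unconditional basis $(e_j)$, regarded as a sequence space in $\omega$ through the basis, with $X^*$ regarded as a sequence space through $x^*\mapsto(x^*(e_j))_j$.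 Let $\mathbb S=\{z\in\mathbb C:0\le \operatorname{Re}z\le 1\}$. $\mathcal F_\infty(X,X^* )$ is the space of functions $F:\mathbb S\to\omega$, bounded and continuous on $\mathbb S$, analytic in its interior, such that $t\mapsto F(it)\in X$ and $t\mapsto F(1+it)\in X^*$ are bounded and continuous, with norm $\max(\sup_t\|F(it)\|_X,\sup_t\|F(1+it)\|_{X^*})$. The interpolation space $(X,X^* )_{1/2}=\{F(1/2):F\in\mathcal F_\infty(X,X^* )\}$ with the quotient norm equals $\ell_2$ up to an equivalent norm. Fix a homogeneous selection $x\in\ell_2\mapsto B(x)\in\mathcal F_\infty(X,X^* )$ with $B(x)(1/2)=x$ and $\|B(x)\|\le C\|x\|_2$, and put $\Omega(x)=B(x)'(1/2)\in\omega$. Then $Z(X)=\{(x,y)\in\omega\times\omega: y\in\ell_2,\ x-\Omega(y)\in\ell_2\}$ with the quasi-norm $\|(x,y)\|=\|x-\Omega(y)\|_2+\|y\|_2$, which is equivalent to a norm; different selections give equivalent quasi-norms. *)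

theory Defs
  imports "HOL-Complex_Analysis.Complex_Analysis"
begin

section \<open>Complex (quasi-)normed spaces on explicit carriers\<close>

text \<open>
  The spaces below depend on parameters (norms on finitely supported sequences, selections), so
  they cannot be types of class \<open>banach\<close>; moreover that class only knows real scalars. The record
  only packages the data. Its last component may be a norm or a quasi-norm.
\<close>

record 'a cspace =
  cs_carrier :: "'a set"
  cs_zero :: 'a
  cs_add :: "'a \<Rightarrow> 'a \<Rightarrow> 'a"
  cs_scale :: "complex \<Rightarrow> 'a \<Rightarrow> 'a"
  cs_norm :: "'a \<Rightarrow> real"

definition cs_diff :: "'a cspace \<Rightarrow> 'a \<Rightarrow> 'a \<Rightarrow> 'a" where
  "cs_diff E x y = cs_add E x (cs_scale E (- 1) y)"

primrec cs_lincomb :: "'a cspace \<Rightarrow> (nat \<Rightarrow> complex) \<Rightarrow> (nat \<Rightarrow> 'a) \<Rightarrow> nat \<Rightarrow> 'a" where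
  "cs_lincomb E a x 0 = cs_zero E"
| "cs_lincomb E a x (Suc n) = cs_add E (cs_lincomb E a x n) (cs_scale E (a n) (x n))"

definition cs_tendsto :: "'a cspace \<Rightarrow> (nat \<Rightarrow> 'a) \<Rightarrow> 'a \<Rightarrow> bool" where
  "cs_tendsto E u x \<longleftrightarrow> (\<lambda>n. cs_norm E (cs_diff E (u n) x)) \<longlonglongrightarrow> 0"

definition cs_cauchy :: "'a cspace \<Rightarrow> (nat \<Rightarrow> 'a) \<Rightarrow> bool" where
  "cs_cauchy E u \<longleftrightarrow> (\<forall>n. u n \<in> cs_carrier E) \<and>
     (\<forall>e>0. \<exists>M. \<forall>m\<ge>M. \<forall>n\<ge>M. cs_norm E (cs_diff E (u m) (u n)) < e)"

definition is_norm_on :: "'a cspace \<Rightarrow> ('a \<Rightarrow> real) \<Rightarrow> bool" where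
  "is_norm_on E N \<longleftrightarrow>
     (\<forall>x\<in>cs_carrier E. 0 \<le> N x \<and> (N x = 0 \<longleftrightarrow> x = cs_zero E)) \<and>
     (\<forall>a. \<forall>x\<in>cs_carrier E. N (cs_scale E a x) = cmod a * N x) \<and>
     (\<forall>x\<in>cs_carrier E. \<forall>y\<in>cs_carrier E. N (cs_add E x y) \<le> N x + N y)"

definition equivalent_on :: "'a set \<Rightarrow> ('a \<Rightarrow> real) \<Rightarrow> ('a \<Rightarrow> real) \<Rightarrow> bool" where
  "equivalent_on V N q \<longleftrightarrow> (\<exists>c C. 0 < c \<and> 0 < C \<and> (\<forall>x\<in>V. c * q x \<le> N x \<and> N x \<le> C * q x))"

definition cs_linear :: "'a cspace \<Rightarrow> 'b cspace \<Rightarrow> ('a \<Rightarrow> 'b) \<Rightarrow> bool" where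
  "cs_linear E F f \<longleftrightarrow>
     (\<forall>x\<in>cs_carrier E. f x \<in> cs_carrier F) \<and>
     (\<forall>x\<in>cs_carrier E. \<forall>y\<in>cs_carrier E. f (cs_add E x y) = cs_add F (f x) (f y)) \<and>
     (\<forall>a. \<forall>x\<in>cs_carrier E. f (cs_scale E a x) = cs_scale F a (f x))"

definition isomorphic :: "'a cspace \<Rightarrow> 'b cspace \<Rightarrow> bool" where
  "isomorphic E F \<longleftrightarrow>
     (\<exists>f. cs_linear E F f \<and> bij_betw f (cs_carrier E) (cs_carrier F) \<and>
          equivalent_on (cs_carrier E) (\<lambda>x. cs_norm F (f x)) (cs_norm E))"


section \<open>Completion\<close>

text \<open>Cauchy sequences modulo null sequences.\<close>

definition completion_rel :: "'a cspace \<Rightarrow> ((nat \<Rightarrow> 'a) \<times> (nat \<Rightarrow> 'a)) set" where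
  "completion_rel E = {(u, v). cs_cauchy E u \<and> cs_cauchy E v \<and>
     (\<lambda>n. cs_norm E (cs_diff E (u n) (v n))) \<longlonglongrightarrow> 0}"

definition completion :: "'a cspace \<Rightarrow> (nat \<Rightarrow> 'a) set cspace" where
  "completion E =
     \<lparr> cs_carrier = Collect (cs_cauchy E) // completion_rel E,
       cs_zero = completion_rel E `` {\<lambda>n. cs_zero E},
       cs_add = (\<lambda>U V. \<Union>u\<in>U. \<Union>v\<in>V. completion_rel E `` {\<lambda>n. cs_add E (u n) (v n)}),
       cs_scale = (\<lambda>a U. \<Union>u\<in>U. completion_rel E `` {\<lambda>n. cs_scale E a (u n)}),
       cs_norm = (\<lambda>U. THE r. \<exists>u\<in>U. (\<lambda>n. cs_norm E (u n)) \<longlonglongrightarrow> r) \<rparr>"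

definition completion_embed :: "'a cspace \<Rightarrow> 'a \<Rightarrow> (nat \<Rightarrow> 'a) set" where
  "completion_embed E x = completion_rel E `` {\<lambda>n. x}"


section \<open>Sequence spaces\<close>

type_synonym cseq = "nat \<Rightarrow> complex"

definition sequence_space :: "cseq set \<Rightarrow> (cseq \<Rightarrow> real) \<Rightarrow> cseq cspace" where
  "sequence_space V N =
     \<lparr> cs_carrier = V, cs_zero = (\<lambda>j. 0), cs_add = (\<lambda>x y j. x j + y j),
       cs_scale = (\<lambda>a x j. a * x j), cs_norm = N \<rparr>"

definition c00 :: "cseq set" where
  "c00 = {x. finite {j. x j \<noteq> 0}}"

definition unit_seq :: "nat \<Rightarrow> cseq" where
  "unit_seq j = (\<lambda>i. if i = j then 1 else 0)"

definition restr :: "nat set \<Rightarrow> cseq \<Rightarrow> cseq" where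
  "restr A x = (\<lambda>j. if j \<in> A then x j else 0)"

definition l2_seqs :: "cseq set" where
  "l2_seqs = {x. summable (\<lambda>j. (cmod (x j))\<^sup>2)}"

definition l2_norm :: "cseq \<Rightarrow> real" where
  "l2_norm x = sqrt (\<Sum>j. (cmod (x j))\<^sup>2)"

definition l2_space :: "cseq cspace" where
  "l2_space = sequence_space l2_seqs l2_norm"

text \<open>
  A space \<open>E\<close> with basis \<open>b\<close>, regarded as a sequence space through the basis: \<open>x = \<Sum>j. a j b j\<close>
  in \<open>E\<close> is identified with its sequence \<open>a\<close> of coefficients.
\<close>

definition basis_expansion :: "'a cspace \<Rightarrow> (nat \<Rightarrow> 'a) \<Rightarrow> cseq \<Rightarrow> 'a \<Rightarrow> bool" where
  "basis_expansion E b a x \<longleftrightarrow> x \<in> cs_carrier E \<and> cs_tendsto E (cs_lincomb E a b) x"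

definition coefficient_space :: "'a cspace \<Rightarrow> (nat \<Rightarrow> 'a) \<Rightarrow> cseq cspace" where
  "coefficient_space E b =
     sequence_space {a. \<exists>x. basis_expansion E b a x}
       (\<lambda>a. cs_norm E (THE x. basis_expansion E b a x))"

text \<open>The dual of \<open>E\<close>, regarded as a sequence space by identifying \<open>f\<close> with \<open>\<lambda>j. f (b j)\<close>.\<close>

definition functionals :: "'a cspace \<Rightarrow> ('a \<Rightarrow> complex) set" where
  "functionals E = {f.
     (\<forall>x\<in>cs_carrier E. \<forall>y\<in>cs_carrier E. f (cs_add E x y) = f x + f y) \<and>
     (\<forall>a. \<forall>x\<in>cs_carrier E. f (cs_scale E a x) = a * f x) \<and>
     (\<exists>K. \<forall>x\<in>cs_carrier E. cmod (f x) \<le> K * cs_norm E x)}"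

definition functional_norm :: "'a cspace \<Rightarrow> ('a \<Rightarrow> complex) \<Rightarrow> real" where
  "functional_norm E f = (SUP x\<in>{x\<in>cs_carrier E. cs_norm E x \<le> 1}. cmod (f x))"

definition dual_sequence_space :: "'a cspace \<Rightarrow> (nat \<Rightarrow> 'a) \<Rightarrow> cseq cspace" where
  "dual_sequence_space E b =
     sequence_space {y. \<exists>f\<in>functionals E. \<forall>j. y j = f (b j)}
       (\<lambda>y. THE r. \<exists>f\<in>functionals E. (\<forall>j. y j = f (b j)) \<and> r = functional_norm E f)"


section \<open>Tsirelson's space\<close>

text \<open>
  Coordinates are numbered from 0 here but from 1 in the usual definition, so that the condition
  \<open>k \<le> min A\<^sub>1\<close> becomes \<open>k \<le> Suc (Min (A 0))\<close>.
\<close>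

definition admissible :: "nat \<Rightarrow> (nat \<Rightarrow> nat set) \<Rightarrow> bool" where
  "admissible k A \<longleftrightarrow> 1 \<le> k \<and> (\<forall>j<k. finite (A j) \<and> A j \<noteq> {}) \<and>
     k \<le> Suc (Min (A 0)) \<and> (\<forall>j. Suc j < k \<longrightarrow> Max (A j) < Min (A (Suc j)))"

text \<open>For \<open>x \<in> c00\<close> the suprema below are taken over finite sets, hence are maxima.\<close>

primrec tsirelson_approx :: "nat \<Rightarrow> cseq \<Rightarrow> real" where
  "tsirelson_approx 0 x = (SUP j. cmod (x j))"
| "tsirelson_approx (Suc n) x =
     max (tsirelson_approx n x)
         (1/2 * Sup {\<Sum>j<k. tsirelson_approx n (restr (A j) x) | k A. admissible k A})"

definition tsirelson_norm :: "cseq \<Rightarrow> real" where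
  "tsirelson_norm x = lim (\<lambda>n. tsirelson_approx n x)"

definition tsirelson2_norm :: "cseq \<Rightarrow> real" where
  "tsirelson2_norm x = sqrt (tsirelson_norm (\<lambda>j. of_real ((cmod (x j))\<^sup>2)))"

definition tsirelson2 :: "(nat \<Rightarrow> cseq) set cspace" where
  "tsirelson2 = completion (sequence_space c00 tsirelson2_norm)"

definition tsirelson2_basis :: "nat \<Rightarrow> (nat \<Rightarrow> cseq) set" where
  "tsirelson2_basis j = completion_embed (sequence_space c00 tsirelson2_norm) (unit_seq j)"


section \<open>Interpolation and the twisted sum\<close>

definition strip :: "complex set" where
  "strip = {z. 0 \<le> Re z \<and> Re z \<le> 1}"

text \<open>
  Continuity on the strip refers to the product topology on \<open>cseq\<close>, that is, pointwise convergence.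
  Boundedness is boundedness in the topological vector space of all sequences, that is, of every
  coordinate; the library's predicate \<open>bounded\<close> on \<open>cseq\<close> would refer to a bounded metric.
\<close>

definition calF :: "cseq cspace \<Rightarrow> cseq cspace \<Rightarrow> (complex \<Rightarrow> cseq) set" where
  "calF X Y = {F.
     (\<forall>j. bounded ((\<lambda>z. F z j) ` strip)) \<and>
     continuous_on strip F \<and>
     (\<forall>j. (\<lambda>z. F z j) analytic_on interior strip) \<and>
     (\<forall>t::real. F (\<i> * t) \<in> cs_carrier X \<and> F (1 + \<i> * t) \<in> cs_carrier Y) \<and>
     bounded (range (\<lambda>t::real. cs_norm X (F (\<i> * t)))) \<and>
     bounded (range (\<lambda>t::real. cs_norm Y (F (1 + \<i> * t)))) \<and>
     (\<forall>t::real. ((\<lambda>s::real. cs_norm X (cs_diff X (F (\<i> * s)) (F (\<i> * t)))) \<longlongrightarrow> 0) (at t)) \<and>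
     (\<forall>t::real. ((\<lambda>s::real. cs_norm Y (cs_diff Y (F (1 + \<i> * s)) (F (1 + \<i> * t)))) \<longlongrightarrow> 0) (at t))}"

definition calF_norm :: "cseq cspace \<Rightarrow> cseq cspace \<Rightarrow> (complex \<Rightarrow> cseq) \<Rightarrow> real" where
  "calF_norm X Y F =
     max (SUP t::real. cs_norm X (F (\<i> * t))) (SUP t::real. cs_norm Y (F (1 + \<i> * t)))"

text \<open>Functions in \<open>calF\<close> matter on the strip only, hence so does homogeneity of a selection.\<close>

definition homogeneous_selection ::
    "cseq cspace \<Rightarrow> cseq cspace \<Rightarrow> (cseq \<Rightarrow> complex \<Rightarrow> cseq) \<Rightarrow> bool" where
  "homogeneous_selection X Y B \<longleftrightarrow>
     (\<forall>x\<in>l2_seqs. B x \<in> calF X Y \<and> B x (1/2) = x) \<and>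
     (\<exists>C. \<forall>x\<in>l2_seqs. calF_norm X Y (B x) \<le> C * l2_norm x) \<and>
     (\<forall>a. \<forall>x\<in>l2_seqs. \<forall>z\<in>strip. B (\<lambda>j. a * x j) z = (\<lambda>j. a * B x z j))"

definition Omega :: "(cseq \<Rightarrow> complex \<Rightarrow> cseq) \<Rightarrow> cseq \<Rightarrow> cseq" where
  "Omega B x = (\<lambda>j. deriv (\<lambda>z. B x z j) (1/2))"

definition Z_space :: "(cseq \<Rightarrow> complex \<Rightarrow> cseq) \<Rightarrow> (cseq \<times> cseq) cspace" where
  "Z_space B =
     \<lparr> cs_carrier = {(x, y). y \<in> l2_seqs \<and> (\<lambda>j. x j - Omega B y j) \<in> l2_seqs},
       cs_zero = (\<lambda>j. 0, \<lambda>j. 0),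
       cs_add = (\<lambda>(x, y) (x', y'). (\<lambda>j. x j + x' j, \<lambda>j. y j + y' j)),
       cs_scale = (\<lambda>a (x, y). (\<lambda>j. a * x j, \<lambda>j. a * y j)),
       cs_norm = (\<lambda>(x, y). l2_norm (\<lambda>j. x j - Omega B y j) + l2_norm y) \<rparr>"


section \<open>Spreading models\<close>

text \<open>
  \<open>L a\<close> for \<open>a \<in> c00\<close> supported in \<open>{..<n}\<close> is the number usually written \<open>L(a\<^sub>1,\<dots>,a\<^sub>n)\<close>; it does
  not depend on the choice of \<open>n\<close>.
\<close>

definition generates_spreading_norm :: "'a cspace \<Rightarrow> (nat \<Rightarrow> 'a) \<Rightarrow> (cseq \<Rightarrow> real) \<Rightarrow> bool" where
  "generates_spreading_norm Y x L \<longleftrightarrow>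
     (\<forall>n a. \<forall>e>0. \<exists>\<nu>. \<forall>k::nat \<Rightarrow> nat.
        (\<forall>i<n. \<nu> \<le> k i) \<and> strict_mono_on {..<n} k \<longrightarrow>
        \<bar>cs_norm Y (cs_lincomb Y a (\<lambda>i. x (k i)) n) - L (restr {..<n} a)\<bar> < e)"

definition spreading_model :: "'a cspace \<Rightarrow> (nat \<Rightarrow> cseq) set cspace \<Rightarrow> bool" where
  "spreading_model Y M \<longleftrightarrow>
     (\<exists>x r L.
        (\<forall>j. x j \<in> cs_carrier Y) \<and>
        bounded (range (\<lambda>j. cs_norm Y (x j))) \<and>
        \<not> (\<exists>s l. strict_mono s \<and> l \<in> cs_carrier Y \<and> cs_tendsto Y (x \<circ> s) l) \<and>
        strict_mono (r :: nat \<Rightarrow> nat) \<and>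
        generates_spreading_norm Y (x \<circ> r) L \<and>
        M = completion (sequence_space c00 L))"

end

theory Submission
  imports Defs
begin

text \<open>
  A function in the interpolation family that vanishes at \<open>1/2\<close> has its derivative there in \<open>\<ell>\<^sub>2\<close>, so
  \<open>\<Omega> y\<close> may be computed, up to a bounded error, from any function of the family with value \<open>y\<close> at
  \<open>1/2\<close>. If \<open>y\<^sub>1 < \<dots> < y\<^sub>k\<close> are blocks supported after \<open>k\<close>, the lower 2-estimate of \<open>T\<^sup>2\<close> on such blocks
  and its dual make the sum of the restricted \<open>B(y\<^sub>i)\<close> a competitor of norm at most a constant times
  \<open>\<parallel>\<Sum> y\<^sub>i\<parallel>\<^sub>2\<close>. Hence \<open>k\<close> blocks of \<open>Z(T\<^sup>2)\<close> supported after \<open>k\<close> span \<open>\<ell>\<^sub>2\<^sup>k\<close> uniformly.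

  A bounded sequence without convergent subsequences has a subsequence \<open>w + u\<^sub>j\<close> with \<open>u\<^sub>j\<close>
  coordinatewise null and bounded away from \<open>0\<close>, and by a gliding hump any number of the \<open>u\<^sub>j\<close> are
  nearly such blocks. So \<open>L(a)\<close> is equivalent to \<open>\<parallel>a\<parallel>\<^sub>2\<close> if \<open>w = 0\<close> and to \<open>\<bar>\<Sum> a\<^sub>j\<bar> + \<parallel>a\<parallel>\<^sub>2\<close>
  otherwise. In the second case the completion is \<open>\<complex> \<oplus> \<ell>\<^sub>2\<close>, since summation is discontinuous on
  \<open>\<ell>\<^sub>2\<close>.
\<close>


section \<open>Square summable sequences\<close>

text \<open>\<open>Omega\<close> need not be linear, but the indicator of a set of coordinates acts
  contractively on both boundary spaces. Hence \<open>Omega\<close> commutes with restrictions up to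
  an error bounded in \<open>l2_seqs\<close>, and blocks may be cut out of vectors of the twisted
  sum.

  That k blocks have to start after k costs nothing: the spreading norm is a limit along indices
  tending to infinity, and for a fixed number of vectors the gliding hump may begin as late as
  desired. So an asymptotic estimate decides all spreading models.

  Of the identity between the interpolation space and l2, the selection supplies functions with
  prescribed value at 1/2. The converse bound is proved by a pairing; it is this bound that puts
  derivatives into l2. Estimates on the boundary spaces are made on finite truncations, so that the
  completions enter through two inequalities only.

  The coordinatewise limit w meets the spreading norm only through the multiple of w by the sum of
  the coefficients, which explains the extra term when w is not 0.\<close>

text \<open>Membership in l2 and the norm bound in one predicate on finite sections. In this form
  the bound passes to coordinatewise limits.\<close>

definition l2_le :: "real \<Rightarrow> cseq \<Rightarrow> bool" where
  "l2_le K x \<longleftrightarrow> (\<forall>n. L2_set (\<lambda>j. cmod (x j)) {..<n} \<le> K)"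

lemma l2_le_nonneg: "l2_le K x \<Longrightarrow> 0 \<le> K"
  unfolding l2_le_def by (metis L2_set_empty lessThan_0)

lemma l2_le_iff: "l2_le K x \<longleftrightarrow> x \<in> l2_seqs \<and> l2_norm x \<le> K"
proof
  assume A: "l2_le K x"
  have b: "(\<Sum>j<n. (cmod (x j))\<^sup>2) \<le> K\<^sup>2" for n
  proof -
    have "L2_set (\<lambda>j. cmod (x j)) {..<n} \<le> K" using A by (simp add: l2_le_def)
    then have "(L2_set (\<lambda>j. cmod (x j)) {..<n})\<^sup>2 \<le> K\<^sup>2" by (rule power_mono) simp
    then show ?thesis by (simp add: L2_set_def sum_nonneg)
  qed
  have s: "summable (\<lambda>j. (cmod (x j))\<^sup>2)"
    by (rule summableI_nonneg_bounded[OF _ b]) simp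
  then have "(\<Sum>j. (cmod (x j))\<^sup>2) \<le> K\<^sup>2"
    using b by (meson suminf_le_const)
  then have "l2_norm x \<le> K" unfolding l2_norm_def
    using l2_le_nonneg[OF A] real_le_lsqrt s suminf_nonneg by fastforce
  then show "x \<in> l2_seqs \<and> l2_norm x \<le> K" using s by (simp add: l2_seqs_def)
next
  assume A: "x \<in> l2_seqs \<and> l2_norm x \<le> K"
  show "l2_le K x" unfolding l2_le_def
  proof
    fix n
    have "(\<Sum>j<n. (cmod (x j))\<^sup>2) \<le> (\<Sum>j. (cmod (x j))\<^sup>2)"
      using A by (intro sum_le_suminf) (auto simp: l2_seqs_def)
    then show "L2_set (\<lambda>j. cmod (x j)) {..<n} \<le> K"
      using A unfolding L2_set_def l2_norm_def by (meson order_trans real_sqrt_le_mono)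
  qed
qed

lemma l2_leI: "x \<in> l2_seqs \<Longrightarrow> l2_le (l2_norm x) x"
  by (simp add: l2_le_iff)

lemma l2_leD: "l2_le K x \<Longrightarrow> x \<in> l2_seqs" "l2_le K x \<Longrightarrow> l2_norm x \<le> K"
  by (simp_all add: l2_le_iff)

lemma l2_norm_nonneg: "x \<in> l2_seqs \<Longrightarrow> 0 \<le> l2_norm x"
  using l2_leI l2_le_nonneg by blast

lemma l2_le_mono: "l2_le K x \<Longrightarrow> K \<le> K' \<Longrightarrow> l2_le K' x"
  unfolding l2_le_def by (meson order_trans)

lemma l2_le_add:
  assumes "l2_le K x" "l2_le K' y"
  shows "l2_le (K + K') (\<lambda>j. x j + y j)"
  unfolding l2_le_def
proof
  fix n
  have "L2_set (\<lambda>j. cmod (x j + y j)) {..<n} \<le> L2_set (\<lambda>j. cmod (x j) + cmod (y j)) {..<n}"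
    by (rule L2_set_mono) (auto intro: norm_triangle_ineq)
  also have "\<dots> \<le> L2_set (\<lambda>j. cmod (x j)) {..<n} + L2_set (\<lambda>j. cmod (y j)) {..<n}"
    by (rule L2_set_triangle_ineq)
  also have "\<dots> \<le> K + K'" using assms by (auto simp: l2_le_def intro: add_mono)
  finally show "L2_set (\<lambda>j. cmod (x j + y j)) {..<n} \<le> K + K'" .
qed

lemma l2_le_scale:
  assumes "l2_le K x" shows "l2_le (cmod a * K) (\<lambda>j. a * x j)"
  unfolding l2_le_def
  using assms
  by (auto simp: norm_mult L2_set_right_distrib[symmetric] l2_le_def intro!: mult_left_mono)

lemma l2_le_minus: "l2_le K x \<Longrightarrow> l2_le K (\<lambda>j. - x j)"
  by (simp add: l2_le_def)

lemma l2_le_diff: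
  assumes "l2_le K x" "l2_le K' y"
  shows "l2_le (K + K') (\<lambda>j. x j - y j)"
  using l2_le_add[OF assms(1) l2_le_minus[OF assms(2)]] by simp

lemma l2_le_restr:
  assumes "l2_le K x" shows "l2_le K (restr A x)"
  unfolding l2_le_def
proof
  fix n
  have "L2_set (\<lambda>j. cmod (restr A x j)) {..<n} \<le> L2_set (\<lambda>j. cmod (x j)) {..<n}"
    by (rule L2_set_mono) (auto simp: restr_def)
  then show "L2_set (\<lambda>j. cmod (restr A x j)) {..<n} \<le> K"
    using assms unfolding l2_le_def by (meson order_trans)
qed

lemma l2_le_coord: "l2_le K x \<Longrightarrow> cmod (x i) \<le> K"
  using member_le_L2_set[of "{..<Suc i}" i "\<lambda>j. cmod (x j)"]
  unfolding l2_le_def by (auto intro: order_trans)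

lemma l2_norm_scale:
  assumes "x \<in> l2_seqs" shows "l2_norm (\<lambda>j. a * x j) = cmod a * l2_norm x"
  using assms unfolding l2_norm_def l2_seqs_def
  by (simp add: norm_mult power_mult_distrib suminf_mult real_sqrt_mult)

lemma l2_add: "x \<in> l2_seqs \<Longrightarrow> y \<in> l2_seqs \<Longrightarrow> (\<lambda>j. x j + y j) \<in> l2_seqs"
  by (rule l2_leD(1)[OF l2_le_add[OF l2_leI l2_leI]])

lemma l2_norm_add: "x \<in> l2_seqs \<Longrightarrow> y \<in> l2_seqs \<Longrightarrow>
    l2_norm (\<lambda>j. x j + y j) \<le> l2_norm x + l2_norm y"
  by (rule l2_leD(2)[OF l2_le_add[OF l2_leI l2_leI]])

lemma l2_diff: "x \<in> l2_seqs \<Longrightarrow> y \<in> l2_seqs \<Longrightarrow> (\<lambda>j. x j - y j) \<in> l2_seqs"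
  by (rule l2_leD(1)[OF l2_le_diff[OF l2_leI l2_leI]])

lemma l2_norm_diff: "x \<in> l2_seqs \<Longrightarrow> y \<in> l2_seqs \<Longrightarrow>
    l2_norm (\<lambda>j. x j - y j) \<le> l2_norm x + l2_norm y"
  by (rule l2_leD(2)[OF l2_le_diff[OF l2_leI l2_leI]])

lemma l2_scale: "x \<in> l2_seqs \<Longrightarrow> (\<lambda>j. a * x j) \<in> l2_seqs"
  by (rule l2_leD(1)[OF l2_le_scale[OF l2_leI]])

lemma l2_restr: "x \<in> l2_seqs \<Longrightarrow> restr A x \<in> l2_seqs"
  by (rule l2_leD(1)[OF l2_le_restr[OF l2_leI]])

lemma l2_norm_restr: "x \<in> l2_seqs \<Longrightarrow> l2_norm (restr A x) \<le> l2_norm x"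
  by (rule l2_leD(2)[OF l2_le_restr[OF l2_leI]])

lemma l2_norm_0: "l2_norm (\<lambda>j. 0) = 0" and l2_zero: "(\<lambda>j. 0) \<in> l2_seqs"
  by (simp_all add: l2_norm_def l2_seqs_def)

lemma l2_coord: "x \<in> l2_seqs \<Longrightarrow> cmod (x i) \<le> l2_norm x"
  using l2_le_coord l2_leI by blast

lemma l2_norm_eq_0: "x \<in> l2_seqs \<Longrightarrow> l2_norm x = 0 \<Longrightarrow> x = (\<lambda>j. 0)"
  using l2_coord[of x] by (metis norm_le_zero_iff)

lemma l2_norm_triangle_diff:
  assumes "x \<in> l2_seqs" "y \<in> l2_seqs"
  shows "\<bar>l2_norm x - l2_norm y\<bar> \<le> l2_norm (\<lambda>j. x j - y j)"
proof -
  have "l2_norm x \<le> l2_norm (\<lambda>j. x j - y j) + l2_norm y"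
    using l2_norm_add[OF l2_diff[OF assms] assms(2)] by simp
  moreover have "l2_norm y \<le> l2_norm (\<lambda>j. y j - x j) + l2_norm x"
    using l2_norm_add[OF l2_diff[OF assms(2,1)] assms(1)] by simp
  moreover have "l2_norm (\<lambda>j. y j - x j) = l2_norm (\<lambda>j. x j - y j)"
    by (simp add: l2_norm_def norm_minus_commute)
  ultimately show ?thesis by linarith
qed

lemma c00_subset_l2: "c00 \<subseteq> l2_seqs"
proof
  fix x :: cseq assume "x \<in> c00"
  then have "finite {j. x j \<noteq> 0}" by (simp add: c00_def)
  then show "x \<in> l2_seqs" unfolding l2_seqs_def
    by (auto intro!: summable_finite[where N = "{j. x j \<noteq> 0}"])
qed

lemma l2_norm_finite:
  assumes "\<And>j. j \<notin> A \<Longrightarrow> x j = 0" "finite A"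
  shows "l2_norm x = L2_set (\<lambda>j. cmod (x j)) A"
  unfolding l2_norm_def L2_set_def
  by (subst suminf_finite[of A]) (auto simp: assms)

lemma l2_tail:
  assumes "x \<in> l2_seqs"
  shows "(\<lambda>n. l2_norm (\<lambda>j. x j - restr {..<n} x j)) \<longlonglongrightarrow> 0"
proof -
  have s: "summable (\<lambda>j. (cmod (x j))\<^sup>2)" using assms by (simp add: l2_seqs_def)
  have "(l2_norm (\<lambda>j. x j - restr {..<n} x j)) =
      sqrt ((\<Sum>j. (cmod (x j))\<^sup>2) - (\<Sum>j<n. (cmod (x j))\<^sup>2))" for n
  proof -
    have "(\<Sum>j. (cmod (x j - restr {..<n} x j))\<^sup>2)
        = (\<Sum>j. (cmod (x j))\<^sup>2 - (if j \<in> {..<n} then (cmod (x j))\<^sup>2 else 0))"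
      by (rule suminf_cong) (auto simp: restr_def)
    also have "\<dots> = (\<Sum>j. (cmod (x j))\<^sup>2) - (\<Sum>j. if j \<in> {..<n} then (cmod (x j))\<^sup>2 else 0)"
      by (rule suminf_diff[symmetric]) (use s in \<open>auto intro: summable_If_finite_set\<close>)
    also have "(\<Sum>j. if j \<in> {..<n} then (cmod (x j))\<^sup>2 else 0) = (\<Sum>j<n. (cmod (x j))\<^sup>2)"
      by (subst suminf_finite[of "{..<n}"]) auto
    finally show ?thesis by (simp add: l2_norm_def)
  qed
  moreover have "(\<lambda>n. sqrt ((\<Sum>j. (cmod (x j))\<^sup>2) - (\<Sum>j<n. (cmod (x j))\<^sup>2)))
      \<longlonglongrightarrow> sqrt ((\<Sum>j. (cmod (x j))\<^sup>2) - (\<Sum>j. (cmod (x j))\<^sup>2))"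
    by (intro tendsto_intros summable_LIMSEQ s)
  ultimately show ?thesis by simp
qed

lemma l2_complete:
  assumes u: "\<And>n. u n \<in> l2_seqs"
    and C: "\<And>e. 0 < e \<Longrightarrow> \<exists>M. \<forall>m\<ge>M. \<forall>n\<ge>M. l2_norm (\<lambda>j. u m j - u n j) < e"
  shows "\<exists>x\<in>l2_seqs. (\<lambda>n. l2_norm (\<lambda>j. u n j - x j)) \<longlonglongrightarrow> 0"
proof -
  have "Cauchy (\<lambda>n. u n j)" for j
  proof (rule metric_CauchyI)
    fix e :: real assume "0 < e"
    from C[OF this] obtain M where M: "\<forall>m\<ge>M. \<forall>n\<ge>M. l2_norm (\<lambda>j. u m j - u n j) < e" by blast
    have "dist (u m j) (u n j) < e" if "m \<ge> M" "n \<ge> M" for m n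
      using l2_coord[OF l2_diff[OF u[of m] u[of n]], of j] M that
      by (fastforce simp: dist_norm)
    then show "\<exists>M. \<forall>m\<ge>M. \<forall>n\<ge>M. dist (u m j) (u n j) < e" by blast
  qed
  then have "\<forall>j. \<exists>l. (\<lambda>n. u n j) \<longlonglongrightarrow> l" using Cauchy_convergent_iff convergent_def by blast
  then obtain x where x: "\<And>j. (\<lambda>n. u n j) \<longlonglongrightarrow> x j" by metis
  \<comment> \<open>On the first k coordinates the Cauchy bound is a finite expression, so m may
    tend to infinity there for each fixed k.\<close>
  have key: "l2_le e (\<lambda>j. u n j - x j)"
    if M: "\<forall>m\<ge>M. \<forall>n\<ge>M. l2_norm (\<lambda>j. u m j - u n j) < e" and n: "n \<ge> M" for e M n
    unfolding l2_le_def
  proof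
    fix k
    have "(\<lambda>m. L2_set (\<lambda>j. cmod (u n j - u m j)) {..<k}) \<longlonglongrightarrow> L2_set (\<lambda>j. cmod (u n j - x j)) {..<k}"
      unfolding L2_set_def by (intro tendsto_intros x)
    moreover have "L2_set (\<lambda>j. cmod (u n j - u m j)) {..<k} \<le> e" if "m \<ge> M" for m
      using M n that l2_le_iff[of e "\<lambda>j. u n j - u m j"] l2_diff[OF u u]
      by (auto simp: l2_le_def intro: less_imp_le)
    ultimately show "L2_set (\<lambda>j. cmod (u n j - x j)) {..<k} \<le> e"
      by (meson LIMSEQ_le_const2)
  qed
  obtain M1 where "\<forall>m\<ge>M1. \<forall>n\<ge>M1. l2_norm (\<lambda>j. u m j - u n j) < 1" using C[of 1] by auto
  from key[OF this order_refl] have "(\<lambda>j. u M1 j - x j) \<in> l2_seqs" by (rule l2_leD)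
  from l2_diff[OF u[of M1] this] have xl: "x \<in> l2_seqs" by simp
  have "(\<lambda>n. l2_norm (\<lambda>j. u n j - x j)) \<longlonglongrightarrow> 0"
  proof (rule LIMSEQ_I)
    fix r :: real assume "0 < r"
    then obtain M where M: "\<forall>m\<ge>M. \<forall>n\<ge>M. l2_norm (\<lambda>j. u m j - u n j) < r/2"
      using C[of "r/2"] by auto
    have "norm (l2_norm (\<lambda>j. u n j - x j) - 0) < r" if "n \<ge> M" for n
      using l2_leD(2)[OF key[OF M that]] \<open>0 < r\<close> l2_norm_nonneg[OF l2_diff[OF u[of n] xl]] by simp
    then show "\<exists>no. \<forall>n\<ge>no. norm (l2_norm (\<lambda>j. u n j - x j) - 0) < r" by blast
  qed
  with xl show ?thesis by blast
qed


section \<open>Completions of finitely supported sequences\<close>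

lemma c00_add: "x \<in> c00 \<Longrightarrow> y \<in> c00 \<Longrightarrow> (\<lambda>j. x j + y j) \<in> c00"
  unfolding c00_def by (auto intro: finite_subset[of _ "{j. x j \<noteq> 0} \<union> {j. y j \<noteq> 0}"])

lemma c00_scale: "x \<in> c00 \<Longrightarrow> (\<lambda>j. a * x j) \<in> c00"
  unfolding c00_def by (auto intro: finite_subset[of _ "{j. x j \<noteq> 0}"])

lemma c00_diff: "x \<in> c00 \<Longrightarrow> y \<in> c00 \<Longrightarrow> (\<lambda>j. x j - y j) \<in> c00"
  using c00_add[of x "\<lambda>j. (-1) * y j"] c00_scale[of y "-1"] by simp

lemma c00_zero: "(\<lambda>j. 0) \<in> c00"
  by (simp add: c00_def)

lemma c00_restr: "x \<in> c00 \<Longrightarrow> restr A x \<in> c00"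
  unfolding c00_def by (auto simp: restr_def intro: finite_subset[of _ "{j. x j \<noteq> 0}"])

lemma c00_restr_finite: "finite A \<Longrightarrow> restr A x \<in> c00"
  unfolding c00_def restr_def by (auto elim: finite_subset[rotated])

lemma c00_unit_seq: "unit_seq j \<in> c00"
  by (simp add: c00_def unit_seq_def)

lemma c00_bounded_support:
  assumes "x \<in> c00" shows "\<exists>n. \<forall>m\<ge>n. restr {..<m} x = x"
proof -
  obtain n where "{j. x j \<noteq> 0} \<subseteq> {..<n}"
    using assms finite_nat_iff_bounded unfolding c00_def by auto
  then have "restr {..<m} x = x" if "m \<ge> n" for m
    using that by (fastforce simp: restr_def)
  then show ?thesis by blast
qed

lemma null_sandwich:
  assumes "\<And>n. 0 \<le> (f n :: real)" "\<And>n. f n \<le> g n" "g \<longlonglongrightarrow> 0" shows "f \<longlonglongrightarrow> 0"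
  by (rule tendsto_sandwich[of "\<lambda>_. 0" f sequentially g]) (use assms in auto)

text \<open>A seminorm is enough, because the completion is taken modulo null sequences. Both the
  norm of the convexified Tsirelson space and the limit L of a spreading model are
  instances.\<close>

locale c00_seminorm =
  fixes N :: "cseq \<Rightarrow> real"
  assumes N_scale: "x \<in> c00 \<Longrightarrow> N (\<lambda>j. a * x j) = cmod a * N x"
    and N_add: "x \<in> c00 \<Longrightarrow> y \<in> c00 \<Longrightarrow> N (\<lambda>j. x j + y j) \<le> N x + N y"
begin

abbreviation "S \<equiv> sequence_space c00 N"
abbreviation "E \<equiv> completion S"
abbreviation "R \<equiv> completion_rel S"

lemma N_0: "N (\<lambda>j. 0) = 0"
  using N_scale[of "\<lambda>j. 0" 0] by (simp add: c00_zero)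

lemma N_minus: "x \<in> c00 \<Longrightarrow> N (\<lambda>j. - x j) = N x"
  using N_scale[of x "-1"] by simp

lemma N_nonneg: "x \<in> c00 \<Longrightarrow> 0 \<le> N x"
  using N_add[of x "\<lambda>j. (-1) * x j"] c00_scale[of x "-1"] by (simp add: N_0 N_minus)

lemma N_diff: "x \<in> c00 \<Longrightarrow> y \<in> c00 \<Longrightarrow> N (\<lambda>j. x j - y j) \<le> N x + N y"
  using N_add[of x "\<lambda>j. (-1) * y j"] c00_scale[of y "-1"] by (simp add: N_minus)

lemma N_diff_triangle:
  assumes "x \<in> c00" "y \<in> c00" "z \<in> c00"
  shows "N (\<lambda>j. x j - z j) \<le> N (\<lambda>j. x j - y j) + N (\<lambda>j. y j - z j)"
  using N_add[OF c00_diff[OF assms(1,2)] c00_diff[OF assms(2,3)]] by simp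

lemma N_diff_commute: "x \<in> c00 \<Longrightarrow> y \<in> c00 \<Longrightarrow> N (\<lambda>j. x j - y j) = N (\<lambda>j. y j - x j)"
  using N_minus[of "\<lambda>j. x j - y j"] c00_diff by simp

lemma N_triangle_diff:
  assumes "x \<in> c00" "y \<in> c00" shows "\<bar>N x - N y\<bar> \<le> N (\<lambda>j. x j - y j)"
  using N_add[OF c00_diff[OF assms] assms(2)] N_add[OF c00_diff[OF assms(2,1)] assms(1)]
    N_diff_commute[OF assms] by simp

lemma cauchy_iff: "cs_cauchy S u \<longleftrightarrow> (\<forall>n. u n \<in> c00) \<and>
     (\<forall>e>0. \<exists>M. \<forall>m\<ge>M. \<forall>n\<ge>M. N (\<lambda>j. u m j - u n j) < e)"
  by (simp add: cs_cauchy_def sequence_space_def cs_diff_def)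

lemma cauchy_c00: "cs_cauchy S u \<Longrightarrow> u n \<in> c00"
  by (simp add: cauchy_iff)

lemma rel_iff: "(u, v) \<in> R \<longleftrightarrow> cs_cauchy S u \<and> cs_cauchy S v \<and>
     (\<lambda>n. N (\<lambda>j. u n j - v n j)) \<longlonglongrightarrow> 0"
  by (simp add: completion_rel_def sequence_space_def cs_diff_def)

lemma equiv_R: "equiv (Collect (cs_cauchy S)) R"
proof (rule equivI)
  show "R \<subseteq> Collect (cs_cauchy S) \<times> Collect (cs_cauchy S)" by (auto simp: rel_iff)
  show "refl_on (Collect (cs_cauchy S)) R"
    by (auto simp: refl_on_def rel_iff N_0)
  show "sym R" unfolding sym_def
  proof (intro allI impI)
    fix u v assume "(u, v) \<in> R"
    moreover from this have "N (\<lambda>j. u n j - v n j) = N (\<lambda>j. v n j - u n j)" for n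
      by (intro N_diff_commute) (auto simp: rel_iff cauchy_c00)
    ultimately show "(v, u) \<in> R" by (simp add: rel_iff)
  qed
  show "trans R" unfolding trans_def
  proof (intro allI impI)
    fix u v w assume A: "(u, v) \<in> R" "(v, w) \<in> R"
    then have c: "u n \<in> c00" "v n \<in> c00" "w n \<in> c00" for n
      by (auto simp: rel_iff cauchy_c00)
    have "(\<lambda>n. N (\<lambda>j. u n j - v n j) + N (\<lambda>j. v n j - w n j)) \<longlonglongrightarrow> 0"
      using A tendsto_add[of "\<lambda>n. N (\<lambda>j. u n j - v n j)" 0 sequentially] by (auto simp: rel_iff)
    then have "(\<lambda>n. N (\<lambda>j. u n j - w n j)) \<longlonglongrightarrow> 0"
      by (rule null_sandwich[rotated 2]) (auto intro: N_nonneg N_diff_triangle c00_diff c)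
    with A show "(u, w) \<in> R" by (simp add: rel_iff)
  qed
qed

lemma class_eq_iff:
  "cs_cauchy S u \<Longrightarrow> cs_cauchy S v \<Longrightarrow>
     R `` {u} = R `` {v} \<longleftrightarrow> (\<lambda>n. N (\<lambda>j. u n j - v n j)) \<longlonglongrightarrow> 0"
  using equiv_class_eq_iff[OF equiv_R, of u v] by (auto simp: rel_iff)

lemma cauchy_add:
  assumes "cs_cauchy S u" "cs_cauchy S v" shows "cs_cauchy S (\<lambda>n j. u n j + v n j)"
  unfolding cauchy_iff
proof (intro conjI allI impI)
  fix n show "(\<lambda>j. u n j + v n j) \<in> c00" using assms by (intro c00_add) (auto simp: cauchy_iff)
next
  fix e :: real assume e: "0 < e"
  from assms(1) e obtain M1 where M1: "\<forall>m\<ge>M1. \<forall>n\<ge>M1. N (\<lambda>j. u m j - u n j) < e/2"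
    unfolding cauchy_iff by (meson half_gt_zero)
  from assms(2) e obtain M2 where M2: "\<forall>m\<ge>M2. \<forall>n\<ge>M2. N (\<lambda>j. v m j - v n j) < e/2"
    unfolding cauchy_iff by (meson half_gt_zero)
  have "N (\<lambda>j. u m j + v m j - (u n j + v n j)) < e" if "m \<ge> max M1 M2" "n \<ge> max M1 M2" for m n
  proof -
    have "N (\<lambda>j. (u m j - u n j) + (v m j - v n j)) \<le> N (\<lambda>j. u m j - u n j) + N (\<lambda>j. v m j - v n j)"
      by (intro N_add c00_diff cauchy_c00 assms)
    moreover have "N (\<lambda>j. u m j - u n j) < e/2" "N (\<lambda>j. v m j - v n j) < e/2"
      using M1 M2 that by auto
    ultimately show ?thesis by (simp add: algebra_simps)
  qed
  then show "\<exists>M. \<forall>m\<ge>M. \<forall>n\<ge>M. N (\<lambda>j. u m j + v m j - (u n j + v n j)) < e" by blast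
qed

lemma cauchy_scale:
  assumes "cs_cauchy S u" shows "cs_cauchy S (\<lambda>n j. a * u n j)"
  unfolding cauchy_iff
proof (intro conjI allI impI)
  fix n show "(\<lambda>j. a * u n j) \<in> c00" using assms by (intro c00_scale) (auto simp: cauchy_iff)
next
  fix e :: real assume e: "0 < e"
  then have "0 < e / (cmod a + 1)" by (intro divide_pos_pos) (auto intro: add_nonneg_pos)
  with assms obtain M where M: "\<forall>m\<ge>M. \<forall>n\<ge>M. N (\<lambda>j. u m j - u n j) < e / (cmod a + 1)"
    unfolding cauchy_iff by meson
  have "N (\<lambda>j. a * u m j - a * u n j) < e" if "m \<ge> M" "n \<ge> M" for m n
  proof -
    have c: "(\<lambda>j. u m j - u n j) \<in> c00" by (intro c00_diff cauchy_c00 assms)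
    have "N (\<lambda>j. a * (u m j - u n j)) = cmod a * N (\<lambda>j. u m j - u n j)" by (rule N_scale[OF c])
    also have "\<dots> \<le> (cmod a + 1) * N (\<lambda>j. u m j - u n j)"
      using N_nonneg[OF c] by (simp add: distrib_right)
    also have "\<dots> < (cmod a + 1) * (e / (cmod a + 1))"
      using M that by (intro mult_strict_left_mono) (auto intro: add_nonneg_pos)
    also have "\<dots> = e" by (metis norm_ge_zero add_nonneg_pos less_irrefl nonzero_mult_div_cancel_left
      times_divide_eq_right zero_less_one)
    finally show ?thesis by (simp add: algebra_simps)
  qed
  then show "\<exists>M. \<forall>m\<ge>M. \<forall>n\<ge>M. N (\<lambda>j. a * u m j - a * u n j) < e" by blast
qed

lemma cauchy_const: "x \<in> c00 \<Longrightarrow> cs_cauchy S (\<lambda>n. x)"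
  by (auto simp: cauchy_iff N_0)

text \<open>The sum of two classes is a union over all representatives. Changing representatives
  changes the sum by a null sequence, so the union consists of copies of a single class.\<close>

lemma add_class:
  assumes u: "cs_cauchy S u" and v: "cs_cauchy S v"
  shows "cs_add E (R `` {u}) (R `` {v}) = R `` {\<lambda>n j. u n j + v n j}"
proof -
  have "R `` {\<lambda>n j. u' n j + v' n j} = R `` {\<lambda>n j. u n j + v n j}"
    if "u' \<in> R `` {u}" "v' \<in> R `` {v}" for u' v'
  proof -
    have r: "(u, u') \<in> R" "(v, v') \<in> R" using that by auto
    then have c: "cs_cauchy S u'" "cs_cauchy S v'" by (auto simp: rel_iff)
    have "(\<lambda>n. N (\<lambda>j. u n j - u' n j) + N (\<lambda>j. v n j - v' n j)) \<longlonglongrightarrow> 0"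
      using r tendsto_add[of "\<lambda>n. N (\<lambda>j. u n j - u' n j)" 0 sequentially] by (auto simp: rel_iff)
    then have "(\<lambda>n. N (\<lambda>j. (u n j - u' n j) + (v n j - v' n j))) \<longlonglongrightarrow> 0"
      by (rule null_sandwich[rotated 2])
        (intro N_nonneg c00_add c00_diff cauchy_c00 u v c N_add)+
    then have "(\<lambda>n. N (\<lambda>j. (u n j + v n j) - (u' n j + v' n j))) \<longlonglongrightarrow> 0"
      by (simp add: algebra_simps)
    then show ?thesis using class_eq_iff[OF cauchy_add[OF u v] cauchy_add[OF c]] by simp
  qed
  moreover have "u \<in> R `` {u}" "v \<in> R `` {v}"
    using u v equiv_class_self[OF equiv_R] by auto
  ultimately have "(\<Union>u'\<in>R `` {u}. \<Union>v'\<in>R `` {v}. R `` {\<lambda>n j. u' n j + v' n j}) =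
      R `` {\<lambda>n j. u n j + v n j}" by blast
  then show ?thesis by (simp add: completion_def sequence_space_def)
qed

lemma scale_class:
  assumes u: "cs_cauchy S u"
  shows "cs_scale E a (R `` {u}) = R `` {\<lambda>n j. a * u n j}"
proof -
  have "R `` {\<lambda>n j. a * u' n j} = R `` {\<lambda>n j. a * u n j}"
    if "u' \<in> R `` {u}" for u'
  proof -
    have r: "(u, u') \<in> R" using that by auto
    then have c: "cs_cauchy S u'" by (auto simp: rel_iff)
    have "(\<lambda>n. cmod a * N (\<lambda>j. u n j - u' n j)) \<longlonglongrightarrow> 0"
      using r tendsto_mult_left[of _ 0 sequentially "cmod a"] by (auto simp: rel_iff)
    moreover have "cmod a * N (\<lambda>j. u n j - u' n j) = N (\<lambda>j. a * u n j - a * u' n j)" for n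
      using N_scale[of "\<lambda>j. u n j - u' n j" a] c00_diff cauchy_c00 u c
      by (simp add: algebra_simps)
    ultimately show ?thesis using class_eq_iff[OF cauchy_scale[OF u, of a] cauchy_scale[OF c, of a]] by simp
  qed
  moreover have "u \<in> R `` {u}"
    using u equiv_class_self[OF equiv_R] by auto
  ultimately have "(\<Union>u'\<in>R `` {u}. R `` {\<lambda>n j. a * u' n j}) = R `` {\<lambda>n j. a * u n j}" by blast
  then show ?thesis by (simp add: completion_def sequence_space_def)
qed

lemma carrier_E: "U \<in> cs_carrier E \<longleftrightarrow> (\<exists>u. cs_cauchy S u \<and> U = R `` {u})"
  by (auto simp: completion_def quotient_def)

lemma zero_E: "cs_zero E = R `` {\<lambda>n j. 0}"
  by (simp add: completion_def sequence_space_def)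

text \<open>The norm of a class is given by a definite description. The limit exists since the norms
  along a Cauchy sequence are Cauchy reals, and equivalent sequences share it.\<close>

lemma norm_tendsto:
  assumes u: "cs_cauchy S u"
  shows "(\<lambda>n. N (u n)) \<longlonglongrightarrow> cs_norm E (R `` {u})"
proof -
  have "Cauchy (\<lambda>n. N (u n))"
  proof (rule metric_CauchyI)
    fix e :: real assume "0 < e"
    with u obtain M where M: "\<forall>m\<ge>M. \<forall>n\<ge>M. N (\<lambda>j. u m j - u n j) < e"
      unfolding cauchy_iff by meson
    have "dist (N (u m)) (N (u n)) < e" if "m \<ge> M" "n \<ge> M" for m n
      using N_triangle_diff[OF cauchy_c00[OF u, of m] cauchy_c00[OF u, of n]] M that
      by (fastforce simp: dist_real_def)
    then show "\<exists>M. \<forall>m\<ge>M. \<forall>n\<ge>M. dist (N (u m)) (N (u n)) < e" by blast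
  qed
  then obtain r where r: "(\<lambda>n. N (u n)) \<longlonglongrightarrow> r"
    using Cauchy_convergent_iff convergent_def by blast
  have uniq: "r' = r" if v: "v \<in> R `` {u}" and lim: "(\<lambda>n. N (v n)) \<longlonglongrightarrow> r'" for v r'
  proof -
    have uv: "(u, v) \<in> R" using v by auto
    then have vl: "(\<lambda>n. N (\<lambda>j. u n j - v n j)) \<longlonglongrightarrow> 0" and v: "cs_cauchy S v" by (auto simp: rel_iff)
    have "\<bar>N (u n) - N (v n)\<bar> \<le> N (\<lambda>j. u n j - v n j)" for n
      by (intro N_triangle_diff cauchy_c00 u v)
    then have "(\<lambda>n. N (u n) - N (v n)) \<longlonglongrightarrow> 0"
      by (intro Lim_null_comparison[OF _ vl]) simp
    then have "(\<lambda>n. N (u n) - (N (u n) - N (v n))) \<longlonglongrightarrow> r - 0" by (intro tendsto_diff r)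
    then show ?thesis using lim LIMSEQ_unique by fastforce
  qed
  have "u \<in> R `` {u}" using u equiv_class_self[OF equiv_R] by auto
  then have "(THE r. \<exists>v\<in>R `` {u}. (\<lambda>n. N (v n)) \<longlonglongrightarrow> r) = r"
    using r uniq by (intro the_equality) blast+
  then show ?thesis using r by (simp add: completion_def sequence_space_def)
qed

lemma diff_class:
  assumes "cs_cauchy S u" "cs_cauchy S v"
  shows "cs_diff E (R `` {u}) (R `` {v}) = R `` {\<lambda>n j. u n j - v n j}"
  unfolding cs_diff_def
  using add_class[OF assms(1) cauchy_scale[OF assms(2), of "-1"]] scale_class[OF assms(2), of "-1"]
  by simp

lemma cauchy_diff:
  assumes "cs_cauchy S u" "cs_cauchy S v" shows "cs_cauchy S (\<lambda>n j. u n j - v n j)"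
  using cauchy_add[OF assms(1) cauchy_scale[OF assms(2), of "-1"]] by simp

lemma embed_eq: "completion_embed S x = R `` {\<lambda>n. x}"
  by (simp add: completion_embed_def)

lemma embed_carrier: "x \<in> c00 \<Longrightarrow> completion_embed S x \<in> cs_carrier E"
  using cauchy_const carrier_E embed_eq by blast

lemma embed_norm: "x \<in> c00 \<Longrightarrow> cs_norm E (completion_embed S x) = N x"
  using norm_tendsto[OF cauchy_const, of x] by (simp add: embed_eq LIMSEQ_const_iff)

lemma embed_dense:
  assumes u: "cs_cauchy S u"
  shows "(\<lambda>n. cs_norm E (cs_diff E (completion_embed S (u n)) (R `` {u}))) \<longlonglongrightarrow> 0"
proof (rule LIMSEQ_I)
  let ?d = "\<lambda>n. cs_norm E (cs_diff E (completion_embed S (u n)) (R `` {u}))"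
  fix e :: real assume e: "0 < e"
  with u obtain M where M: "\<forall>m\<ge>M. \<forall>n\<ge>M. N (\<lambda>j. u m j - u n j) < e/2"
    unfolding cauchy_iff by (meson half_gt_zero)
  have "norm (?d n - 0) < e" if "n \<ge> M" for n
  proof -
    have c: "cs_cauchy S (\<lambda>m. u n)" by (intro cauchy_const cauchy_c00 u)
    have "cs_diff E (completion_embed S (u n)) (R `` {u}) = R `` {\<lambda>m j. u n j - u m j}"
      unfolding embed_eq by (rule diff_class[OF c u])
    then have l: "(\<lambda>m. N (\<lambda>j. u n j - u m j)) \<longlonglongrightarrow> ?d n"
      using norm_tendsto[OF cauchy_diff[OF c u]] by simp
    have "?d n \<le> e/2"
      by (rule LIMSEQ_le_const2[OF l]) (use M that in \<open>auto intro: less_imp_le\<close>)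
    moreover have "0 \<le> ?d n"
      using N_nonneg[OF c00_diff[OF cauchy_c00[OF u] cauchy_c00[OF u]]]
      by (intro LIMSEQ_le_const[OF l]) blast
    ultimately show ?thesis using e by simp
  qed
  then show "\<exists>no. \<forall>n\<ge>no. norm (?d n - 0) < e"
    by blast
qed

text \<open>Partial sums along the unit vectors are embedded truncations; this reduces expansions
  and functionals on the completion to \<open>restr {..<n}\<close>.\<close>

lemma lincomb_embed:
  "cs_lincomb E a (\<lambda>j. completion_embed S (unit_seq j)) n = completion_embed S (restr {..<n} a)"
proof (induction n)
  case 0
  have "restr {..<0} a = (\<lambda>j. 0)" by (auto simp: restr_def)
  then show ?case by (simp add: zero_E embed_eq)
next
  case (Suc n)
  have "cs_scale E (a n) (R `` {\<lambda>m. unit_seq n}) = R `` {\<lambda>m j. a n * unit_seq n j}"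
    by (intro scale_class cauchy_const c00_unit_seq)
  moreover have "cs_add E (R `` {\<lambda>m. restr {..<n} a}) (R `` {\<lambda>m j. a n * unit_seq n j})
      = R `` {\<lambda>m j. restr {..<n} a j + a n * unit_seq n j}"
    by (intro add_class cauchy_const c00_scale c00_restr_finite c00_unit_seq) simp
  moreover have "(\<lambda>j. restr {..<n} a j + a n * unit_seq n j) = restr {..<Suc n} a"
    by (rule ext) (auto simp: restr_def unit_seq_def less_Suc_eq)
  ultimately show ?case using Suc by (simp add: embed_eq)
qed

text \<open>Extension by density: a linear map on \<open>c00\<close> that is bounded above and below
  and has dense range in a complete space extends to an isomorphism of the completion. The freedom
  in T is used later to prepend a coordinate.\<close>

lemma isomorphic_l2:
  fixes T :: "cseq \<Rightarrow> cseq"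
  assumes T: "\<And>a. a \<in> c00 \<Longrightarrow> T a \<in> l2_seqs"
    and T_add: "\<And>a b. a \<in> c00 \<Longrightarrow> b \<in> c00 \<Longrightarrow> T (\<lambda>j. a j + b j) = (\<lambda>j. T a j + T b j)"
    and T_scale: "\<And>a c. a \<in> c00 \<Longrightarrow> T (\<lambda>j. c * a j) = (\<lambda>j. c * T a j)"
    and pos: "0 < c" "0 < C"
    and lower: "\<And>a. a \<in> c00 \<Longrightarrow> c * N a \<le> l2_norm (T a)"
    and upper: "\<And>a. a \<in> c00 \<Longrightarrow> l2_norm (T a) \<le> C * N a"
    and dense: "\<And>x e. x \<in> l2_seqs \<Longrightarrow> 0 < e \<Longrightarrow> \<exists>a\<in>c00. l2_norm (\<lambda>j. T a j - x j) < e"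
  shows "isomorphic E l2_space"
proof -
  have T_diff: "T (\<lambda>j. a j - b j) = (\<lambda>j. T a j - T b j)" if "a \<in> c00" "b \<in> c00" for a b
    using T_add[of a "\<lambda>j. (-1) * b j"] T_scale[of b "-1"] c00_scale[of b "-1"] that by simp
  \<comment> \<open>The graph of the extension: x is the limit of the images along the
    representative u.\<close>
  define conv where "conv u x \<longleftrightarrow> x \<in> l2_seqs \<and> (\<lambda>n. l2_norm (\<lambda>j. T (u n) j - x j)) \<longlonglongrightarrow> 0" for u x
  have conv_ex: "\<exists>x. conv u x" if u: "cs_cauchy S u" for u
  proof -
    have "\<exists>M. \<forall>m\<ge>M. \<forall>n\<ge>M. l2_norm (\<lambda>j. T (u m) j - T (u n) j) < e" if "0 < e" for e
    proof -
      from \<open>0 < e\<close> pos have "0 < e / C" by simp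
      with u obtain M where M: "\<forall>m\<ge>M. \<forall>n\<ge>M. N (\<lambda>j. u m j - u n j) < e / C"
        unfolding cauchy_iff by meson
      have "l2_norm (\<lambda>j. T (u m) j - T (u n) j) < e" if "m \<ge> M" "n \<ge> M" for m n
      proof -
        have "N (\<lambda>j. u m j - u n j) < e / C" using M that by blast
        then have "C * N (\<lambda>j. u m j - u n j) < e" using pos by (simp add: field_simps)
        then show ?thesis
          using upper[OF c00_diff[OF cauchy_c00[OF u, of m] cauchy_c00[OF u, of n]]]
          by (simp add: T_diff cauchy_c00[OF u])
      qed
      then show ?thesis by blast
    qed
    then show ?thesis unfolding conv_def
      using l2_complete[of "\<lambda>n. T (u n)"] T cauchy_c00[OF u] by blast
  qed
  have conv_uniq: "x = y" if uv: "(u, v) \<in> R" and x: "conv u x" and y: "conv v y" for u v x y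
  proof -
    have c: "cs_cauchy S u" "cs_cauchy S v" using uv by (auto simp: rel_iff)
    note m = c00_diff[OF cauchy_c00[OF c(1)] cauchy_c00[OF c(2)]]
    have "(\<lambda>n. C * N (\<lambda>j. u n j - v n j)) \<longlonglongrightarrow> 0"
      using uv tendsto_mult_left[of _ 0 sequentially C] by (auto simp: rel_iff)
    moreover have "l2_norm (\<lambda>j. T (u n) j - T (v n) j) \<le> C * N (\<lambda>j. u n j - v n j)" for n
      using upper[OF m[of n n]] by (simp add: T_diff cauchy_c00 c)
    ultimately have "(\<lambda>n. l2_norm (\<lambda>j. T (u n) j - x j) + C * N (\<lambda>j. u n j - v n j) +
        l2_norm (\<lambda>j. T (v n) j - y j)) \<longlonglongrightarrow> 0 + 0 + 0"
      using x y unfolding conv_def by (intro tendsto_add) auto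
    moreover have "l2_norm (\<lambda>j. x j - y j) \<le> l2_norm (\<lambda>j. T (u n) j - x j) +
        C * N (\<lambda>j. u n j - v n j) + l2_norm (\<lambda>j. T (v n) j - y j)" for n
    proof -
      have l: "T (u n) \<in> l2_seqs" "T (v n) \<in> l2_seqs" "x \<in> l2_seqs" "y \<in> l2_seqs"
        using x y T cauchy_c00 c by (auto simp: conv_def)
      have "l2_le (l2_norm (\<lambda>j. T (u n) j - T (v n) j) + l2_norm (\<lambda>j. T (v n) j - y j)
              + l2_norm (\<lambda>j. T (u n) j - x j))
         (\<lambda>j. (T (u n) j - T (v n) j) + (T (v n) j - y j) - (T (u n) j - x j))"
        by (intro l2_le_add l2_le_diff l2_leI l2_diff l)
      then show ?thesis
        using upper[OF m[of n n]] by (auto dest!: l2_leD(2) simp: T_diff cauchy_c00 c)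
    qed
    ultimately have "l2_norm (\<lambda>j. x j - y j) \<le> 0"
      by (intro LIMSEQ_le_const[where a = "l2_norm (\<lambda>j. x j - y j)"]) auto
    moreover have d: "(\<lambda>j. x j - y j) \<in> l2_seqs" using x y by (auto simp: conv_def intro: l2_diff)
    ultimately have "(\<lambda>j. x j - y j) = (\<lambda>j. 0)"
      using l2_norm_nonneg[OF d] l2_norm_eq_0[OF d] by simp
    then show ?thesis by (metis ext eq_iff_diff_eq_0)
  qed
  \<comment> \<open>The choice ranges over all representatives, so f is a function of the class;
    \<open>conv_uniq\<close> makes the chosen value independent of the representative.\<close>
  define f where "f U = (SOME x. \<exists>u\<in>U. conv u x)" for U
  have f_eq: "f (R `` {u}) = x" if u: "cs_cauchy S u" and x: "conv u x" for u x
  proof -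
    have uu: "u \<in> R `` {u}" using u equiv_class_self[OF equiv_R] by auto
    then have "\<exists>v\<in>R `` {u}. conv v (f (R `` {u}))"
      unfolding f_def using x by (intro someI_ex[where P = "\<lambda>x. \<exists>u\<in>R `` {u}. conv u x" for u]) blast
    then obtain v where "(u, v) \<in> R" "conv v (f (R `` {u}))" by auto
    then show ?thesis using conv_uniq x by metis
  qed
  have f_conv: "conv u (f (R `` {u}))" if "cs_cauchy S u" for u
    using conv_ex[OF that] f_eq[OF that] by metis
  have norms: "c * cs_norm E (R `` {u}) \<le> l2_norm (f (R `` {u})) \<and>
      l2_norm (f (R `` {u})) \<le> C * cs_norm E (R `` {u})"
    if u: "cs_cauchy S u" for u
  proof -
    note fc = f_conv[OF u, unfolded conv_def]
    have "\<bar>l2_norm (T (u n)) - l2_norm (f (R `` {u}))\<bar> \<le> l2_norm (\<lambda>j. T (u n) j - f (R `` {u}) j)" for n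
      by (intro l2_norm_triangle_diff T cauchy_c00 u conjunct1[OF fc])
    then have "(\<lambda>n. l2_norm (T (u n)) - l2_norm (f (R `` {u}))) \<longlonglongrightarrow> 0"
      by (intro Lim_null_comparison[OF _ conjunct2[OF fc]]) simp
    then have l: "(\<lambda>n. l2_norm (T (u n))) \<longlonglongrightarrow> l2_norm (f (R `` {u}))"
      by (simp add: LIM_zero_iff)
    note nt = norm_tendsto[OF u]
    show ?thesis
      by (intro conjI LIMSEQ_le[OF tendsto_mult_left[OF nt] l] LIMSEQ_le[OF l tendsto_mult_left[OF nt]])
        (use upper lower cauchy_c00[OF u] in auto)
  qed
  have lin: "cs_linear E l2_space f" unfolding cs_linear_def
  proof (intro conjI ballI allI)
    fix U assume "U \<in> cs_carrier E"
    then obtain u where u: "cs_cauchy S u" "U = R `` {u}" by (auto simp: carrier_E)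
    then show "f U \<in> cs_carrier l2_space"
      using f_conv[OF u(1)] by (simp add: conv_def l2_space_def sequence_space_def)
    fix a
    note fc = f_conv[OF u(1)]
    have "conv (\<lambda>n j. a * u n j) (\<lambda>j. a * f U j)" unfolding conv_def
    proof
      show "(\<lambda>j. a * f U j) \<in> l2_seqs" using fc u(2) by (auto simp: conv_def intro: l2_scale)
      have "l2_norm (\<lambda>j. T (\<lambda>j. a * u n j) j - a * f U j) = cmod a * l2_norm (\<lambda>j. T (u n) j - f U j)" for n
      proof -
        have "(\<lambda>j. T (u n) j - f U j) \<in> l2_seqs"
          using fc u(2) by (intro l2_diff T cauchy_c00 u) (simp add: conv_def)
        from l2_norm_scale[OF this, of a] show ?thesis
          by (simp add: T_scale cauchy_c00[OF u(1)] algebra_simps)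
      qed
      moreover have "(\<lambda>n. cmod a * l2_norm (\<lambda>j. T (u n) j - f U j)) \<longlonglongrightarrow> cmod a * 0"
        using fc u by (intro tendsto_mult_left) (auto simp: conv_def)
      ultimately show "(\<lambda>n. l2_norm (\<lambda>j. T (\<lambda>j. a * u n j) j - a * f U j)) \<longlonglongrightarrow> 0" by simp
    qed
    then have "f (cs_scale E a U) = (\<lambda>j. a * f U j)"
      using f_eq[OF cauchy_scale[OF u(1)]] u by (simp add: scale_class)
    then show "f (cs_scale E a U) = cs_scale l2_space a (f U)"
      by (simp add: l2_space_def sequence_space_def)
  next
    fix U V assume "U \<in> cs_carrier E" "V \<in> cs_carrier E"
    then obtain u v where u: "cs_cauchy S u" "U = R `` {u}" and v: "cs_cauchy S v" "V = R `` {v}"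
      by (auto simp: carrier_E)
    note fc = f_conv[OF u(1), folded u(2)] f_conv[OF v(1), folded v(2)]
    have "conv (\<lambda>n j. u n j + v n j) (\<lambda>j. f U j + f V j)" unfolding conv_def
    proof
      show "(\<lambda>j. f U j + f V j) \<in> l2_seqs" using fc by (auto simp: conv_def intro: l2_add)
      have le: "l2_le (l2_norm (\<lambda>j. T (u n) j - f U j) + l2_norm (\<lambda>j. T (v n) j - f V j))
          (\<lambda>j. T (\<lambda>j. u n j + v n j) j - (f U j + f V j))" for n
      proof -
        have "l2_le (l2_norm (\<lambda>j. T (u n) j - f U j) + l2_norm (\<lambda>j. T (v n) j - f V j))
          (\<lambda>j. (T (u n) j - f U j) + (T (v n) j - f V j))"
          using fc by (intro l2_le_add l2_leI l2_diff T cauchy_c00 u v) (auto simp: conv_def)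
        then show ?thesis by (simp add: T_add cauchy_c00 u v algebra_simps)
      qed
      have "(\<lambda>n. l2_norm (\<lambda>j. T (u n) j - f U j) + l2_norm (\<lambda>j. T (v n) j - f V j)) \<longlonglongrightarrow> 0 + 0"
        using fc by (intro tendsto_add) (auto simp: conv_def)
      then show "(\<lambda>n. l2_norm (\<lambda>j. T (\<lambda>j. u n j + v n j) j - (f U j + f V j))) \<longlonglongrightarrow> 0"
        using le by (intro null_sandwich[where f = "\<lambda>n. l2_norm (\<lambda>j. T (\<lambda>j. u n j + v n j) j - (f U j + f V j))"])
          (auto dest: l2_leD intro!: l2_norm_nonneg)
    qed
    then have "f (cs_add E U V) = (\<lambda>j. f U j + f V j)"
      using f_eq[OF cauchy_add[OF u(1) v(1)]] u v by (simp add: add_class)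
    then show "f (cs_add E U V) = cs_add l2_space (f U) (f V)"
      by (simp add: l2_space_def sequence_space_def)
  qed
  have inj: "inj_on f (cs_carrier E)"
  proof (rule inj_onI)
    fix U V assume "U \<in> cs_carrier E" "V \<in> cs_carrier E" and eq: "f U = f V"
    then obtain u v where u: "cs_cauchy S u" "U = R `` {u}" and v: "cs_cauchy S v" "V = R `` {v}"
      by (auto simp: carrier_E)
    note fc = f_conv[OF u(1), folded u(2)] f_conv[OF v(1), folded v(2), folded eq]
    have fl: "f U \<in> l2_seqs" using fc by (auto simp: conv_def)
    have lim: "(\<lambda>n. (l2_norm (\<lambda>j. T (u n) j - f U j) + l2_norm (\<lambda>j. T (v n) j - f U j)) / c) \<longlonglongrightarrow> (0 + 0) / c"
      using fc pos by (intro tendsto_divide tendsto_add) (auto simp: conv_def)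
    have le: "N (\<lambda>j. u n j - v n j) \<le>
        (l2_norm (\<lambda>j. T (u n) j - f U j) + l2_norm (\<lambda>j. T (v n) j - f U j)) / c" for n
    proof -
      have "l2_le (l2_norm (\<lambda>j. T (u n) j - f U j) + l2_norm (\<lambda>j. T (v n) j - f U j))
          (\<lambda>j. (T (u n) j - f U j) - (T (v n) j - f U j))"
        by (intro l2_le_diff l2_leI l2_diff T cauchy_c00 u v fl)
      then have "l2_norm (\<lambda>j. T (u n) j - T (v n) j) \<le>
          l2_norm (\<lambda>j. T (u n) j - f U j) + l2_norm (\<lambda>j. T (v n) j - f U j)"
        by (auto dest: l2_leD)
      moreover have "c * N (\<lambda>j. u n j - v n j) \<le> l2_norm (\<lambda>j. T (u n) j - T (v n) j)"
        using lower[OF c00_diff[OF cauchy_c00[OF u(1), of n] cauchy_c00[OF v(1), of n]]]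
        by (simp add: T_diff cauchy_c00 u v)
      ultimately show ?thesis using pos by (simp add: field_simps)
    qed
    have nn: "0 \<le> N (\<lambda>j. u n j - v n j)" for n
      by (intro N_nonneg c00_diff cauchy_c00 u v)
    have "(\<lambda>n. N (\<lambda>j. u n j - v n j)) \<longlonglongrightarrow> 0"
      by (rule null_sandwich[OF nn le]) (use lim in simp)
    then show "U = V" using u v class_eq_iff by simp
  qed
  \<comment> \<open>Dense range gives images converging to x; the lower bound turns the preimages
    into a Cauchy sequence.\<close>
  have surj: "l2_seqs \<subseteq> f ` cs_carrier E"
  proof
    fix x assume x: "x \<in> l2_seqs"
    have "\<forall>n. \<exists>a\<in>c00. l2_norm (\<lambda>j. T a j - x j) < 1 / real (Suc n)"
      using dense[OF x] by simp
    then obtain u where u: "\<And>n. u n \<in> c00" "\<And>n. l2_norm (\<lambda>j. T (u n) j - x j) < 1 / real (Suc n)"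
      by metis
    have lim: "(\<lambda>n. l2_norm (\<lambda>j. T (u n) j - x j)) \<longlonglongrightarrow> 0"
      by (rule null_sandwich[OF _ _ LIMSEQ_Suc[OF lim_1_over_n]])
        (intro l2_norm_nonneg l2_diff T x u less_imp_le[OF u(2)])+
    have "cs_cauchy S u" unfolding cauchy_iff
    proof (intro conjI allI impI u)
      fix e :: real assume "0 < e"
      then have "0 < c * e / 2" using pos by simp
      from LIMSEQ_D[OF lim this] obtain M where
        M: "\<And>n. n \<ge> M \<Longrightarrow> l2_norm (\<lambda>j. T (u n) j - x j) < c * e / 2" by fastforce
      have "N (\<lambda>j. u m j - u n j) < e" if "m \<ge> M" "n \<ge> M" for m n
      proof -
        have "l2_le (l2_norm (\<lambda>j. T (u m) j - x j) + l2_norm (\<lambda>j. T (u n) j - x j))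
          (\<lambda>j. (T (u m) j - x j) - (T (u n) j - x j))"
          by (intro l2_le_diff l2_leI l2_diff T u x)
        then have "l2_norm (\<lambda>j. T (u m) j - T (u n) j) \<le>
            l2_norm (\<lambda>j. T (u m) j - x j) + l2_norm (\<lambda>j. T (u n) j - x j)"
          by (auto dest: l2_leD)
        then have "c * N (\<lambda>j. u m j - u n j) < c * e"
          using lower[OF c00_diff[OF u(1)[of m] u(1)[of n]]] M[OF that(1)] M[OF that(2)]
          by (simp add: T_diff u)
        then show ?thesis using pos by simp
      qed
      then show "\<exists>M. \<forall>m\<ge>M. \<forall>n\<ge>M. N (\<lambda>j. u m j - u n j) < e" by blast
    qed
    moreover from this have "f (R `` {u}) = x" using lim x by (intro f_eq) (auto simp: conv_def)
    ultimately show "x \<in> f ` cs_carrier E" using carrier_E by blast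
  qed
  have crr: "cs_carrier l2_space = l2_seqs"
    by (simp add: l2_space_def sequence_space_def)
  have "bij_betw f (cs_carrier E) (cs_carrier l2_space)"
    unfolding bij_betw_def
    using inj surj lin crr by (auto simp: cs_linear_def)
  moreover have nrm: "cs_norm l2_space x = l2_norm x" for x
    by (simp add: l2_space_def sequence_space_def)
  moreover have "equivalent_on (cs_carrier E) (\<lambda>x. cs_norm l2_space (f x)) (cs_norm E)"
    unfolding equivalent_on_def
    by (intro exI[of _ c] exI[of _ C])
      (use norms pos nrm in \<open>auto simp: carrier_E\<close>)
  ultimately show ?thesis using lin unfolding isomorphic_def by blast
qed

end


section \<open>Tsirelson's norm\<close>

lemma restr_add: "restr A (\<lambda>j. x j + y j) = (\<lambda>j. restr A x j + restr A y j)"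
  by (rule ext) (simp add: restr_def)

lemma restr_scale: "restr A (\<lambda>j. a * x j) = (\<lambda>j. a * restr A x j)"
  by (rule ext) (simp add: restr_def)

lemma restr_diff: "restr A (\<lambda>j. x j - y j) = (\<lambda>j. restr A x j - restr A y j)"
  by (rule ext) (simp add: restr_def)

lemma restr_sum: "restr A (\<lambda>j. \<Sum>i\<in>I. x i j) = (\<lambda>j. \<Sum>i\<in>I. restr A (x i) j)"
  by (rule ext) (simp add: restr_def)

lemma restr_restr: "restr A (restr B x) = restr (A \<inter> B) x"
  by (rule ext) (simp add: restr_def)

lemma c00_sum: "(\<And>i. i \<in> I \<Longrightarrow> x i \<in> c00) \<Longrightarrow> (\<lambda>j. \<Sum>i\<in>I. x i j) \<in> c00"
  by (induction I rule: infinite_finite_induct) (simp_all add: c00_zero c00_add)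

lemma admissible_less:
  assumes "admissible k A" "i < j" "j < k"
  shows "Max (A i) < Min (A j)"
  using assms(2,3)
proof (induction j)
  case (Suc j)
  have step: "Max (A j) < Min (A (Suc j))" using assms(1) Suc.prems by (auto simp: admissible_def)
  show ?case
  proof (cases "i = j")
    case False
    then have "Max (A i) < Min (A j)" using Suc by simp
    moreover have "Min (A j) \<le> Max (A j)"
      using assms(1) Suc.prems by (auto simp: admissible_def)
    ultimately show ?thesis using step by simp
  qed (use step in simp)
qed simp

lemma admissible_disjoint:
  assumes "admissible k A" "i < k" "j < k" "i \<noteq> j"
  shows "A i \<inter> A j = {}"
proof -
  have "A i \<inter> A j = {}" if "i < j" "j < k" for i j
  proof (rule ccontr)
    assume "A i \<inter> A j \<noteq> {}"
    then obtain m where m: "m \<in> A i" "m \<in> A j" by blast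
    have "finite (A i)" "finite (A j)" using assms(1) that by (auto simp: admissible_def)
    then have "m \<le> Max (A i)" "Min (A j) \<le> m" using m by auto
    then show False using admissible_less[OF assms(1) that] by simp
  qed
  then show ?thesis using assms(2-4) by (metis Int_commute nat_neq_iff)
qed

lemma admissible_finite: "admissible k A \<Longrightarrow> i < k \<Longrightarrow> finite (A i)"
  by (auto simp: admissible_def)

section \<open>The Tsirelson approximations and their limit\<close>

definition l1 :: "cseq \<Rightarrow> real" where
  "l1 x = (\<Sum>j\<in>{j. x j \<noteq> 0}. cmod (x j))"

lemma l1_eq:
  assumes "finite A" "\<And>j. j \<notin> A \<Longrightarrow> x j = 0"
  shows "l1 x = (\<Sum>j\<in>A. cmod (x j))"
  unfolding l1_def by (rule sum.mono_neutral_left) (use assms in auto)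

lemma l1_admissible:
  assumes A: "admissible k A" and x: "x \<in> c00"
  shows "(\<Sum>i<k. l1 (restr (A i) x)) \<le> l1 x"
proof -
  have "(\<Sum>i<k. l1 (restr (A i) x)) = (\<Sum>i<k. \<Sum>j\<in>A i. cmod (x j))"
  proof (rule sum.cong)
    fix i assume "i \<in> {..<k}"
    then have "l1 (restr (A i) x) = (\<Sum>j\<in>A i. cmod (restr (A i) x j))"
      using admissible_finite[OF A] by (intro l1_eq) (auto simp: restr_def)
    then show "l1 (restr (A i) x) = (\<Sum>j\<in>A i. cmod (x j))" by (simp add: restr_def)
  qed simp
  also have "\<dots> = (\<Sum>j\<in>(\<Union>i<k. A i). cmod (x j))"
    using admissible_finite[OF A] admissible_disjoint[OF A]
    by (intro sum.UNION_disjoint[symmetric]) auto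
  also have "\<dots> \<le> (\<Sum>j\<in>(\<Union>i<k. A i) \<union> {j. x j \<noteq> 0}. cmod (x j))"
    using admissible_finite[OF A] x by (intro sum_mono2) (auto simp: c00_def)
  also have "\<dots> = l1 x"
    using admissible_finite[OF A] x by (intro l1_eq[symmetric]) (auto simp: c00_def)
  finally show ?thesis .
qed

text \<open>The invariant of the induction over the approximations. The bound by \<open>l1\<close>
  keeps every supremum finite and makes the increasing approximations converge. Homogeneity is kept
  as an inequality, since scaling back by the inverse yields equality in the limit.\<close>

definition lattice_seminorm_le_l1 :: "(cseq \<Rightarrow> real) \<Rightarrow> bool" where
  "lattice_seminorm_le_l1 f \<longleftrightarrow>
     (\<forall>x\<in>c00. 0 \<le> f x \<and> f x \<le> l1 x) \<and>
     (\<forall>x\<in>c00. \<forall>y\<in>c00. (\<forall>j. cmod (x j) \<le> cmod (y j)) \<longrightarrow> f x \<le> f y) \<and>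
     (\<forall>x\<in>c00. \<forall>y\<in>c00. f (\<lambda>j. x j + y j) \<le> f x + f y) \<and>
     (\<forall>x\<in>c00. \<forall>a. f (\<lambda>j. a * x j) \<le> cmod a * f x)"

lemma admissible_1: "admissible 1 (\<lambda>_. {0})"
  by (simp add: admissible_def)

text \<open>A real \<open>Sup\<close> says something only about nonempty bounded sets. Nonemptiness
  comes from a one-block family, boundedness from the disjointness of admissible blocks and the
  additivity of \<open>l1\<close> over them.\<close>

lemma Sup_admissible:
  assumes f: "lattice_seminorm_le_l1 f" and x: "x \<in> c00"
  defines "T \<equiv> \<lambda>x. {\<Sum>j<k. f (restr (A j) x) | k A. admissible k A}"
  shows "\<And>k A. admissible k A \<Longrightarrow> (\<Sum>j<k. f (restr (A j) x)) \<le> Sup (T x)"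
    and "(\<And>k A. admissible k A \<Longrightarrow> (\<Sum>j<k. f (restr (A j) x)) \<le> K) \<Longrightarrow> Sup (T x) \<le> K"
    and "Sup (T x) \<le> l1 x" and "0 \<le> Sup (T x)"
proof -
  have le: "(\<Sum>j<k. f (restr (A j) x)) \<le> l1 x" if "admissible k A" for k A
  proof -
    have "(\<Sum>j<k. f (restr (A j) x)) \<le> (\<Sum>i<k. l1 (restr (A i) x))"
      using f c00_restr[OF x] by (intro sum_mono) (auto simp: lattice_seminorm_le_l1_def)
    then show ?thesis using l1_admissible[OF that x] by simp
  qed
  then have bdd: "bdd_above (T x)" unfolding T_def bdd_above_def by blast
  have ne: "T x \<noteq> {}" unfolding T_def using admissible_1 by blast
  show up: "(\<Sum>j<k. f (restr (A j) x)) \<le> Sup (T x)" if "admissible k A" for k A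
    by (rule cSup_upper[OF _ bdd]) (use that in \<open>auto simp: T_def\<close>)
  show least: "Sup (T x) \<le> K"
    if "\<And>k A. admissible k A \<Longrightarrow> (\<Sum>j<k. f (restr (A j) x)) \<le> K" for K
    by (rule cSup_least[OF ne]) (use that in \<open>auto simp: T_def\<close>)
  show "Sup (T x) \<le> l1 x" using least le by blast
  have "0 \<le> (\<Sum>j<(1::nat). f (restr ((\<lambda>_. {0}) j) x))"
    using f c00_restr[OF x] by (auto simp: lattice_seminorm_le_l1_def)
  also have "\<dots> \<le> Sup (T x)" by (rule up[OF admissible_1])
  finally show "0 \<le> Sup (T x)" .
qed

lemma approx_seminorm: "lattice_seminorm_le_l1 (tsirelson_approx n)"
proof (induction n)
  case 0
  have ub: "cmod (x j) \<le> l1 x" if "x \<in> c00" for x j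
  proof (cases "x j = 0")
    case False
    then show ?thesis using that unfolding l1_def c00_def
      by (intro member_le_sum[of j "{j. x j \<noteq> 0}" "\<lambda>j. cmod (x j)"]) auto
  qed (simp add: l1_def sum_nonneg)
  have bdd: "bdd_above (range (\<lambda>j. cmod (x j)))" if "x \<in> c00" for x
    using ub[OF that] unfolding bdd_above_def by blast
  have up: "cmod (x j) \<le> (SUP j. cmod (x j))" if "x \<in> c00" for x j
    by (rule cSUP_upper[OF _ bdd[OF that]]) simp
  have "0 \<le> (SUP j. cmod (x j))" if "x \<in> c00" for x
    using up[OF that, of 0] norm_ge_zero order_trans by blast
  then show ?case unfolding lattice_seminorm_le_l1_def tsirelson_approx.simps
    by (intro conjI ballI allI impI cSUP_least UNIV_not_empty)
      (use ub up in \<open>auto simp: norm_mult intro: order_trans norm_triangle_mono mult_left_mono\<close>)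
next
  case (Suc n)
  let ?f = "tsirelson_approx n"
  let ?T = "\<lambda>x. {\<Sum>j<k. ?f (restr (A j) x) | k A. admissible k A}"
  note S = Sup_admissible[OF Suc]
  have max_add: "max a (1/2 * s) \<le> max b (1/2 * t) + max c (1/2 * u)"
    if "s \<le> t + u" "a \<le> b + c" for a b c s t u :: real
    using that by (auto simp: max_def)
  note f = Suc[unfolded lattice_seminorm_le_l1_def]
  show ?case unfolding lattice_seminorm_le_l1_def
  proof (intro conjI ballI allI impI)
    fix x :: cseq assume x: "x \<in> c00"
    note fx = f[THEN conjunct1, rule_format, OF x]
    show "0 \<le> tsirelson_approx (Suc n) x" using fx by auto
    show "tsirelson_approx (Suc n) x \<le> l1 x" using fx S(3,4)[OF x] by auto
    { fix y assume y: "y \<in> c00" and le: "\<forall>j. cmod (x j) \<le> cmod (y j)"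
      have m: "?f (restr A x) \<le> ?f (restr A y)" for A
        using f c00_restr[OF x] c00_restr[OF y] le by (auto simp: restr_def)
      have "Sup (?T x) \<le> Sup (?T y)"
        by (rule S(2)[OF x]) (use m in \<open>auto intro!: order_trans[OF _ S(1)[OF y]] sum_mono\<close>)
      moreover have "?f x \<le> ?f y" using f x y le by blast
      ultimately show "tsirelson_approx (Suc n) x \<le> tsirelson_approx (Suc n) y"
        by auto }
    { fix y assume y: "y \<in> c00"
      have m: "?f (restr A (\<lambda>j. x j + y j)) \<le> ?f (restr A x) + ?f (restr A y)" for A
        using f c00_restr[OF x] c00_restr[OF y] by (simp add: restr_add)
      have "Sup (?T (\<lambda>j. x j + y j)) \<le> Sup (?T x) + Sup (?T y)"
      proof (rule S(2)[OF c00_add[OF x y]])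
        fix k A assume A: "admissible k A"
        have "(\<Sum>j<k. ?f (restr (A j) (\<lambda>j. x j + y j))) \<le>
            (\<Sum>j<k. ?f (restr (A j) x)) + (\<Sum>j<k. ?f (restr (A j) y))"
          unfolding sum.distrib[symmetric] by (intro sum_mono m)
        then show "(\<Sum>j<k. ?f (restr (A j) (\<lambda>j. x j + y j))) \<le> Sup (?T x) + Sup (?T y)"
          using S(1)[OF x A] S(1)[OF y A] by linarith
      qed
      moreover have "?f (\<lambda>j. x j + y j) \<le> ?f x + ?f y" using f x y by blast
      ultimately show "tsirelson_approx (Suc n) (\<lambda>j. x j + y j) \<le>
          tsirelson_approx (Suc n) x + tsirelson_approx (Suc n) y"
        unfolding tsirelson_approx.simps by (intro max_add) }
    { fix a
      have m: "?f (restr A (\<lambda>j. a * x j)) \<le> cmod a * ?f (restr A x)" for A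
        using f c00_restr[OF x] by (simp add: restr_scale)
      have "Sup (?T (\<lambda>j. a * x j)) \<le> cmod a * Sup (?T x)"
      proof (rule S(2)[OF c00_scale[OF x]])
        fix k A assume A: "admissible k A"
        have "(\<Sum>j<k. ?f (restr (A j) (\<lambda>j. a * x j))) \<le> cmod a * (\<Sum>j<k. ?f (restr (A j) x))"
          unfolding sum_distrib_left by (intro sum_mono m)
        also have "\<dots> \<le> cmod a * Sup (?T x)" by (intro mult_left_mono S(1)[OF x A]) simp
        finally show "(\<Sum>j<k. ?f (restr (A j) (\<lambda>j. a * x j))) \<le> cmod a * Sup (?T x)" .
      qed
      moreover have "?f (\<lambda>j. a * x j) \<le> cmod a * ?f x" using f x by blast
      moreover have "cmod a * max (?f x) (1/2 * Sup (?T x)) =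
          max (cmod a * ?f x) (1/2 * (cmod a * Sup (?T x)))"
        by (simp add: max_mult_distrib_left)
      ultimately show "tsirelson_approx (Suc n) (\<lambda>j. a * x j) \<le> cmod a * tsirelson_approx (Suc n) x"
        unfolding tsirelson_approx.simps by (simp add: max.coboundedI1 max.coboundedI2) }
  qed
qed

lemma approx_limit:
  assumes x: "x \<in> c00"
  shows "(\<lambda>n. tsirelson_approx n x) \<longlonglongrightarrow> tsirelson_norm x"
    and "tsirelson_approx n x \<le> tsirelson_norm x"
proof -
  have inc: "incseq (\<lambda>n. tsirelson_approx n x)" by (rule incseq_SucI) simp
  have le: "tsirelson_approx n x \<le> l1 x" for n
    using approx_seminorm[of n] x by (auto simp: lattice_seminorm_le_l1_def)
  obtain L where L: "(\<lambda>n. tsirelson_approx n x) \<longlonglongrightarrow> L"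
    using incseq_convergent[OF inc, of "l1 x"] le by blast
  then show l: "(\<lambda>n. tsirelson_approx n x) \<longlonglongrightarrow> tsirelson_norm x"
    by (simp add: tsirelson_norm_def limI)
  show "tsirelson_approx n x \<le> tsirelson_norm x" by (rule incseq_le[OF inc l])
qed

lemma tsirelson_nonneg: "x \<in> c00 \<Longrightarrow> 0 \<le> tsirelson_norm x"
  using approx_limit(2)[of x 0] approx_seminorm[of 0]
  unfolding lattice_seminorm_le_l1_def by fastforce

lemma tsirelson_mono:
  assumes "x \<in> c00" "y \<in> c00" "\<And>j. cmod (x j) \<le> cmod (y j)"
  shows "tsirelson_norm x \<le> tsirelson_norm y"
  using approx_seminorm assms
  by (intro LIMSEQ_le[OF approx_limit(1) approx_limit(1)]) (auto simp: lattice_seminorm_le_l1_def)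

lemma tsirelson_add:
  assumes "x \<in> c00" "y \<in> c00"
  shows "tsirelson_norm (\<lambda>j. x j + y j) \<le> tsirelson_norm x + tsirelson_norm y"
  using approx_seminorm assms
  by (intro LIMSEQ_le[OF approx_limit(1) tendsto_add[OF approx_limit(1) approx_limit(1)]])
    (auto simp: lattice_seminorm_le_l1_def c00_add)

lemma tsirelson_scale_le:
  assumes "x \<in> c00"
  shows "tsirelson_norm (\<lambda>j. a * x j) \<le> cmod a * tsirelson_norm x"
  using approx_seminorm assms
  by (intro LIMSEQ_le[OF approx_limit(1) tendsto_mult_left[OF approx_limit(1)]])
    (auto simp: lattice_seminorm_le_l1_def c00_scale)

lemma tsirelson_scale:
  assumes x: "x \<in> c00"
  shows "tsirelson_norm (\<lambda>j. a * x j) = cmod a * tsirelson_norm x"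
proof (cases "a = 0")
  case True
  then show ?thesis using tsirelson_scale_le[OF x, of 0] tsirelson_nonneg[OF c00_zero] by simp
next
  case False
  have "tsirelson_norm x \<le> cmod (inverse a) * tsirelson_norm (\<lambda>j. a * x j)"
    using tsirelson_scale_le[OF c00_scale[OF x, of a], of "inverse a"] False by (simp add: mult.assoc[symmetric])
  then have "cmod a * tsirelson_norm x \<le> tsirelson_norm (\<lambda>j. a * x j)"
    using False by (simp add: norm_inverse norm_divide field_simps)
  then show ?thesis using tsirelson_scale_le[OF x, of a] by simp
qed

lemma tsirelson_sum:
  fixes k :: nat
  assumes "\<And>i. i < k \<Longrightarrow> x i \<in> c00"
  shows "tsirelson_norm (\<lambda>j. \<Sum>i<k. x i j) \<le> (\<Sum>i<k. tsirelson_norm (x i))"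
  using assms
proof (induction k)
  case 0
  then show ?case using tsirelson_scale_le[OF c00_zero, of 0] by simp
next
  case (Suc k)
  have "tsirelson_norm (\<lambda>j. (\<Sum>i<k. x i j) + x k j) \<le>
      tsirelson_norm (\<lambda>j. \<Sum>i<k. x i j) + tsirelson_norm (x k)"
    by (intro tsirelson_add c00_sum) (use Suc in auto)
  then show ?case using Suc by fastforce
qed

lemma tsirelson_coord:
  assumes x: "x \<in> c00" shows "cmod (x j) \<le> tsirelson_norm x"
proof -
  have "finite (range (\<lambda>j. cmod (x j)))"
    by (rule finite_subset[of _ "insert 0 ((\<lambda>j. cmod (x j)) ` {j. x j \<noteq> 0})"])
      (use x in \<open>auto simp: c00_def\<close>)
  then have "cmod (x j) \<le> tsirelson_approx 0 x"
    by (auto intro!: cSUP_upper bdd_above_finite)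
  then show ?thesis using approx_limit(2)[OF x, of 0] by linarith
qed

text \<open>The sum at level n is one of the competitors at level n + 1. The factor 2 is the inverse
  of the 1/2 in the recursion.\<close>

lemma tsirelson_lower:
  assumes x: "x \<in> c00" and A: "admissible k A"
  shows "(\<Sum>i<k. tsirelson_norm (restr (A i) x)) \<le> 2 * tsirelson_norm x"
proof -
  have "(\<Sum>i<k. tsirelson_approx n (restr (A i) x)) \<le> 2 * tsirelson_norm x" for n
  proof -
    have "(\<Sum>i<k. tsirelson_approx n (restr (A i) x)) \<le> 2 * tsirelson_approx (Suc n) x"
      using Sup_admissible(1)[OF approx_seminorm x A, of n] by simp
    then show ?thesis using approx_limit(2)[OF x, of "Suc n"] by linarith
  qed
  moreover have "(\<lambda>n. \<Sum>i<k. tsirelson_approx n (restr (A i) x)) \<longlonglongrightarrow>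
      (\<Sum>i<k. tsirelson_norm (restr (A i) x))"
    by (intro tendsto_sum approx_limit(1) c00_restr x)
  ultimately show ?thesis by (meson LIMSEQ_le_const2)
qed

section \<open>The 2-convexified norm and its 2-estimates\<close>

abbreviation (input) "t2norm \<equiv> tsirelson2_norm"

definition sq :: "cseq \<Rightarrow> cseq" where
  "sq x = (\<lambda>j. of_real ((cmod (x j))\<^sup>2))"

lemma sq_c00: "x \<in> c00 \<Longrightarrow> sq x \<in> c00"
  by (simp add: c00_def sq_def)

lemma sq_restr: "sq (restr A x) = restr A (sq x)"
  by (rule ext) (simp add: restr_def sq_def)

lemma cmod_sq: "cmod (sq x j) = (cmod (x j))\<^sup>2"
  unfolding sq_def norm_of_real by simp

lemma t2_eq: "t2norm x = sqrt (tsirelson_norm (sq x))"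
  by (simp add: tsirelson2_norm_def sq_def)

lemma t2_sq: "x \<in> c00 \<Longrightarrow> (t2norm x)\<^sup>2 = tsirelson_norm (sq x)"
  by (simp add: t2_eq tsirelson_nonneg sq_c00)

lemma t2_nonneg: "x \<in> c00 \<Longrightarrow> 0 \<le> t2norm x"
  by (simp add: t2_eq tsirelson_nonneg sq_c00)

lemma t2_scale:
  assumes x: "x \<in> c00"
  shows "t2norm (\<lambda>j. a * x j) = cmod a * t2norm x"
proof -
  have "sq (\<lambda>j. a * x j) = (\<lambda>j. of_real ((cmod a)\<^sup>2) * sq x j)"
    by (simp add: sq_def norm_mult power_mult_distrib)
  then have "tsirelson_norm (sq (\<lambda>j. a * x j)) = cmod (of_real ((cmod a)\<^sup>2)) * tsirelson_norm (sq x)"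
    using tsirelson_scale[OF sq_c00[OF x]] by simp
  moreover have "cmod (of_real ((cmod a)\<^sup>2)) = (cmod a)\<^sup>2" unfolding norm_of_real by simp
  ultimately show ?thesis by (simp add: t2_eq real_sqrt_mult)
qed

lemma t2_mono:
  assumes "x \<in> c00" "y \<in> c00" "\<And>j. cmod (x j) \<le> cmod (y j)"
  shows "t2norm x \<le> t2norm y"
  unfolding t2_eq
  by (intro real_sqrt_le_mono tsirelson_mono sq_c00 assms(1,2)) (simp add: cmod_sq power_mono assms(3))

lemma t2_coord:
  assumes x: "x \<in> c00" shows "cmod (x j) \<le> t2norm x"
  unfolding t2_eq using tsirelson_coord[OF sq_c00[OF x], of j]
  by (intro real_le_rsqrt) (simp add: cmod_sq)

text \<open>Pointwise, \<open>(a + b)^2 <= (1 + s) * a^2 + (1 + 1/s) * b^2\<close> for every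
  \<open>s > 0\<close>, so the triangle inequality of the Tsirelson norm applies to the squares; s
  is then optimised.\<close>

lemma t2_add:
  assumes x: "x \<in> c00" and y: "y \<in> c00"
  shows "t2norm (\<lambda>j. x j + y j) \<le> t2norm x + t2norm y"
proof (cases "t2norm x = 0 \<or> t2norm y = 0")
  case True
  \<comment> \<open>The norm dominates every coordinate, so norm 0 forces the zero sequence; this
    removes the case in which s would be 0 or undefined.\<close>
  have "z = (\<lambda>j. 0)" if "t2norm z = 0" "z \<in> c00" for z
    using t2_coord[OF that(2)] that(1) by (intro ext) simp
  then consider "x = (\<lambda>j. 0)" | "y = (\<lambda>j. 0)" using True x y by blast
  then show ?thesis by cases (use x y t2_nonneg in simp_all)
next
  case False
  define p where "p = t2norm x"
  define q where "q = t2norm y"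
  have pq: "0 < p" "0 < q" using False t2_nonneg x y unfolding p_def q_def by (auto simp: less_le)
  \<comment> \<open>This s minimises \<open>(1 + s) * p^2 + (1 + 1/s) * q^2\<close>, with minimum
    \<open>(p + q)^2\<close>.\<close>
  define s where "s = q / p"
  have s: "0 < s" using pq by (simp add: s_def)
  have pt: "(cmod (x j + y j))\<^sup>2 \<le> (1 + s) * (cmod (x j))\<^sup>2 + (1 + 1/s) * (cmod (y j))\<^sup>2" for j
  proof -
    have "(cmod (x j + y j))\<^sup>2 \<le> (cmod (x j) + cmod (y j))\<^sup>2"
      by (intro power_mono norm_triangle_ineq) simp
    moreover have "(1 + s) * (cmod (x j))\<^sup>2 + (1 + 1/s) * (cmod (y j))\<^sup>2 - (cmod (x j) + cmod (y j))\<^sup>2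
        = (s * cmod (x j) - cmod (y j))\<^sup>2 / s"
      using s by (simp add: field_simps power2_eq_square)
    moreover have "0 \<le> (s * cmod (x j) - cmod (y j))\<^sup>2 / s" using s by simp
    ultimately show ?thesis by linarith
  qed
  let ?z = "\<lambda>j. of_real (1 + s) * sq x j + of_real (1 + 1/s) * sq y j"
  have zc: "?z \<in> c00" by (intro c00_add c00_scale sq_c00 x y)
  have le: "cmod (sq (\<lambda>j. x j + y j) j) \<le> cmod (?z j)" for j
  proof -
    have "?z j = of_real ((1 + s) * (cmod (x j))\<^sup>2 + (1 + 1/s) * (cmod (y j))\<^sup>2)"
      by (simp add: sq_def)
    then have "cmod (?z j) = \<bar>(1 + s) * (cmod (x j))\<^sup>2 + (1 + 1/s) * (cmod (y j))\<^sup>2\<bar>"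
      by (metis norm_of_real)
    then show ?thesis using pt[of j] by (simp add: cmod_sq)
  qed
  have cs: "cmod (of_real (1 + s)) = 1 + s" "cmod (of_real (1 + 1/s)) = 1 + 1/s"
    unfolding norm_of_real using s by auto
  have "tsirelson_norm (sq (\<lambda>j. x j + y j)) \<le> tsirelson_norm ?z"
    by (intro tsirelson_mono sq_c00 c00_add x y zc le)
  also have "\<dots> \<le> tsirelson_norm (\<lambda>j. of_real (1 + s) * sq x j) + tsirelson_norm (\<lambda>j. of_real (1 + 1/s) * sq y j)"
    by (intro tsirelson_add c00_scale sq_c00 x y)
  also have "\<dots> = (1 + s) * p\<^sup>2 + (1 + 1/s) * q\<^sup>2"
    by (simp only: tsirelson_scale[OF sq_c00[OF x]] tsirelson_scale[OF sq_c00[OF y]] cs p_def q_def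
        t2_sq[OF x] t2_sq[OF y])
  also have "\<dots> = (p + q)\<^sup>2"
    using pq by (simp add: s_def field_simps power2_eq_square)
  finally have "tsirelson_norm (sq (\<lambda>j. x j + y j)) \<le> (p + q)\<^sup>2" .
  then have "sqrt (tsirelson_norm (sq (\<lambda>j. x j + y j))) \<le> p + q"
    using pq by (intro real_le_lsqrt) auto
  then show ?thesis by (simp add: t2_eq p_def q_def)
qed

interpretation t2: c00_seminorm t2norm
  by unfold_locales (simp_all add: t2_scale t2_add)

lemma sum_disjoint_restr:
  fixes k :: nat
  assumes "\<And>i i'. i < k \<Longrightarrow> i' < k \<Longrightarrow> i \<noteq> i' \<Longrightarrow> A i \<inter> A i' = {}"
  shows "(\<Sum>i<k. restr (A i) (y i) j) = (if \<exists>i<k. j \<in> A i then y (THE i. i < k \<and> j \<in> A i) j else 0)"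
proof (cases "\<exists>i<k. j \<in> A i")
  case True
  then obtain i where i: "i < k" "j \<in> A i" by blast
  have u: "i' = i" if "i' < k" "j \<in> A i'" for i' using assms[of i i'] i that by blast
  have "(THE i. i < k \<and> j \<in> A i) = i" using i u by blast
  moreover have "restr (A i') (y i') j = (if i' = i then y i j else 0)" if "i' < k" for i'
    using u[OF that] i(2) by (cases "i' = i") (simp_all add: restr_def, blast)
  then have "(\<Sum>i'<k. restr (A i') (y i') j) = (\<Sum>i'<k. if i' = i then y i j else 0)"
    by simp
  ultimately show ?thesis using i by auto
qed (auto simp: restr_def intro!: sum.neutral)

lemma sq_sum_disjoint:
  fixes k :: nat
  assumes "\<And>i i'. i < k \<Longrightarrow> i' < k \<Longrightarrow> i \<noteq> i' \<Longrightarrow> A i \<inter> A i' = {}"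
  shows "sq (\<lambda>j. \<Sum>i<k. restr (A i) (y i) j) = (\<lambda>j. \<Sum>i<k. restr (A i) (sq (y i)) j)"
proof
  fix j
  show "sq (\<lambda>j. \<Sum>i<k. restr (A i) (y i) j) j = (\<Sum>i<k. restr (A i) (sq (y i)) j)"
    unfolding sum_disjoint_restr[OF assms] by (auto simp: sq_def sum_disjoint_restr[OF assms])
qed

text \<open>Squaring turns a disjoint sum into the sum of the squares, and the triangle inequality
  of the Tsirelson norm becomes an upper 2-estimate with constant 1. No admissibility is
  involved.\<close>

lemma t2_upper:
  fixes k :: nat
  assumes "\<And>i i'. i < k \<Longrightarrow> i' < k \<Longrightarrow> i \<noteq> i' \<Longrightarrow> A i \<inter> A i' = {}"
    and y: "\<And>i. i < k \<Longrightarrow> y i \<in> c00"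
  shows "t2norm (\<lambda>j. \<Sum>i<k. restr (A i) (y i) j) \<le>
    L2_set (\<lambda>i. t2norm (restr (A i) (y i))) {..<k}"
proof -
  have "tsirelson_norm (\<lambda>j. \<Sum>i<k. restr (A i) (sq (y i)) j) \<le>
      (\<Sum>i<k. tsirelson_norm (restr (A i) (sq (y i))))"
    by (intro tsirelson_sum c00_restr sq_c00 y)
  also have "\<dots> = (\<Sum>i<k. (t2norm (restr (A i) (y i)))\<^sup>2)"
    by (rule sum.cong) (simp_all add: t2_sq c00_restr y sq_restr)
  finally show ?thesis unfolding L2_set_def t2_eq[of "\<lambda>j. \<Sum>i<k. restr (A i) (y i) j"]
    by (subst sq_sum_disjoint) (use assms(1) in auto)
qed

text \<open>The lower 1-estimate applied to the squares; \<open>sqrt 2\<close> is the root of its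
  factor 2.\<close>

lemma t2_lower:
  assumes x: "x \<in> c00" and A: "admissible k A"
  shows "L2_set (\<lambda>i. t2norm (restr (A i) x)) {..<k} \<le> sqrt 2 * t2norm x"
proof -
  have "(\<Sum>i<k. (t2norm (restr (A i) x))\<^sup>2) = (\<Sum>i<k. tsirelson_norm (restr (A i) (sq x)))"
    by (rule sum.cong) (simp_all add: t2_sq c00_restr x sq_restr)
  also have "\<dots> \<le> 2 * tsirelson_norm (sq x)" by (rule tsirelson_lower[OF sq_c00[OF x] A])
  finally show ?thesis unfolding L2_set_def t2_eq[of x]
    by (simp add: real_sqrt_mult[symmetric])
qed


section \<open>The sequence spaces of the convexified Tsirelson space and of its dual\<close>

context c00_seminorm
begin

abbreviation "d U V \<equiv> cs_norm E (cs_diff E U V)"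

lemma d_tendsto:
  assumes "cs_cauchy S u" "cs_cauchy S v"
  shows "(\<lambda>n. N (\<lambda>j. u n j - v n j)) \<longlonglongrightarrow> d (R `` {u}) (R `` {v})"
  using norm_tendsto[OF cauchy_diff[OF assms]] by (simp add: diff_class[OF assms])

lemma scale_carrier: "U \<in> cs_carrier E \<Longrightarrow> cs_scale E a U \<in> cs_carrier E"
  by (metis carrier_E scale_class cauchy_scale)

lemma diff_carrier: "U \<in> cs_carrier E \<Longrightarrow> V \<in> cs_carrier E \<Longrightarrow> cs_diff E U V \<in> cs_carrier E"
  unfolding carrier_E using diff_class cauchy_diff by blast

lemma norm_carrier_nonneg:
  assumes "U \<in> cs_carrier E" shows "0 \<le> cs_norm E U"
proof -
  obtain u where u: "cs_cauchy S u" "U = R `` {u}" using assms carrier_E by blast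
  then show ?thesis
    using LIMSEQ_le_const[OF norm_tendsto[OF u(1)], of 0] N_nonneg[OF cauchy_c00[OF u(1)]] by blast
qed

lemma d_triangle:
  assumes "U \<in> cs_carrier E" "V \<in> cs_carrier E" "W \<in> cs_carrier E"
  shows "d U V \<le> d W U + d W V"
proof -
  obtain u v w where u: "cs_cauchy S u" "U = R `` {u}" and v: "cs_cauchy S v" "V = R `` {v}"
    and w: "cs_cauchy S w" "W = R `` {w}" using assms by (auto simp: carrier_E)
  have "N (\<lambda>j. u n j - v n j) \<le> N (\<lambda>j. w n j - u n j) + N (\<lambda>j. w n j - v n j)" for n
    using N_diff_triangle[OF cauchy_c00[OF u(1), of n] cauchy_c00[OF w(1), of n] cauchy_c00[OF v(1), of n]]
      N_diff_commute[OF cauchy_c00[OF u(1), of n] cauchy_c00[OF w(1), of n]] by simp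
  then show ?thesis unfolding u(2) v(2) w(2)
    by (intro LIMSEQ_le[OF d_tendsto[OF u(1) v(1)] tendsto_add[OF d_tendsto[OF w(1) u(1)] d_tendsto[OF w(1) v(1)]]])
      blast
qed

lemma d_eq_0:
  assumes "U \<in> cs_carrier E" "V \<in> cs_carrier E" "d U V \<le> 0"
  shows "U = V"
proof -
  obtain u v where u: "cs_cauchy S u" "U = R `` {u}" and v: "cs_cauchy S v" "V = R `` {v}"
    using assms by (auto simp: carrier_E)
  have "0 \<le> N (\<lambda>j. u n j - v n j)" for n by (intro N_nonneg c00_diff cauchy_c00 u v)
  then have "0 \<le> d U V" unfolding u(2) v(2)
    by (intro LIMSEQ_le_const[OF d_tendsto[OF u(1) v(1)]]) blast
  then have "d U V = 0" using assms(3) by simp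
  then show ?thesis using d_tendsto[OF u(1) v(1)] class_eq_iff[OF u(1) v(1)] u(2) v(2) by simp
qed

lemma norm_d:
  assumes "U \<in> cs_carrier E" "V \<in> cs_carrier E"
  shows "\<bar>cs_norm E U - cs_norm E V\<bar> \<le> d U V"
proof -
  obtain u v where u: "cs_cauchy S u" "U = R `` {u}" and v: "cs_cauchy S v" "V = R `` {v}"
    using assms by (auto simp: carrier_E)
  have "\<bar>N (u n) - N (v n)\<bar> \<le> N (\<lambda>j. u n j - v n j)" for n
    by (intro N_triangle_diff cauchy_c00 u v)
  then show ?thesis unfolding u(2) v(2)
    by (intro LIMSEQ_le[OF tendsto_rabs[OF tendsto_diff[OF norm_tendsto[OF u(1)] norm_tendsto[OF v(1)]]]
          d_tendsto[OF u(1) v(1)]]) blast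
qed

abbreviation "basis \<equiv> \<lambda>j. completion_embed S (unit_seq j)"

text \<open>The norm of a coefficient sequence is that of the vector it expands, chosen by a
  definite description; uniqueness of limits in the completion justifies the choice. The result
  expresses the norm by finite truncations.\<close>

lemma coefficient_norm_tendsto:
  assumes "a \<in> cs_carrier (coefficient_space E basis)"
  shows "(\<lambda>n. N (restr {..<n} a)) \<longlonglongrightarrow> cs_norm (coefficient_space E basis) a"
proof -
  from assms obtain x where x: "basis_expansion E basis a x"
    by (auto simp: coefficient_space_def sequence_space_def)
  have dx: "(\<lambda>n. d (completion_embed S (restr {..<n} a)) x) \<longlonglongrightarrow> 0" "x \<in> cs_carrier E"
    if "basis_expansion E basis a x" for x
    using that by (auto simp: basis_expansion_def cs_tendsto_def lincomb_embed)
  have c: "restr {..<n} a \<in> c00" for n by (simp add: c00_restr_finite)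
  have uniq: "y = x" if y: "basis_expansion E basis a y" for y
  proof -
    have "(\<lambda>n. d (completion_embed S (restr {..<n} a)) y + d (completion_embed S (restr {..<n} a)) x) \<longlonglongrightarrow> 0 + 0"
      by (intro tendsto_add dx(1) x y)
    moreover have "d y x \<le> d (completion_embed S (restr {..<n} a)) y + d (completion_embed S (restr {..<n} a)) x" for n
      by (intro d_triangle dx(2) x y embed_carrier c)
    ultimately have "d y x \<le> 0" by (intro LIMSEQ_le_const[where a = "d y x"]) auto
    then show ?thesis by (intro d_eq_0 dx(2) x y)
  qed
  have "(THE x. basis_expansion E basis a x) = x" by (rule the_equality) (fact x, fact uniq)
  then have n: "cs_norm (coefficient_space E basis) a = cs_norm E x"
    by (simp add: coefficient_space_def sequence_space_def)
  have "\<bar>cs_norm E (completion_embed S (restr {..<n} a)) - cs_norm E x\<bar> \<le>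
      d (completion_embed S (restr {..<n} a)) x" for n
    by (intro norm_d embed_carrier c dx(2) x)
  then have "(\<lambda>n. N (restr {..<n} a) - cs_norm E x) \<longlonglongrightarrow> 0"
    by (intro Lim_null_comparison[OF _ dx(1)[OF x]]) (simp add: embed_norm c)
  then show ?thesis by (simp add: n LIM_zero_iff)
qed

lemma functional_embed:
  assumes f: "f \<in> functionals E"
  shows "f (completion_embed S (restr {..<n} a)) = (\<Sum>j<n. a j * f (basis j))"
proof -
  have cc: "cs_lincomb E a basis n \<in> cs_carrier E" for n
    by (simp add: lincomb_embed embed_carrier c00_restr_finite)
  have sc: "cs_scale E b (basis j) \<in> cs_carrier E" for b j
    by (intro scale_carrier embed_carrier c00_unit_seq)
  have z: "f (cs_zero E) = 0"
  proof -
    have "cs_scale E 0 (cs_zero E) = cs_zero E"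
      using scale_class[OF cauchy_const[OF c00_zero], of 0] by (simp add: zero_E)
    moreover have "cs_zero E \<in> cs_carrier E" using cc[of 0] by simp
    ultimately show ?thesis using f unfolding functionals_def by (metis (mono_tags, lifting) mem_Collect_eq mult_zero_left)
  qed
  have "f (cs_lincomb E a basis n) = (\<Sum>j<n. a j * f (basis j))"
  proof (induction n)
    case (Suc n)
    have "f (cs_add E (cs_lincomb E a basis n) (cs_scale E (a n) (basis n))) =
        f (cs_lincomb E a basis n) + f (cs_scale E (a n) (basis n))"
      using f cc sc unfolding functionals_def by blast
    moreover have "f (cs_scale E (a n) (basis n)) = a n * f (basis n)"
      using f embed_carrier[OF c00_unit_seq] unfolding functionals_def by blast
    ultimately show ?case using Suc by simp
  qed (simp add: z)
  then show ?thesis by (simp add: lincomb_embed)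
qed

text \<open>Embedded finitely supported sequences are dense and the functionals are bounded. This
  makes the description of the norm in \<open>dual_sequence_space\<close> well defined.\<close>

lemma functional_unique:
  assumes f: "f \<in> functionals E" and g: "g \<in> functionals E"
    and eq: "\<And>j. f (basis j) = g (basis j)" and U: "U \<in> cs_carrier E"
  shows "f U = g U"
proof -
  obtain u where u: "cs_cauchy S u" "U = R `` {u}" using U by (auto simp: carrier_E)
  obtain K where K: "\<forall>x\<in>cs_carrier E. cmod (f x) \<le> K * cs_norm E x" using f by (auto simp: functionals_def)
  obtain K' where K': "\<forall>x\<in>cs_carrier E. cmod (g x) \<le> K' * cs_norm E x" using g by (auto simp: functionals_def)
  let ?e = "\<lambda>n. completion_embed S (u n)"
  have fe: "f (?e n) = g (?e n)" for n
  proof -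
    obtain m where "restr {..<m} (u n) = u n" using c00_bounded_support[OF cauchy_c00[OF u(1)]] by blast
    then show ?thesis using functional_embed[OF f, of m "u n"] functional_embed[OF g, of m "u n"] eq by simp
  qed
  have ec: "?e n \<in> cs_carrier E" for n by (intro embed_carrier cauchy_c00 u)
  have sc: "cs_scale E (-1) U \<in> cs_carrier E"
    by (rule scale_carrier[OF U])
  have dc: "cs_diff E (?e n) U \<in> cs_carrier E" for n
    by (intro diff_carrier ec U)
  have lin: "h (cs_diff E (?e n) U) = h (?e n) - h U" if "h \<in> functionals E" for h n
  proof -
    have "h (cs_add E (?e n) (cs_scale E (-1) U)) = h (?e n) + h (cs_scale E (-1) U)"
      using that ec sc unfolding functionals_def by blast
    moreover have "h (cs_scale E (-1) U) = (-1) * h U"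
      using that U unfolding functionals_def by blast
    ultimately show ?thesis by (simp add: cs_diff_def)
  qed
  have "cmod (f U - g U) \<le> (K + K') * d (?e n) U" for n
  proof -
    have "f U - g U = g (cs_diff E (?e n) U) - f (cs_diff E (?e n) U)" by (simp add: lin f g fe)
    then have "cmod (f U - g U) \<le> cmod (g (cs_diff E (?e n) U)) + cmod (f (cs_diff E (?e n) U))"
      by (simp add: norm_triangle_ineq4)
    moreover have "cmod (g (cs_diff E (?e n) U)) \<le> K' * d (?e n) U" using K' dc by blast
    moreover have "cmod (f (cs_diff E (?e n) U)) \<le> K * d (?e n) U" using K dc by blast
    ultimately show ?thesis by (simp add: distrib_right)
  qed
  moreover have "(\<lambda>n. (K + K') * d (?e n) U) \<longlonglongrightarrow> (K + K') * 0"
    using embed_dense[OF u(1)] u(2) by (intro tendsto_mult_left) simp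
  ultimately have "cmod (f U - g U) \<le> (K + K') * 0"
    by (intro LIMSEQ_le_const[where a = "cmod (f U - g U)"]) auto
  then show ?thesis by simp
qed

text \<open>U is scaled to norm 1, where the supremum applies. For norm 0 the boundedness constant
  of f gives the value 0 directly.\<close>

lemma functional_norm_bound:
  assumes f: "f \<in> functionals E" and U: "U \<in> cs_carrier E"
  shows "cmod (f U) \<le> functional_norm E f * cs_norm E U"
proof -
  obtain K where K: "\<forall>x\<in>cs_carrier E. cmod (f x) \<le> K * cs_norm E x" using f by (auto simp: functionals_def)
  obtain u where u: "cs_cauchy S u" "U = R `` {u}" using U by (auto simp: carrier_E)
  note nn = norm_carrier_nonneg
  show ?thesis
  proof (cases "cs_norm E U = 0")
    case True
    then show ?thesis using K U by force
  next
    case False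
    then have pos: "0 < cs_norm E U" using nn[OF U] by simp
    define V where "V = cs_scale E (of_real (1 / cs_norm E U)) U"
    have V: "V = R `` {\<lambda>n j. of_real (1 / cs_norm E U) * u n j}" using scale_class[OF u(1)] u(2) V_def by simp
    have Vc: "V \<in> cs_carrier E" using V cauchy_scale[OF u(1)] carrier_E by blast
    have "(\<lambda>n. N (\<lambda>j. of_real (1 / cs_norm E U) * u n j)) \<longlonglongrightarrow> cs_norm E V"
      unfolding V by (rule norm_tendsto[OF cauchy_scale[OF u(1)]])
    moreover have "N (\<lambda>j. of_real (1 / cs_norm E U) * u n j) = (1 / cs_norm E U) * N (u n)" for n
      using N_scale[OF cauchy_c00[OF u(1)], of "of_real (1 / cs_norm E U)"] pos
      unfolding norm_of_real by simp
    moreover have "(\<lambda>n. (1 / cs_norm E U) * N (u n)) \<longlonglongrightarrow> (1 / cs_norm E U) * cs_norm E U"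
      using norm_tendsto[OF u(1)] u(2) by (intro tendsto_mult_left) simp
    ultimately have "cs_norm E V = 1" using pos LIMSEQ_unique by fastforce
    moreover have "cmod (f x) \<le> \<bar>K\<bar>" if "x \<in> cs_carrier E" "cs_norm E x \<le> 1" for x
    proof -
      have "K * cs_norm E x \<le> \<bar>K\<bar> * 1" using nn[OF that(1)] that(2) by (intro mult_mono) auto
      then show ?thesis using K that(1) by fastforce
    qed
    ultimately have "cmod (f V) \<le> functional_norm E f"
      unfolding functional_norm_def using Vc
      by (intro cSUP_upper) (auto simp: bdd_above_def)
    moreover have "f V = of_real (1 / cs_norm E U) * f U"
      unfolding V_def using f U unfolding functionals_def by blast
    ultimately show ?thesis using pos by (simp add: norm_mult norm_divide field_simps)
  qed
qed

text \<open>Evaluation of the represented functional on an embedded truncation. This is the form in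
  which the dual norm is used on the right boundary line.\<close>

lemma dual_bound:
  assumes "y \<in> cs_carrier (dual_sequence_space E basis)"
  shows "cmod (\<Sum>j<n. a j * y j) \<le> cs_norm (dual_sequence_space E basis) y * N (restr {..<n} a)"
proof -
  from assms obtain f where f: "f \<in> functionals E" "\<forall>j. y j = f (basis j)"
    by (auto simp: dual_sequence_space_def sequence_space_def)
  have "functional_norm E g = functional_norm E f" if g: "g \<in> functionals E" "\<forall>j. y j = g (basis j)" for g
    unfolding functional_norm_def using functional_unique[OF g(1) f(1)] f(2) g(2)
    by (intro SUP_cong) auto
  then have "(THE r. \<exists>f\<in>functionals E. (\<forall>j. y j = f (basis j)) \<and> r = functional_norm E f) = functional_norm E f"
    using f by (intro the_equality) blast+
  then have n: "cs_norm (dual_sequence_space E basis) y = functional_norm E f"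
    by (simp add: dual_sequence_space_def sequence_space_def)
  have "(\<Sum>j<n. a j * y j) = f (completion_embed S (restr {..<n} a))"
    using functional_embed[OF f(1)] f(2) by simp
  then show ?thesis
    using functional_norm_bound[OF f(1) embed_carrier[OF c00_restr_finite[of "{..<n}" a]]]
    by (simp add: n embed_norm c00_restr_finite)
qed

end

abbreviation (input) "X2 \<equiv> coefficient_space tsirelson2 tsirelson2_basis"
abbreviation (input) "Y2 \<equiv> dual_sequence_space tsirelson2 tsirelson2_basis"

lemma tsirelson2_basis_eq:
  "tsirelson2_basis = (\<lambda>j. completion_embed (sequence_space c00 t2norm) (unit_seq j))"
  by (rule ext) (simp add: tsirelson2_basis_def)

text \<open>Since the norm is monotone in the moduli of the coordinates, the norms of the
  truncations increase to their limit.\<close>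

lemma X2_bound:
  assumes "a \<in> cs_carrier X2"
  shows "t2norm (restr {..<n} a) \<le> cs_norm X2 a"
proof -
  have "(\<lambda>n. t2norm (restr {..<n} a)) \<longlonglongrightarrow> cs_norm X2 a"
    using t2.coefficient_norm_tendsto assms unfolding tsirelson2_def tsirelson2_basis_eq by blast
  moreover have "incseq (\<lambda>n. t2norm (restr {..<n} a))"
    by (rule incseq_SucI, rule t2_mono) (simp_all add: c00_restr_finite, simp add: restr_def)
  ultimately show ?thesis by (rule incseq_le[rotated])
qed

lemma Y2_bound:
  assumes "y \<in> cs_carrier Y2"
  shows "cmod (\<Sum>j<n. a j * y j) \<le> cs_norm Y2 y * t2norm (restr {..<n} a)"
  using t2.dual_bound assms unfolding tsirelson2_def tsirelson2_basis_eq by blast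


section \<open>Analytic functions on the strip\<close>

definition ostrip :: "complex set" where
  "ostrip = {z. 0 < Re z \<and> Re z < 1}"

lemma ostrip_open: "open ostrip"
  unfolding ostrip_def by (intro open_Collect_conj open_Collect_less continuous_intros)

lemma ostrip_subset: "ostrip \<subseteq> strip" "ostrip \<subseteq> interior strip"
proof -
  show "ostrip \<subseteq> strip" by (auto simp: ostrip_def strip_def)
  then show "ostrip \<subseteq> interior strip" using ostrip_open by (simp add: interior_maximal)
qed

lemma half_in_ostrip: "1/2 \<in> ostrip"
  by (simp add: ostrip_def)

text \<open>The Phragmen-Lindelof factor \<open>exp (e * (z\<^sup>2 - 1))\<close> is at most \<open>1\<close> on the strip and decays at
  infinity, which reduces the claim to the maximum principle on a rectangle.\<close>

lemma three_lines:
  assumes cont: "continuous_on strip h" and hol: "h holomorphic_on ostrip"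
    and bdd: "bounded (h ` strip)"
    and m0: "\<And>t::real. cmod (h (\<i> * t)) \<le> m" and m1: "\<And>t::real. cmod (h (1 + \<i> * t)) \<le> m"
    and z: "z \<in> strip"
  shows "cmod (h z) \<le> m"
proof (rule field_le_epsilon)
  fix \<delta> :: real assume \<delta>: "0 < \<delta>"
  have m: "0 \<le> m" using m0[of 0] norm_ge_zero order_trans by blast
  obtain K where K: "\<And>w. w \<in> strip \<Longrightarrow> cmod (h w) \<le> K"
    using bdd unfolding bounded_iff by blast
  have K0: "0 \<le> K" using K[OF z] norm_ge_zero order_trans by blast
  have key: "cmod (h z) * exp (e * ((Re z)\<^sup>2 - (Im z)\<^sup>2 - 1)) \<le> m + \<delta>" if e: "0 < e" for e
  proof -
    define f where "f w = h w * exp (of_real e * (w\<^sup>2 - 1))" for w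
    have nf: "cmod (f w) = cmod (h w) * exp (e * ((Re w)\<^sup>2 - (Im w)\<^sup>2 - 1))" for w
      unfolding f_def norm_mult norm_exp_eq_Re by (simp add: power2_eq_square)
    \<comment> \<open>The rectangle contains z, and its horizontal sides are harmless:
      \<open>K <= r * (e * (m + \<delta>))\<close> and \<open>1 <= r\<close> give
      \<open>K * exp (- (e * r^2)) <= m + \<delta>\<close>. The summand \<delta> keeps the
      denominator positive.\<close>
    define r where "r = \<bar>Im z\<bar> + 1 + K / (e * (m + \<delta>))"
    have r: "1 \<le> r" "\<bar>Im z\<bar> \<le> r" "K / (e * (m + \<delta>)) \<le> r"
      using K0 m \<delta> e unfolding r_def by (auto intro!: add_nonneg_nonneg divide_nonneg_pos mult_pos_pos)
    define Q where "Q = cbox (Complex 0 (- r)) (Complex 1 r)"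
    have Q: "w \<in> Q \<longleftrightarrow> 0 \<le> Re w \<and> Re w \<le> 1 \<and> - r \<le> Im w \<and> Im w \<le> r" for w
      by (auto simp: Q_def in_cbox_complex_iff)
    have Qi: "w \<in> interior Q \<longleftrightarrow> 0 < Re w \<and> Re w < 1 \<and> - r < Im w \<and> Im w < r" for w
      by (auto simp: Q_def in_box_complex_iff)
    have "cmod (f z) \<le> m + \<delta>"
    proof (rule maximum_modulus_frontier[of f Q])
      have "f holomorphic_on ostrip" unfolding f_def by (intro holomorphic_intros hol)
      then show "f holomorphic_on interior Q"
        by (rule holomorphic_on_subset) (auto simp: Qi ostrip_def)
      have "continuous_on strip f" unfolding f_def by (intro continuous_intros cont)
      moreover have "closure Q = Q" by (simp add: Q_def)
      ultimately show "continuous_on (closure Q) f"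
        by (auto elim!: continuous_on_subset simp: Q strip_def)
      show "bounded Q" by (simp add: Q_def)
      show "z \<in> Q" using z r(2) by (auto simp: Q strip_def)
      fix w assume "w \<in> frontier Q"
      then have w: "w \<in> Q" "w \<notin> interior Q" by (auto simp: frontier_def Q_def)
      then have ws: "w \<in> strip" by (auto simp: Q strip_def)
      from w consider "Re w = 0" | "Re w = 1" | "\<bar>Im w\<bar> = r" by (force simp: Q Qi)
      then show "cmod (f w) \<le> m + \<delta>"
      proof cases
        case 1
        then have "w = \<i> * of_real (Im w)" by (simp add: complex_eq_iff)
        then have "cmod (h w) \<le> m" using m0[of "Im w"] by simp
        moreover have "exp (e * ((Re w)\<^sup>2 - (Im w)\<^sup>2 - 1)) \<le> 1" using 1 mult_nonneg_nonpos[of e "- (Im w)\<^sup>2 - 1"] e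
            zero_le_power2[of "Im w"] by (simp del: zero_le_power2)
        ultimately show ?thesis unfolding nf using \<delta> mult_left_le[OF _ norm_ge_zero[of "h w"]] by fastforce
      next
        case 2
        then have "w = 1 + \<i> * of_real (Im w)" by (simp add: complex_eq_iff)
        then have "cmod (h w) \<le> m" using m1[of "Im w"] by simp
        moreover have "exp (e * ((Re w)\<^sup>2 - (Im w)\<^sup>2 - 1)) \<le> 1" using 2 mult_nonneg_nonpos[of e "- (Im w)\<^sup>2"] e by simp
        ultimately show ?thesis unfolding nf using \<delta> mult_left_le[OF _ norm_ge_zero[of "h w"]] by fastforce
      next
        case 3
        have "(Im w)\<^sup>2 = r\<^sup>2" using 3 by (metis power2_abs)
        moreover have "(Re w)\<^sup>2 \<le> 1" using w(1) by (simp add: Q power_le_one)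
        ultimately have "exp (e * ((Re w)\<^sup>2 - (Im w)\<^sup>2 - 1)) \<le> exp (- (e * r\<^sup>2))"
          using e by (simp add: algebra_simps)
        then have "cmod (f w) \<le> K * exp (- (e * r\<^sup>2))"
          unfolding nf using K[OF ws] K0 by (intro mult_mono) auto
        also have "\<dots> \<le> m + \<delta>"
        proof -
          have "K \<le> r * (e * (m + \<delta>))" using r(3) e m \<delta> by (simp add: divide_le_eq)
          also have "\<dots> \<le> r\<^sup>2 * (e * (m + \<delta>))"
            using r(1) e m \<delta> by (intro mult_right_mono) (auto simp: power2_eq_square)
          also have "\<dots> = (m + \<delta>) * (e * r\<^sup>2)" by simp
          also have "\<dots> \<le> (m + \<delta>) * exp (e * r\<^sup>2)"
            using m \<delta> exp_ge_add_one_self[of "e * r\<^sup>2"] by (intro mult_left_mono) linarith+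
          finally show ?thesis by (simp add: exp_minus field_simps)
        qed
        finally show ?thesis .
      qed
    qed
    then show ?thesis by (simp add: nf)
  qed
  \<comment> \<open>At the fixed point z the damping factor tends to 1 as e decreases to 0.\<close>
  have "((\<lambda>e. cmod (h z) * exp (e * ((Re z)\<^sup>2 - (Im z)\<^sup>2 - 1))) \<longlongrightarrow>
      cmod (h z) * exp (0 * ((Re z)\<^sup>2 - (Im z)\<^sup>2 - 1))) (at_right 0)"
    by (intro tendsto_intros)
  moreover have "eventually (\<lambda>e. cmod (h z) * exp (e * ((Re z)\<^sup>2 - (Im z)\<^sup>2 - 1)) \<le> m + \<delta>) (at_right 0)"
    using key by (auto simp: eventually_at_right_field intro: exI[of _ 1])
  ultimately show "cmod (h z) \<le> m + \<delta>"
    by (auto dest: tendsto_upperbound)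
qed

section \<open>Functions on the strip with bounded boundary norms\<close>

text \<open>A version of the ball of radius M in the interpolation family, tested on truncations on
  the left line and against finitely supported sequences on the right line. Sums of restricted
  functions can be handled without showing that their boundary values belong to the completed
  spaces.\<close>

definition strip_le :: "real \<Rightarrow> (complex \<Rightarrow> cseq) \<Rightarrow> bool" where
  "strip_le M G \<longleftrightarrow>
     (\<forall>j. bounded ((\<lambda>z. G z j) ` strip) \<and> continuous_on strip (\<lambda>z. G z j) \<and>
          (\<lambda>z. G z j) holomorphic_on ostrip) \<and>
     (\<forall>(t::real) n. t2norm (restr {..<n} (G (\<i> * t))) \<le> M) \<and>
     (\<forall>(t::real) n a. cmod (\<Sum>j<n. a j * G (1 + \<i> * t) j) \<le> M * t2norm (restr {..<n} a))"

lemma strip_leI: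
  assumes "\<And>j. bounded ((\<lambda>z. G z j) ` strip)" "\<And>j. continuous_on strip (\<lambda>z. G z j)"
    "\<And>j. (\<lambda>z. G z j) holomorphic_on ostrip"
    "\<And>(t::real) n. t2norm (restr {..<n} (G (\<i> * t))) \<le> M"
    "\<And>(t::real) n a. cmod (\<Sum>j<n. a j * G (1 + \<i> * t) j) \<le> M * t2norm (restr {..<n} a)"
  shows "strip_le M G"
  using assms by (simp add: strip_le_def)

lemma strip_leD:
  assumes "strip_le M G"
  shows "bounded ((\<lambda>z. G z j) ` strip)" "continuous_on strip (\<lambda>z. G z j)"
    "(\<lambda>z. G z j) holomorphic_on ostrip"
    "t2norm (restr {..<n} (G (\<i> * of_real t))) \<le> M"
    "cmod (\<Sum>j<n. a j * G (1 + \<i> * of_real t) j) \<le> M * t2norm (restr {..<n} a)"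
    "0 \<le> M"
proof -
  show "0 \<le> M"
    using assms t2_nonneg[of "restr {..<0} (G (\<i> * of_real t))"] c00_restr_finite[of "{..<0}"]
    unfolding strip_le_def by (meson finite_lessThan order_trans)
qed (use assms in \<open>auto simp: strip_le_def\<close>)

lemma strip_le_differentiable:
  assumes "strip_le M G" shows "(\<lambda>z. G z j) field_differentiable at (1/2)"
  by (rule holomorphic_on_imp_differentiable_at[OF strip_leD(3)[OF assms] ostrip_open half_in_ostrip])

lemma calF_strip_le:
  assumes "F \<in> calF X2 Y2" shows "strip_le (calF_norm X2 Y2 F) F"
proof (rule strip_leI)
  note F = assms[unfolded calF_def mem_Collect_eq]
  have c: "continuous_on strip F" using F by blast
  fix j
  show "bounded ((\<lambda>z. F z j) ` strip)" using F by blast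
  show "continuous_on strip (\<lambda>z. F z j)" by (rule continuous_on_product_then_coordinatewise[OF c])
  have "(\<lambda>z. F z j) analytic_on interior strip" using F by blast
  then show "(\<lambda>z. F z j) holomorphic_on ostrip"
    using analytic_imp_holomorphic holomorphic_on_subset ostrip_subset(2) by blast
next
  note F = assms[unfolded calF_def mem_Collect_eq]
  fix t :: real and n and a :: cseq
  have "bdd_above (range (\<lambda>t::real. cs_norm X2 (F (\<i> * t))))"
    using F by (intro bounded_imp_bdd_above) blast
  then have "cs_norm X2 (F (\<i> * t)) \<le> calF_norm X2 Y2 F"
    unfolding calF_norm_def by (intro max.coboundedI1 cSUP_upper) auto
  moreover have "F (\<i> * t) \<in> cs_carrier X2" using F by blast
  ultimately show "t2norm (restr {..<n} (F (\<i> * t))) \<le> calF_norm X2 Y2 F"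
    using X2_bound order_trans by blast
  have "bdd_above (range (\<lambda>t::real. cs_norm Y2 (F (1 + \<i> * t))))"
    using F by (intro bounded_imp_bdd_above) blast
  then have "cs_norm Y2 (F (1 + \<i> * t)) \<le> calF_norm X2 Y2 F"
    unfolding calF_norm_def by (intro max.coboundedI2 cSUP_upper) auto
  then have "cs_norm Y2 (F (1 + \<i> * t)) * t2norm (restr {..<n} a) \<le>
      calF_norm X2 Y2 F * t2norm (restr {..<n} a)"
    by (intro mult_right_mono t2_nonneg c00_restr_finite) auto
  moreover have "F (1 + \<i> * t) \<in> cs_carrier Y2" using F by blast
  ultimately show "cmod (\<Sum>j<n. a j * F (1 + \<i> * t) j) \<le> calF_norm X2 Y2 F * t2norm (restr {..<n} a)"
    using Y2_bound order_trans by blast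
qed

lemma strip_le_mono:
  assumes "strip_le M G" "M \<le> M'" shows "strip_le M' G"
proof (rule strip_leI)
  fix t :: real and n and a :: cseq
  show "t2norm (restr {..<n} (G (\<i> * t))) \<le> M'"
    using strip_leD(4)[OF assms(1)] assms(2) order_trans by blast
  have "M * t2norm (restr {..<n} a) \<le> M' * t2norm (restr {..<n} a)"
    using assms(2) by (intro mult_right_mono t2_nonneg c00_restr_finite) auto
  then show "cmod (\<Sum>j<n. a j * G (1 + \<i> * t) j) \<le> M' * t2norm (restr {..<n} a)"
    using strip_leD(5)[OF assms(1)] order_trans by blast
qed (use strip_leD[OF assms(1)] in blast)+

lemma strip_le_add:
  assumes G: "strip_le M G" and H: "strip_le M' H"
  shows "strip_le (M + M') (\<lambda>z j. G z j + H z j)"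
proof (rule strip_leI)
  fix j
  show "bounded ((\<lambda>z. G z j + H z j) ` strip)"
    by (intro bounded_plus_comp strip_leD(1)[OF G] strip_leD(1)[OF H])
  show "continuous_on strip (\<lambda>z. G z j + H z j)"
    by (intro continuous_intros strip_leD(2)[OF G] strip_leD(2)[OF H])
  show "(\<lambda>z. G z j + H z j) holomorphic_on ostrip"
    by (intro holomorphic_intros strip_leD(3)[OF G] strip_leD(3)[OF H])
next
  fix t :: real and n and a :: cseq
  have "t2norm (\<lambda>j. restr {..<n} (G (\<i> * t)) j + restr {..<n} (H (\<i> * t)) j) \<le>
      t2norm (restr {..<n} (G (\<i> * t))) + t2norm (restr {..<n} (H (\<i> * t)))"
    by (intro t2_add c00_restr_finite) auto
  then show "t2norm (restr {..<n} (\<lambda>j. G (\<i> * t) j + H (\<i> * t) j)) \<le> M + M'"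
    unfolding restr_add using strip_leD(4)[OF G, of n t] strip_leD(4)[OF H, of n t] by linarith
  have "(\<Sum>j<n. a j * (G (1 + \<i> * t) j + H (1 + \<i> * t) j)) =
      (\<Sum>j<n. a j * G (1 + \<i> * t) j) + (\<Sum>j<n. a j * H (1 + \<i> * t) j)"
    by (simp add: sum.distrib distrib_left)
  then have "cmod (\<Sum>j<n. a j * (G (1 + \<i> * t) j + H (1 + \<i> * t) j)) \<le>
      cmod (\<Sum>j<n. a j * G (1 + \<i> * t) j) + cmod (\<Sum>j<n. a j * H (1 + \<i> * t) j)"
    by (simp add: norm_triangle_ineq)
  then show "cmod (\<Sum>j<n. a j * (G (1 + \<i> * t) j + H (1 + \<i> * t) j)) \<le>
      (M + M') * t2norm (restr {..<n} a)"
    using strip_leD(5)[OF G, of a t n] strip_leD(5)[OF H, of a t n] by (simp add: distrib_right)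
qed

lemma strip_le_scale:
  assumes G: "strip_le M G"
  shows "strip_le (cmod c * M) (\<lambda>z j. c * G z j)"
proof (rule strip_leI)
  fix j
  show "bounded ((\<lambda>z. c * G z j) ` strip)"
    using strip_leD(1)[OF G, of j] bounded_linear_image[OF _ bounded_linear_mult_right[of c]]
    by (metis image_image)
  show "continuous_on strip (\<lambda>z. c * G z j)"
    by (intro continuous_intros strip_leD(2)[OF G])
  show "(\<lambda>z. c * G z j) holomorphic_on ostrip"
    by (intro holomorphic_intros strip_leD(3)[OF G])
next
  fix t :: real and n and a :: cseq
  show "t2norm (restr {..<n} (\<lambda>j. c * G (\<i> * t) j)) \<le> cmod c * M"
    unfolding restr_scale using strip_leD(4)[OF G, of n t]
    by (simp add: t2_scale c00_restr_finite mult_left_mono)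
  have "(\<Sum>j<n. a j * (c * G (1 + \<i> * t) j)) = c * (\<Sum>j<n. a j * G (1 + \<i> * t) j)"
    by (simp add: sum_distrib_left algebra_simps)
  then show "cmod (\<Sum>j<n. a j * (c * G (1 + \<i> * t) j)) \<le> cmod c * M * t2norm (restr {..<n} a)"
    using strip_leD(5)[OF G, of a t n] by (simp add: norm_mult mult.assoc mult_left_mono)
qed

lemma strip_le_diff:
  assumes "strip_le M G" "strip_le M' H"
  shows "strip_le (M + M') (\<lambda>z j. G z j - H z j)"
  using strip_le_add[OF assms(1) strip_le_scale[OF assms(2), of "-1"]] by simp

text \<open>A restriction decreases the lattice norm on the left line; on the right line it is moved
  onto the test sequence, where it decreases the same norm.\<close>

lemma strip_le_restr:
  assumes G: "strip_le M G"
  shows "strip_le M (\<lambda>z. restr A (G z))"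
proof (rule strip_leI)
  fix j
  have *: "(\<lambda>z. restr A (G z) j) = (if j \<in> A then (\<lambda>z. G z j) else (\<lambda>z. 0))"
    by (auto simp: restr_def)
  show "bounded ((\<lambda>z. restr A (G z) j) ` strip)"
    using strip_leD(1)[OF G, of j] unfolding * by (auto intro: finite_imp_bounded finite_subset[of _ "{0}"])
  show "continuous_on strip (\<lambda>z. restr A (G z) j)"
    using strip_leD(2)[OF G, of j] unfolding * by auto
  show "(\<lambda>z. restr A (G z) j) holomorphic_on ostrip"
    using strip_leD(3)[OF G, of j] unfolding * by auto
next
  fix t :: real and n and a :: cseq
  have "t2norm (restr {..<n} (restr A (G (\<i> * t)))) \<le> t2norm (restr {..<n} (G (\<i> * t)))"
    by (rule t2_mono) (simp_all add: c00_restr_finite, simp add: restr_def)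
  then show "t2norm (restr {..<n} (restr A (G (\<i> * t)))) \<le> M"
    using strip_leD(4)[OF G, of n t] by linarith
  have "(\<Sum>j<n. a j * restr A (G (1 + \<i> * t)) j) = (\<Sum>j<n. restr A a j * G (1 + \<i> * t) j)"
    by (rule sum.cong) (auto simp: restr_def)
  moreover have "t2norm (restr {..<n} (restr A a)) \<le> t2norm (restr {..<n} a)"
    by (rule t2_mono) (simp_all add: c00_restr_finite, simp add: restr_def)
  ultimately show "cmod (\<Sum>j<n. a j * restr A (G (1 + \<i> * t)) j) \<le> M * t2norm (restr {..<n} a)"
    using strip_leD(5)[OF G, of "restr A a" t n] mult_left_mono[OF _ strip_leD(6)[OF G]]
    by fastforce
qed

text \<open>The upper 2-estimate holds in \<open>T\<^sup>2\<close> by 2-convexity, and in the dual by duality with the lower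
  2-estimate of \<open>T\<^sup>2\<close> on admissible blocks.\<close>

lemma strip_le_blocks:
  assumes A: "admissible k A" and G: "\<And>i. i < k \<Longrightarrow> strip_le (M i) (G i)"
  shows "strip_le (sqrt 2 * L2_set M {..<k}) (\<lambda>z j. \<Sum>i<k. restr (A i) (G i z) j)"
proof (rule strip_leI)
  fix j
  have "(\<lambda>z. \<Sum>i<m. restr (A i) (G i z) j) holomorphic_on ostrip" if "m \<le> k" for m
    using strip_leD(3)[OF strip_le_restr[OF G]] that by (intro holomorphic_intros) auto
  then show "(\<lambda>z. \<Sum>i<k. restr (A i) (G i z) j) holomorphic_on ostrip" by blast
  show "continuous_on strip (\<lambda>z. \<Sum>i<k. restr (A i) (G i z) j)"
    using strip_leD(2)[OF strip_le_restr[OF G]] by (intro continuous_intros) auto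
  have "bounded ((\<lambda>z. \<Sum>i<m. restr (A i) (G i z) j) ` strip)" if "m \<le> k" for m
    using that
  proof (induction m)
    case 0 then show ?case by (auto intro: finite_imp_bounded finite_subset[of _ "{0}"])
  next
    case (Suc m)
    then show ?case using strip_leD(1)[OF strip_le_restr[OF G], of m "A m" j]
      by (simp add: bounded_plus_comp)
  qed
  then show "bounded ((\<lambda>z. \<Sum>i<k. restr (A i) (G i z) j) ` strip)" by blast
next
  fix t :: real and n and a :: cseq
  note dis = admissible_disjoint[OF A]
  have sw: "restr {..<n} (restr B x) = restr B (restr {..<n} x)" for B x
    by (rule ext) (simp add: restr_def)
  have M0: "0 \<le> M i" if "i < k" for i using strip_leD(6)[OF G[OF that]] .
  have "t2norm (restr {..<n} (\<lambda>j. \<Sum>i<k. restr (A i) (G i (\<i> * t)) j)) =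
      t2norm (\<lambda>j. \<Sum>i<k. restr (A i) (restr {..<n} (G i (\<i> * t))) j)"
    by (simp add: restr_sum sw)
  also have "\<dots> \<le> L2_set (\<lambda>i. t2norm (restr (A i) (restr {..<n} (G i (\<i> * t))))) {..<k}"
    by (rule t2_upper) (use dis in \<open>auto simp: c00_restr_finite\<close>)
  also have "\<dots> \<le> L2_set M {..<k}"
  proof (rule L2_set_mono)
    fix i assume "i \<in> {..<k}"
    then show "t2norm (restr (A i) (restr {..<n} (G i (\<i> * t)))) \<le> M i"
      using strip_leD(4)[OF strip_le_restr[OF G], of i n "A i" t] by (simp add: sw)
  qed (simp add: t2_nonneg c00_restr c00_restr_finite)
  \<comment> \<open>The left line has constant 1; \<open>sqrt 2\<close> is inserted to match the
    right line.\<close>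
  also have "\<dots> \<le> sqrt 2 * L2_set M {..<k}" using mult_right_mono[of 1 "sqrt 2" "L2_set M {..<k}"] by simp
  finally show "t2norm (restr {..<n} (\<lambda>j. \<Sum>i<k. restr (A i) (G i (\<i> * t)) j)) \<le>
      sqrt 2 * L2_set M {..<k}" .
  have "(\<Sum>j<n. a j * (\<Sum>i<k. restr (A i) (G i (1 + \<i> * t)) j)) =
      (\<Sum>i<k. \<Sum>j<n. restr (A i) a j * G i (1 + \<i> * t) j)"
    unfolding sum_distrib_left by (subst sum.swap) (auto simp: restr_def intro!: sum.cong)
  then have "cmod (\<Sum>j<n. a j * (\<Sum>i<k. restr (A i) (G i (1 + \<i> * t)) j)) \<le>
      (\<Sum>i<k. cmod (\<Sum>j<n. restr (A i) a j * G i (1 + \<i> * t) j))"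
    by (simp add: norm_sum)
  \<comment> \<open>With the restrictions moved onto the test sequence, Cauchy-Schwarz over the
    blocks meets the lower 2-estimate of a. The absolute values only fit the shape of
    \<open>L2_set_mult_ineq\<close>.\<close>
  also have "\<dots> \<le> (\<Sum>i<k. \<bar>M i\<bar> * \<bar>t2norm (restr (A i) (restr {..<n} a))\<bar>)"
  proof (rule sum_mono)
    fix i assume "i \<in> {..<k}"
    then show "cmod (\<Sum>j<n. restr (A i) a j * G i (1 + \<i> * t) j) \<le>
        \<bar>M i\<bar> * \<bar>t2norm (restr (A i) (restr {..<n} a))\<bar>"
      using strip_leD(5)[OF G, of i "restr (A i) a" t n] M0[of i]
        t2_nonneg[OF c00_restr[OF c00_restr_finite[of "{..<n}" a]], of "A i"] by (simp add: sw)
  qed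
  also have "\<dots> \<le> L2_set M {..<k} * L2_set (\<lambda>i. t2norm (restr (A i) (restr {..<n} a))) {..<k}"
    by (rule L2_set_mult_ineq)
  also have "\<dots> \<le> L2_set M {..<k} * (sqrt 2 * t2norm (restr {..<n} a))"
    by (intro mult_left_mono t2_lower A c00_restr_finite) auto
  finally show "cmod (\<Sum>j<n. a j * (\<Sum>i<k. restr (A i) (G i (1 + \<i> * t)) j)) \<le>
      sqrt 2 * L2_set M {..<k} * t2norm (restr {..<n} a)"
    by (simp add: mult_ac)
qed

text \<open>The function \<open>z \<mapsto> \<Sum>j. G z j * cnj (G (1 - cnj z) j)\<close> pairs \<open>X\<close> with its dual on both
  boundary lines and equals \<open>\<Sum>j. \<bar>G z j\<bar>\<^sup>2\<close> at \<open>1/2\<close>.\<close>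

lemma strip_le_l2:
  assumes G: "strip_le M G" shows "l2_le M (G (1/2))"
  unfolding l2_le_def
proof
  fix n
  have M: "0 \<le> M" by (rule strip_leD(6)[OF G])
  define h where "h z = (\<Sum>j<n. G z j * cnj (G (1 - cnj z) j))" for z
  have refl_strip: "(\<lambda>z. 1 - cnj z) ` strip \<subseteq> strip" by (auto simp: strip_def)
  have "continuous_on strip (\<lambda>z. G (1 - cnj z) j)" for j
    by (rule continuous_on_compose2[OF strip_leD(2)[OF G] _ refl_strip]) (intro continuous_intros)
  then have cont: "continuous_on strip h" unfolding h_def
    by (intro continuous_intros strip_leD(2)[OF G])
  \<comment> \<open>The inner and outer conjugations cancel, so the reflection in the line
    \<open>Re z = 1/2\<close> preserves holomorphy.\<close>
  have "(\<lambda>z. cnj (G (1 - cnj z) j)) holomorphic_on ostrip" for j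
  proof -
    have "(\<lambda>z. G z j) \<circ> (\<lambda>z. 1 - z) holomorphic_on cnj ` ostrip"
      by (rule holomorphic_on_compose_gen[OF _ strip_leD(3)[OF G]])
        (auto simp: ostrip_def intro!: holomorphic_intros)
    from holomorphic_on_compose_cnj_cnj[OF this ostrip_open] show ?thesis by (simp add: o_def)
  qed
  then have hol: "h holomorphic_on ostrip" unfolding h_def
    by (intro holomorphic_intros strip_leD(3)[OF G])
  have bd: "bounded ((\<lambda>z. \<Sum>j<m. G z j * cnj (G (1 - cnj z) j)) ` strip)" for m
  proof (induction m)
    case 0 then show ?case by (auto intro: finite_imp_bounded finite_subset[of _ "{0}"])
  next
    case (Suc m)
    obtain K where K: "\<And>z. z \<in> strip \<Longrightarrow> cmod (G z m) \<le> K"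
      using strip_leD(1)[OF G, of m] unfolding bounded_iff by blast
    have "cmod (G z m * cnj (G (1 - cnj z) m)) \<le> K * K" if "z \<in> strip" for z
    proof -
      have "1 - cnj z \<in> strip" using that by (auto simp: strip_def)
      then show ?thesis unfolding norm_mult complex_mod_cnj
        by (intro mult_mono K that norm_ge_zero order_trans[OF norm_ge_zero K[OF that]])
    qed
    then have "bounded ((\<lambda>z. G z m * cnj (G (1 - cnj z) m)) ` strip)" unfolding bounded_iff by blast
    then show ?case using Suc by (simp add: bounded_plus_comp)
  qed
  \<comment> \<open>The reflection exchanges the points of the two boundary lines at the same height
    t. Both boundary values of h are therefore this one pairing, up to conjugation.\<close>
  have pair: "cmod (\<Sum>j<n. cnj (G (\<i> * of_real t) j) * G (1 + \<i> * of_real t) j) \<le> M\<^sup>2" for t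
  proof -
    have "t2norm (restr {..<n} (\<lambda>j. cnj (G (\<i> * of_real t) j))) \<le> t2norm (restr {..<n} (G (\<i> * of_real t)))"
      by (rule t2_mono) (simp_all add: c00_restr_finite, simp add: restr_def)
    also have "\<dots> \<le> M" by (rule strip_leD(4)[OF G])
    finally have "M * t2norm (restr {..<n} (\<lambda>j. cnj (G (\<i> * of_real t) j))) \<le> M * M"
      using M by (rule mult_left_mono)
    then show ?thesis
      using strip_leD(5)[OF G, of "\<lambda>j. cnj (G (\<i> * of_real t) j)" t n] by (simp add: power2_eq_square)
  qed
  have "cmod (h (1/2)) \<le> M\<^sup>2"
  proof (rule three_lines[OF cont hol])
    show "bounded (h ` strip)" using bd[of n] by (simp add: h_def[abs_def])
    fix t :: real
    have "h (\<i> * t) = cnj (\<Sum>j<n. cnj (G (\<i> * t) j) * G (1 + \<i> * t) j)" by (simp add: h_def)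
    then show "cmod (h (\<i> * t)) \<le> M\<^sup>2" using pair[of t] by (metis complex_mod_cnj)
    have "h (1 + \<i> * t) = (\<Sum>j<n. cnj (G (\<i> * t) j) * G (1 + \<i> * t) j)" by (simp add: h_def mult.commute)
    then show "cmod (h (1 + \<i> * t)) \<le> M\<^sup>2" using pair[of t] by simp
    show "1/2 \<in> strip" by (simp add: strip_def)
  qed
  moreover have "h (1/2) = of_real (\<Sum>j<n. (cmod (G (1/2) j))\<^sup>2)"
    unfolding h_def by (simp add: complex_norm_square del: of_real_power)
  ultimately have "(\<Sum>j<n. (cmod (G (1/2) j))\<^sup>2) \<le> M\<^sup>2" by (simp add: norm_of_real sum_nonneg del: of_real_sum)
  then show "L2_set (\<lambda>j. cmod (G (1/2) j)) {..<n} \<le> M"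
    unfolding L2_set_def using M by (intro real_le_lsqrt) (auto simp: sum_nonneg)
qed

lemma half_le_dist_boundary: "1/2 \<le> cmod (\<i> * of_real t - 1/2)" "1/2 \<le> cmod (1 + \<i> * of_real t - 1/2)"
  using abs_Re_le_cmod[of "\<i> * of_real t - 1/2"] abs_Re_le_cmod[of "1 + \<i> * of_real t - 1/2"] by simp_all

text \<open>Apply the previous lemma to \<open>G z / (z - 1/2)\<close>.\<close>

lemma strip_le_deriv:
  assumes G: "strip_le M G" and 0: "\<And>j. G (1/2) j = 0"
  shows "l2_le (2 * M) (\<lambda>j. deriv (\<lambda>z. G z j) (1/2))"
proof -
  \<comment> \<open>The singularity at 1/2 is removable because all coordinates of G vanish there,
    and the value filled in is the derivative to be estimated.\<close>
  define H where "H z = (\<lambda>j. if z = 1/2 then deriv (\<lambda>z. G z j) (1/2) else G z j / (z - 1/2))" for z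
  have M: "0 \<le> M" by (rule strip_leD(6)[OF G])
  have hol: "(\<lambda>z. H z j) holomorphic_on ostrip" for j
    using pole_lemma[OF strip_leD(3)[OF G, of j], of "1/2"] half_in_ostrip ostrip_open
    by (simp add: H_def 0 interior_open cong: if_cong)
  have cont: "continuous_on strip (\<lambda>z. H z j)" for j
  proof -
    \<comment> \<open>Holomorphy gives continuity on the open strip, the quotient formula gives it
      away from 1/2. Both sets are relatively open in the strip, so the two statements glue.\<close>
    have s: "strip = ostrip \<union> (strip - {1/2})"
      using ostrip_subset(1) half_in_ostrip by auto
    have "continuous_on (strip - {1/2}) (\<lambda>z. G z j / (z - 1/2))"
      by (intro continuous_intros continuous_on_subset[OF strip_leD(2)[OF G]]) auto
    then have c: "continuous_on (strip - {1/2}) (\<lambda>z. H z j)"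
      by (rule continuous_on_eq) (auto simp: H_def)
    have "continuous_on (ostrip \<union> (strip - {1/2})) (\<lambda>z. H z j)"
    proof (rule continuous_on_Un_local_open[OF _ _ holomorphic_on_imp_continuous_on[OF hol] c])
      show "openin (top_of_set (ostrip \<union> (strip - {1/2}))) ostrip"
        unfolding openin_open using ostrip_open by blast
      show "openin (top_of_set (ostrip \<union> (strip - {1/2}))) (strip - {1/2})"
        unfolding s[symmetric] openin_open by (intro exI[of _ "- {1/2}"]) auto
    qed
    then show ?thesis using s by simp
  qed
  have bd: "bounded ((\<lambda>z. H z j) ` strip)" for j
  proof -
    obtain K where K: "\<And>z. z \<in> strip \<Longrightarrow> cmod (G z j) \<le> K"
      using strip_leD(1)[OF G, of j] unfolding bounded_iff by blast
    \<comment> \<open>Close to 1/2 the quotient is bounded by compactness, elsewhere by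
      \<open>K * 4\<close> because the denominator exceeds 1/4.\<close>
    let ?D = "cball (1/2) (1/4) :: complex set"
    have D: "?D \<subseteq> strip"
    proof
      fix z :: complex assume "z \<in> ?D"
      then have "\<bar>Re (1/2 - z)\<bar> \<le> 1/4"
        by (metis abs_Re_le_cmod dist_norm mem_cball order_trans)
      then have "\<bar>1/2 - Re z\<bar> \<le> 1/4" by simp
      then have "0 \<le> Re z \<and> Re z \<le> 1" by linarith
      then show "z \<in> strip" by (simp add: strip_def)
    qed
    have "bounded ((\<lambda>z. H z j) ` ?D)"
      by (intro compact_imp_bounded compact_continuous_image continuous_on_subset[OF cont D]) simp
    moreover have "cmod (H z j) \<le> K * 4" if "z \<in> strip - ?D" for z
    proof -
      have d: "1/4 < cmod (z - 1/2)" using that by (simp add: dist_norm norm_minus_commute)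
      then have "0 < cmod (z - 1/2)" by linarith
      then have "z \<noteq> 1/2" unfolding zero_less_norm_iff by simp
      then have "cmod (H z j) = cmod (G z j) * (1 / cmod (z - 1/2))" by (simp add: H_def norm_divide)
      also have "\<dots> \<le> K * 4"
        using d K that norm_ge_zero[of "G z j"] order_trans[OF norm_ge_zero K[of z]]
        by (intro mult_mono) (auto simp: divide_le_eq)
      finally show ?thesis .
    qed
    then have "bounded ((\<lambda>z. H z j) ` (strip - ?D))" unfolding bounded_iff by blast
    ultimately have "bounded ((\<lambda>z. H z j) ` (?D \<union> (strip - ?D)))"
      unfolding image_Un bounded_Un ..
    then show ?thesis by (rule bounded_subset) auto
  qed
  \<comment> \<open>Both boundary lines have distance 1/2 from the point 1/2: the origin of the
    factor 2 in the bound.\<close>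
  have inv: "cmod (1 / w) \<le> 2" if "1/2 \<le> cmod w" for w :: complex
  proof -
    have "0 < cmod w" using that by linarith
    then show ?thesis using that by (simp add: norm_divide divide_le_eq)
  qed
  have Heq: "H w = (\<lambda>j. 1 / (w - 1/2) * G w j)" if "1/2 \<le> cmod (w - 1/2)" for w
  proof -
    have "w \<noteq> 1/2" using that by (metis diff_self half_gt_zero_iff linorder_not_le norm_zero zero_less_one)
    then show ?thesis by (simp add: H_def)
  qed
  have "strip_le (2 * M) H"
  proof (rule strip_leI[OF bd cont hol])
    fix t :: real and n and a :: cseq
    note H0 = Heq[OF half_le_dist_boundary(1)[of t]]
    have "t2norm (restr {..<n} (H (\<i> * t))) = cmod (1 / (\<i> * t - 1/2)) * t2norm (restr {..<n} (G (\<i> * t)))"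
      unfolding H0 restr_scale by (rule t2_scale) (simp add: c00_restr_finite)
    also have "\<dots> \<le> 2 * M"
      by (intro mult_mono inv half_le_dist_boundary strip_leD(4)[OF G] t2_nonneg c00_restr_finite) auto
    finally show "t2norm (restr {..<n} (H (\<i> * t))) \<le> 2 * M" .
    note H1 = Heq[OF half_le_dist_boundary(2)[of t]]
    have "(\<Sum>j<n. a j * H (1 + \<i> * t) j) = 1 / (1 + \<i> * t - 1/2) * (\<Sum>j<n. a j * G (1 + \<i> * t) j)"
      unfolding H1 sum_distrib_left by (rule sum.cong) simp_all
    then have "cmod (\<Sum>j<n. a j * H (1 + \<i> * t) j) = cmod (1 / (1 + \<i> * t - 1/2)) * cmod (\<Sum>j<n. a j * G (1 + \<i> * t) j)"
      by (simp only: norm_mult)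
    also have "\<dots> \<le> 2 * (M * t2norm (restr {..<n} a))"
      by (intro mult_mono inv half_le_dist_boundary strip_leD(5)[OF G]) auto
    finally show "cmod (\<Sum>j<n. a j * H (1 + \<i> * t) j) \<le> 2 * M * t2norm (restr {..<n} a)" by simp
  qed
  from strip_le_l2[OF this] show ?thesis by (simp add: H_def)
qed


section \<open>The twisted sum\<close>

text \<open>Boundary values of a selection only enter through \<open>strip_le\<close>.\<close>

locale twisted_sum =
  fixes B :: "cseq \<Rightarrow> complex \<Rightarrow> cseq" and C :: real
  assumes B_le: "y \<in> l2_seqs \<Longrightarrow> strip_le (C * l2_norm y) (B y)"
    and B_half: "y \<in> l2_seqs \<Longrightarrow> B y (1/2) = y"
    and C_nonneg: "0 \<le> C"
begin

text \<open>G and \<open>B y\<close> agree at 1/2, so their difference vanishes there and has bound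
  \<open>M + C * l2_norm y\<close>; its derivative is estimated by twice that. All near-linearity of
  \<open>Omega\<close> follows by choosing G.\<close>

lemma Omega_compare:
  assumes G: "strip_le M G" and y: "y \<in> l2_seqs" and half: "G (1/2) = y"
  shows "l2_le (2 * (M + C * l2_norm y)) (\<lambda>j. deriv (\<lambda>z. G z j) (1/2) - Omega B y j)"
proof -
  have "l2_le (2 * (M + C * l2_norm y)) (\<lambda>j. deriv (\<lambda>z. G z j - B y z j) (1/2))"
    by (rule strip_le_deriv[OF strip_le_diff[OF G B_le[OF y]]]) (simp add: half B_half[OF y])
  then show ?thesis by (simp add: Omega_def strip_le_differentiable[OF G] strip_le_differentiable[OF B_le[OF y]])
qed

lemma Omega_add:
  assumes x: "x \<in> l2_seqs" and y: "y \<in> l2_seqs"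
  shows "(\<lambda>j. Omega B x j + Omega B y j - Omega B (\<lambda>j. x j + y j) j) \<in> l2_seqs"
proof -
  have "(\<lambda>j. deriv (\<lambda>z. B x z j + B y z j) (1/2) - Omega B (\<lambda>j. x j + y j) j) \<in> l2_seqs"
    by (rule l2_leD(1)[OF Omega_compare[OF strip_le_add[OF B_le[OF x] B_le[OF y]]]])
      (simp_all add: l2_add B_half x y)
  then show ?thesis by (simp add: Omega_def strip_le_differentiable[OF B_le] x y)
qed

lemma Omega_scale:
  assumes y: "y \<in> l2_seqs"
  shows "l2_le (4 * C * cmod a * l2_norm y) (\<lambda>j. a * Omega B y j - Omega B (\<lambda>j. a * y j) j)"
proof -
  have "l2_le (2 * (cmod a * (C * l2_norm y) + C * l2_norm (\<lambda>j. a * y j)))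
      (\<lambda>j. deriv (\<lambda>z. a * B y z j) (1/2) - Omega B (\<lambda>j. a * y j) j)"
    by (rule Omega_compare[OF strip_le_scale[OF B_le[OF y]]])
      (simp_all add: l2_scale B_half y)
  then show ?thesis by (simp add: Omega_def strip_le_differentiable[OF B_le] l2_norm_scale y mult_ac)
qed

text \<open>The restriction of \<open>B y\<close> competes with \<open>B (restr A y)\<close>. Both
  have bound \<open>C * l2_norm y\<close>, and the comparison doubles their sum.\<close>

lemma Omega_restr:
  assumes y: "y \<in> l2_seqs"
  shows "l2_le (4 * C * l2_norm y) (\<lambda>j. restr A (Omega B y) j - Omega B (restr A y) j)"
proof -
  have d: "deriv (\<lambda>z. restr A (B y z) j) (1/2) = restr A (Omega B y) j" for j
    by (cases "j \<in> A") (simp_all add: restr_def Omega_def)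
  have "l2_le (2 * (C * l2_norm y + C * l2_norm (restr A y)))
      (\<lambda>j. deriv (\<lambda>z. restr A (B y z) j) (1/2) - Omega B (restr A y) j)"
    by (rule Omega_compare[OF strip_le_restr[OF B_le[OF y]]])
      (simp_all add: l2_restr B_half y)
  then show ?thesis unfolding d
    by (rule l2_le_mono) (use mult_left_mono[OF l2_norm_restr[OF y, of A] C_nonneg] in simp)
qed

lemma Omega_zero: "Omega B (\<lambda>j. 0) = (\<lambda>j. 0)"
  using l2_le_coord[OF Omega_scale[OF l2_zero, of 0]] by (auto simp: l2_norm_0)

text \<open>For y supported in \<open>{..<n}\<close>, \<open>Omega B y\<close> differs by an element
  of l2 from its own truncation, which is finitely supported.\<close>

lemma Omega_c00:
  assumes y: "y \<in> c00" shows "Omega B y \<in> l2_seqs"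
proof -
  obtain n where n: "restr {..<n} y = y" using c00_bounded_support[OF y] by blast
  have "(\<lambda>j. restr {..<n} (Omega B y) j - Omega B y j) \<in> l2_seqs"
    using l2_leD(1)[OF Omega_restr[of y "{..<n}"]] y c00_subset_l2 n by auto
  from l2_diff[OF _ this, of "restr {..<n} (Omega B y)"] show ?thesis
    using c00_subset_l2 c00_restr_finite[of "{..<n}" "Omega B y"] by auto
qed

text \<open>Cutting y down to the coordinate i and then pulling out the scalar \<open>y i\<close>
  costs at most \<open>4 * C * l2_norm y\<close> each time, hence \<open>8 * C\<close>. What remains
  is the fixed number \<open>Omega B (unit_seq i) i\<close>. Coordinates are thus continuous on the
  twisted sum.\<close>

lemma Omega_coord: "\<exists>K\<ge>0. \<forall>y\<in>l2_seqs. cmod (Omega B y i) \<le> K * l2_norm y"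
proof (intro exI[of _ "8 * C + cmod (Omega B (unit_seq i) i)"] conjI ballI)
  show "0 \<le> 8 * C + cmod (Omega B (unit_seq i) i)" using C_nonneg by simp
  fix y assume y: "y \<in> l2_seqs"
  have e: "unit_seq i \<in> l2_seqs" using c00_unit_seq c00_subset_l2 by blast
  have en: "l2_norm (unit_seq i) = 1"
    by (subst l2_norm_finite[of "{i}"]) (auto simp: unit_seq_def)
  have r: "restr {i} y = (\<lambda>j. y i * unit_seq i j)"
    by (rule ext) (simp add: restr_def unit_seq_def)
  have 1: "cmod (Omega B y i - Omega B (restr {i} y) i) \<le> 4 * C * l2_norm y"
    using l2_le_coord[OF Omega_restr[OF y, of "{i}"], of i] by (simp add: restr_def)
  have 2: "cmod (y i * Omega B (unit_seq i) i - Omega B (restr {i} y) i) \<le> 4 * C * cmod (y i)"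
    using l2_le_coord[OF Omega_scale[OF e, of "y i"], of i] by (simp add: r en)
  have yi: "cmod (y i) \<le> l2_norm y" by (rule l2_coord[OF y])
  have "Omega B y i = (Omega B y i - Omega B (restr {i} y) i)
      - (y i * Omega B (unit_seq i) i - Omega B (restr {i} y) i) + y i * Omega B (unit_seq i) i" by simp
  then have "cmod (Omega B y i) \<le> cmod (Omega B y i - Omega B (restr {i} y) i)
      + cmod (y i * Omega B (unit_seq i) i - Omega B (restr {i} y) i) + cmod (y i) * cmod (Omega B (unit_seq i) i)"
    by (metis (no_types, lifting) norm_mult norm_triangle_le norm_triangle_ineq4 add_mono order_refl)
  moreover have "4 * C * cmod (y i) \<le> 4 * C * l2_norm y" using yi C_nonneg by (intro mult_left_mono) auto
  moreover have "cmod (y i) * cmod (Omega B (unit_seq i) i) \<le> l2_norm y * cmod (Omega B (unit_seq i) i)"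
    using yi by (intro mult_right_mono) auto
  ultimately show "cmod (Omega B y i) \<le> (8 * C + cmod (Omega B (unit_seq i) i)) * l2_norm y"
    using 1 2 by (simp add: algebra_simps)
qed

end

lemma l2_norm_blocks:
  fixes k :: nat
  assumes dis: "\<And>i i'. i < k \<Longrightarrow> i' < k \<Longrightarrow> i \<noteq> i' \<Longrightarrow> A i \<inter> A i' = {}"
    and fin: "\<And>i. i < k \<Longrightarrow> finite (A i)"
  shows "l2_norm (\<lambda>j. \<Sum>i<k. restr (A i) (z i) j) = L2_set (\<lambda>i. l2_norm (restr (A i) (z i))) {..<k}"
proof -
  let ?s = "\<lambda>j. \<Sum>i<k. restr (A i) (z i) j"
  have s: "?s j = restr (A i) (z i) j" if "i < k" "j \<in> A i" for i j
  proof -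
    have "(THE i. i < k \<and> j \<in> A i) = i" using dis that by blast
    then show ?thesis using sum_disjoint_restr[of k A z j, OF dis] that
      by (auto simp: restr_def)
  qed
  have "l2_norm ?s = L2_set (\<lambda>j. cmod (?s j)) (\<Union>i<k. A i)"
    by (rule l2_norm_finite) (auto simp: fin restr_def intro!: sum.neutral)
  also have "\<dots> = sqrt (\<Sum>i<k. \<Sum>j\<in>A i. (cmod (?s j))\<^sup>2)"
    unfolding L2_set_def by (subst sum.UNION_disjoint) (use fin dis in auto)
  also have "\<dots> = sqrt (\<Sum>i<k. (l2_norm (restr (A i) (z i)))\<^sup>2)"
  proof -
    have "(\<Sum>j\<in>A i. (cmod (?s j))\<^sup>2) = (l2_norm (restr (A i) (z i)))\<^sup>2" if "i < k" for i
    proof -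
      have "l2_norm (restr (A i) (z i)) = L2_set (\<lambda>j. cmod (restr (A i) (z i) j)) (A i)"
        by (rule l2_norm_finite) (auto simp: fin[OF that] restr_def)
      then show ?thesis by (simp add: L2_set_def sum_nonneg s[OF that])
    qed
    then show ?thesis by simp
  qed
  finally show ?thesis by (simp add: L2_set_def)
qed

section \<open>Pairs of sequences and the quasi-norm on blocks\<close>

definition padd :: "cseq \<times> cseq \<Rightarrow> cseq \<times> cseq \<Rightarrow> cseq \<times> cseq" where
  "padd w v = (\<lambda>j. fst w j + fst v j, \<lambda>j. snd w j + snd v j)"

definition pscale :: "complex \<Rightarrow> cseq \<times> cseq \<Rightarrow> cseq \<times> cseq" where
  "pscale a w = (\<lambda>j. a * fst w j, \<lambda>j. a * snd w j)"

definition pdiff :: "cseq \<times> cseq \<Rightarrow> cseq \<times> cseq \<Rightarrow> cseq \<times> cseq" where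
  "pdiff w v = (\<lambda>j. fst w j - fst v j, \<lambda>j. snd w j - snd v j)"

definition prestr :: "nat set \<Rightarrow> cseq \<times> cseq \<Rightarrow> cseq \<times> cseq" where
  "prestr A w = (restr A (fst w), restr A (snd w))"

definition plincomb :: "(nat \<Rightarrow> complex) \<Rightarrow> (nat \<Rightarrow> cseq \<times> cseq) \<Rightarrow> nat \<Rightarrow> cseq \<times> cseq" where
  "plincomb a v n = (\<lambda>j. \<Sum>i<n. a i * fst (v i) j, \<lambda>j. \<Sum>i<n. a i * snd (v i) j)"

lemmas p_defs = padd_def pscale_def pdiff_def prestr_def plincomb_def

lemma plincomb_Suc: "plincomb a v (Suc n) = padd (plincomb a v n) (pscale (a n) (v n))"
  by (simp add: p_defs)

lemma plincomb_0: "plincomb a v 0 = (\<lambda>j. 0, \<lambda>j. 0)"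
  by (simp add: p_defs)

lemma Z_space_ops:
  "cs_zero (Z_space B) = (\<lambda>j. 0, \<lambda>j. 0)"
  "cs_add (Z_space B) = padd" "cs_scale (Z_space B) = pscale"
  by (auto simp: Z_space_def p_defs fun_eq_iff)

lemma Z_space_lincomb: "cs_lincomb ((Z_space B)\<lparr>cs_norm := N\<rparr>) a v n = plincomb a v n"
  by (induction n) (simp_all add: Z_space_ops plincomb_0 plincomb_Suc)

lemma Z_space_diff: "cs_diff ((Z_space B)\<lparr>cs_norm := N\<rparr>) w v = pdiff w v"
  by (simp add: cs_diff_def Z_space_ops p_defs)

context twisted_sum
begin

abbreviation "Z \<equiv> cs_carrier (Z_space B)"

definition q :: "cseq \<times> cseq \<Rightarrow> real" where
  "q w = l2_norm (\<lambda>j. fst w j - Omega B (snd w) j) + l2_norm (snd w)"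

lemma q_eq: "q = cs_norm (Z_space B)"
  by (auto simp: q_def Z_space_def fun_eq_iff)

lemma Z_iff: "w \<in> Z \<longleftrightarrow> snd w \<in> l2_seqs \<and> (\<lambda>j. fst w j - Omega B (snd w) j) \<in> l2_seqs"
  by (auto simp: Z_space_def split: prod.splits)

lemma Z_add:
  assumes "w \<in> Z" "v \<in> Z" shows "padd w v \<in> Z"
proof -
  have "(\<lambda>j. (fst w j - Omega B (snd w) j) + (fst v j - Omega B (snd v) j) +
     (Omega B (snd w) j + Omega B (snd v) j - Omega B (\<lambda>j. snd w j + snd v j) j)) \<in> l2_seqs"
    using assms by (intro l2_add Omega_add) (auto simp: Z_iff)
  then show ?thesis using assms by (simp add: Z_iff padd_def l2_add algebra_simps)
qed

lemma Z_scale: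
  assumes "w \<in> Z" shows "pscale a w \<in> Z"
proof -
  have "(\<lambda>j. a * (fst w j - Omega B (snd w) j) +
     (a * Omega B (snd w) j - Omega B (\<lambda>j. a * snd w j) j)) \<in> l2_seqs"
    using assms by (intro l2_add l2_scale l2_leD(1)[OF Omega_scale]) (auto simp: Z_iff)
  then show ?thesis using assms by (simp add: Z_iff pscale_def l2_scale algebra_simps)
qed

lemma pdiff_eq: "pdiff w v = padd w (pscale (-1) v)"
  by (simp add: p_defs)

lemma Z_diff: "w \<in> Z \<Longrightarrow> v \<in> Z \<Longrightarrow> pdiff w v \<in> Z"
  unfolding pdiff_eq by (intro Z_add Z_scale)

lemma Z_zero: "(\<lambda>j. 0, \<lambda>j. 0) \<in> Z"
  by (simp add: Z_iff Omega_zero l2_zero)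

lemma Z_lincomb:
  assumes "\<And>i. i < n \<Longrightarrow> v i \<in> Z" shows "plincomb a v n \<in> Z"
  using assms by (induction n) (auto simp: plincomb_0 plincomb_Suc intro: Z_zero Z_add Z_scale)

lemma q_nonneg: "w \<in> Z \<Longrightarrow> 0 \<le> q w"
  unfolding q_def Z_iff by (auto intro: add_nonneg_nonneg l2_norm_nonneg)

text \<open>The commutator of \<open>Omega\<close> with the restriction is the only error. Any set A
  is allowed, finite or not, with the same constant.\<close>

lemma Z_restr:
  assumes w: "w \<in> Z"
  shows "prestr A w \<in> Z" "q (prestr A w) \<le> (4 * C + 1) * q w"
proof -
  define d where "d = (\<lambda>j. fst w j - Omega B (snd w) j)"
  have y: "snd w \<in> l2_seqs" and d: "d \<in> l2_seqs" using w by (auto simp: Z_iff d_def)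
  have "l2_le (l2_norm d + 4 * C * l2_norm (snd w))
      (\<lambda>j. restr A d j + (restr A (Omega B (snd w)) j - Omega B (restr A (snd w)) j))"
    by (intro l2_le_add l2_le_restr l2_leI d Omega_restr y)
  moreover have "(\<lambda>j. restr A d j + (restr A (Omega B (snd w)) j - Omega B (restr A (snd w)) j)) =
      (\<lambda>j. restr A (fst w) j - Omega B (restr A (snd w)) j)"
    by (rule ext) (simp add: d_def restr_def)
  ultimately have l: "l2_le (l2_norm d + 4 * C * l2_norm (snd w))
      (\<lambda>j. restr A (fst w) j - Omega B (restr A (snd w)) j)" by simp
  then show "prestr A w \<in> Z" by (auto simp: Z_iff prestr_def l2_restr y dest: l2_leD)
  have "q (prestr A w) \<le> l2_norm d + 4 * C * l2_norm (snd w) + l2_norm (snd w)"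
    using l2_leD(2)[OF l] l2_norm_restr[OF y, of A] by (simp add: q_def prestr_def)
  also have "\<dots> \<le> (4 * C + 1) * (l2_norm d + l2_norm (snd w))"
    using C_nonneg l2_norm_nonneg[OF d] by (simp add: algebra_simps)
  finally show "q (prestr A w) \<le> (4 * C + 1) * q w" by (simp add: q_def d_def)
qed

lemma q_coord: "\<exists>K\<ge>0. \<forall>w\<in>Z. cmod (fst w i) \<le> K * q w \<and> cmod (snd w i) \<le> K * q w"
proof -
  obtain K where K: "0 \<le> K" "\<And>y. y \<in> l2_seqs \<Longrightarrow> cmod (Omega B y i) \<le> K * l2_norm y"
    using Omega_coord by blast
  have "cmod (fst w i) \<le> (K + 1) * q w \<and> cmod (snd w i) \<le> (K + 1) * q w" if w: "w \<in> Z" for w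
  proof -
    define d where "d = (\<lambda>j. fst w j - Omega B (snd w) j)"
    have y: "snd w \<in> l2_seqs" and d: "d \<in> l2_seqs" using w by (auto simp: Z_iff d_def)
    have q: "q w = l2_norm d + l2_norm (snd w)" by (simp add: q_def d_def)
    have n: "0 \<le> l2_norm d" "0 \<le> l2_norm (snd w)" using d y by (auto intro: l2_norm_nonneg)
    have p: "0 \<le> K * l2_norm d" "0 \<le> K * l2_norm (snd w)" using K(1) n by auto
    have "cmod (fst w i) \<le> cmod (d i) + cmod (Omega B (snd w) i)"
      unfolding d_def by (metis add.commute diff_add_cancel norm_triangle_ineq)
    then show ?thesis
      using l2_coord[OF d, of i] l2_coord[OF y, of i] K(2)[OF y] n p
      by (simp add: q algebra_simps)
  qed
  then show ?thesis using K(1) by (intro exI[of _ "K + 1"]) auto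
qed

lemma Z_finite: "finite A \<Longrightarrow> prestr A w \<in> Z"
  using c00_restr_finite c00_subset_l2 Omega_c00
  by (auto simp: Z_iff prestr_def intro!: l2_diff)

text \<open>These pairs form the kernel of the projection onto the second component, on which the
  quasi-norm is exactly the l2 norm.\<close>

lemma Z_l2: "x \<in> l2_seqs \<Longrightarrow> (x, \<lambda>j. 0) \<in> Z" "q (x, \<lambda>j. 0) = l2_norm x"
  by (simp_all add: Z_iff q_def Omega_zero l2_zero l2_norm_0)

text \<open>For blocks the quasi-norm is computed from the two \<open>\<ell>\<^sub>2\<close> parts up to an error controlled by
  the second one: summing \<open>a i * restr (A i) (B (y i))\<close> competes with \<open>B (\<Sum>i. a i * y i)\<close>.\<close>

lemma block_estimate:
  assumes A: "admissible k A" and v: "\<And>i. i < k \<Longrightarrow> v i \<in> Z"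
    and supp: "\<And>i. i < k \<Longrightarrow> prestr (A i) (v i) = v i"
  shows "q (plincomb a v k) \<le> (6 * C + 2) * L2_set (\<lambda>i. cmod (a i) * q (v i)) {..<k}"
    and "L2_set (\<lambda>i. cmod (a i) * q (v i)) {..<k} \<le> (10 * C + 2) * q (plincomb a v k)"
proof -
  let ?Q = "L2_set (\<lambda>i. cmod (a i) * q (v i)) {..<k}"
  note dis = admissible_disjoint[OF A] and fin = admissible_finite[OF A]
  define y where "y i = snd (v i)" for i
  define D where "D i = (\<lambda>j. fst (v i) j - Omega B (y i) j)" for i
  \<comment> \<open>\<open>D i\<close> need not be supported in \<open>A i\<close>, because
    \<open>Omega B (y i)\<close> need not be. Only its part inside \<open>A i\<close> enters the
    exact l2 computation.\<close>
  define r where "r i = l2_norm (restr (A i) (D i))" for i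
  define s where "s i = l2_norm (y i)" for i
  define Y where "Y = snd (plincomb a v k)"
  have y: "y i \<in> l2_seqs" and D: "D i \<in> l2_seqs" if "i < k" for i
    using v[OF that] by (auto simp: Z_iff D_def y_def)
  have s0: "0 \<le> s i" if "i < k" for i using y[OF that] by (simp add: s_def l2_norm_nonneg)
  have r0: "0 \<le> r i" if "i < k" for i using D[OF that] by (simp add: r_def l2_norm_nonneg l2_restr)
  have ry: "restr (A i) (y i) = y i" and rx: "restr (A i) (fst (v i)) = fst (v i)" if "i < k" for i
    using supp[OF that] unfolding prestr_def y_def by (metis fst_conv snd_conv)+
  have qv: "q (v i) = l2_norm (D i) + s i" for i by (simp add: q_def D_def s_def y_def)
  have rq: "r i \<le> q (v i)" "s i \<le> q (v i)" if "i < k" for i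
    using l2_norm_restr[OF D[OF that], of "A i"] s0[OF that] l2_norm_nonneg[OF D[OF that]]
    by (auto simp: qv r_def)
  \<comment> \<open>Since \<open>fst (v i)\<close> vanishes off \<open>A i\<close>, the part of
    \<open>D i\<close> outside comes from \<open>Omega B (y i)\<close> alone and is bounded by
    \<open>Omega_restr\<close>.\<close>
  have qr: "q (v i) \<le> r i + (4 * C + 1) * s i" if "i < k" for i
  proof -
    have "l2_le (r i + 4 * C * s i) (\<lambda>j. restr (A i) (D i) j + (restr (A i) (Omega B (y i)) j - Omega B (restr (A i) (y i)) j))"
      unfolding r_def s_def by (intro l2_le_add l2_leI l2_restr D y that Omega_restr)
    moreover have "restr (A i) (D i) j + restr (A i) (Omega B (y i)) j = fst (v i) j" for j
    proof -
      have "restr (A i) (D i) j + restr (A i) (Omega B (y i)) j = restr (A i) (fst (v i)) j"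
        by (simp add: D_def restr_def)
      then show ?thesis by (simp add: rx[OF that])
    qed
    ultimately have "l2_le (r i + 4 * C * s i) (D i)"
      by (simp add: ry[OF that] D_def add_diff_eq)
    then show ?thesis using l2_leD(2)[of _ "D i"] by (fastforce simp: qv algebra_simps)
  qed
  have Yeq: "Y = (\<lambda>j. \<Sum>i<k. restr (A i) (\<lambda>j. a i * y i j) j)"
    unfolding Y_def plincomb_def by (simp add: restr_scale ry y_def[symmetric])
  have nsc: "l2_norm (restr (A i) (\<lambda>j. a i * y i j)) = cmod (a i) * s i" if "i < k" for i
    unfolding restr_scale using that by (simp add: ry l2_norm_scale y s_def)
  have nY: "l2_norm Y = L2_set (\<lambda>i. cmod (a i) * s i) {..<k}"
    unfolding Yeq by (subst l2_norm_blocks) (use dis fin nsc in \<open>auto intro!: L2_set_cong\<close>)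
  have Yl: "Y \<in> l2_seqs" using Z_lincomb[OF v] by (auto simp: Y_def Z_iff)
  define W where "W = (\<lambda>j. fst (plincomb a v k) j - Omega B Y j)"
  have Wl: "W \<in> l2_seqs" using Z_lincomb[OF v] by (auto simp: W_def Y_def Z_iff)
  have qW: "q (plincomb a v k) = l2_norm W + l2_norm Y" by (simp add: q_def W_def Y_def)
  \<comment> \<open>P is a disjoint sum, so its norm is an exact L2 sum of the \<open>r i\<close>; W
    is the first part that occurs in the quasi-norm. The estimates follow from comparing the
    two.\<close>
  define P where "P = (\<lambda>j. \<Sum>i<k. restr (A i) (\<lambda>j. a i * D i j) j)"
  have nP: "l2_norm P = L2_set (\<lambda>i. cmod (a i) * r i) {..<k}"
  proof -
    have "l2_norm (restr (A i) (\<lambda>j. a i * D i j)) = cmod (a i) * r i" if "i < k" for i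
      unfolding restr_scale r_def using that by (simp add: l2_norm_scale D l2_restr)
    then show ?thesis unfolding P_def
      by (subst l2_norm_blocks) (use dis fin in \<open>auto intro!: L2_set_cong\<close>)
  qed
  have Pl: "P \<in> l2_seqs"
  proof -
    have "finite {j. P j \<noteq> 0}"
    proof (rule finite_subset[of _ "\<Union>i<k. A i"])
      have "P j = 0" if "j \<notin> (\<Union>i<k. A i)" for j
        unfolding P_def by (rule sum.neutral) (use that in \<open>auto simp: restr_def\<close>)
      then show "{j. P j \<noteq> 0} \<subseteq> (\<Union>i<k. A i)" by blast
    qed (use fin in auto)
    then show ?thesis using c00_subset_l2 by (auto simp: c00_def)
  qed
  \<comment> \<open>The constant is \<open>2 * (2 * C + C)\<close>: the bound of the block
    competitor with \<open>sqrt 2\<close> rounded up to 2, the bound of the selection itself, and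
    the factor 2 of \<open>Omega_compare\<close>.\<close>
  have err: "l2_le (6 * C * l2_norm Y) (\<lambda>j. P j - W j)"
  proof -
    define G where "G z = (\<lambda>j. \<Sum>i<k. restr (A i) (\<lambda>j. a i * B (y i) z j) j)" for z
    have G: "strip_le (sqrt 2 * L2_set (\<lambda>i. cmod (a i) * (C * s i)) {..<k}) G"
      unfolding G_def s_def by (intro strip_le_blocks A strip_le_scale B_le y)
    have "L2_set (\<lambda>i. cmod (a i) * (C * s i)) {..<k} = C * l2_norm Y"
      unfolding nY using C_nonneg by (simp add: L2_set_right_distrib mult_ac)
    moreover have "sqrt 2 \<le> (2::real)" by (rule real_le_lsqrt) auto
    ultimately have "strip_le (2 * (C * l2_norm Y)) G"
      using G C_nonneg l2_norm_nonneg[OF Yl]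
      by (auto elim!: strip_le_mono intro!: mult_right_mono)
    moreover have "G (1/2) = Y" unfolding G_def Yeq by (simp add: B_half y)
    ultimately have "l2_le (2 * (2 * (C * l2_norm Y) + C * l2_norm Y)) (\<lambda>j. deriv (\<lambda>z. G z j) (1/2) - Omega B Y j)"
      by (intro Omega_compare Yl)
    moreover have "deriv (\<lambda>z. G z j) (1/2) = (\<Sum>i<k. restr (A i) (\<lambda>j. a i * Omega B (y i) j) j)" for j
    proof -
      have fd: "((\<lambda>z. restr (A i) (\<lambda>j. a i * B (y i) z j) j) has_field_derivative
          restr (A i) (\<lambda>j. a i * Omega B (y i) j) j) (at (1/2))" if "i < k" for i
      proof (cases "j \<in> A i")
        case True
        have "(\<lambda>z. B (y i) z j) field_differentiable at (1/2)"
          by (rule strip_le_differentiable[OF B_le[OF y[OF that]]])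
        then have "((\<lambda>z. B (y i) z j) has_field_derivative Omega B (y i) j) (at (1/2))"
          by (simp add: Omega_def DERIV_deriv_iff_field_differentiable)
        then show ?thesis using True by (auto simp: restr_def intro!: DERIV_cmult)
      qed (simp add: restr_def)
      then show ?thesis unfolding G_def by (intro DERIV_imp_deriv DERIV_sum) auto
    qed
    moreover have "P j - W j = Omega B Y j - (\<Sum>i<k. restr (A i) (\<lambda>j. a i * Omega B (y i) j) j)" for j
    proof -
      have "P j + (\<Sum>i<k. restr (A i) (\<lambda>j. a i * Omega B (y i) j) j) = (\<Sum>i<k. restr (A i) (\<lambda>j. a i * fst (v i) j) j)"
        unfolding P_def sum.distrib[symmetric]
        by (rule sum.cong) (auto simp: restr_def D_def algebra_simps)
      also have "\<dots> = fst (plincomb a v k) j"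
        unfolding plincomb_def by (simp add: restr_scale rx)
      finally show ?thesis by (simp add: W_def algebra_simps)
    qed
    ultimately show ?thesis
      using l2_le_minus[of "6 * C * l2_norm Y" "\<lambda>j. (\<Sum>i<k. restr (A i) (\<lambda>j. a i * Omega B (y i) j) j) - Omega B Y j"]
      by (simp add: mult_ac)
  qed
  have diff: "\<bar>l2_norm P - l2_norm W\<bar> \<le> 6 * C * l2_norm Y"
    using l2_norm_triangle_diff[OF Pl Wl] l2_leD(2)[OF err] by linarith
  have q0: "0 \<le> q (v i)" if "i < k" for i using q_nonneg v that by blast
  have PQ: "l2_norm P \<le> ?Q"
    unfolding nP by (rule L2_set_mono) (use rq r0 in \<open>auto intro!: mult_left_mono\<close>)
  have YQ: "l2_norm Y \<le> ?Q"
    unfolding nY by (rule L2_set_mono) (use rq s0 in \<open>auto intro!: mult_left_mono\<close>)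
  have "q (plincomb a v k) \<le> l2_norm P + (6 * C + 1) * l2_norm Y"
    using diff by (simp add: qW algebra_simps)
  also have "\<dots> \<le> ?Q + (6 * C + 1) * ?Q"
    using PQ YQ C_nonneg by (intro add_mono mult_left_mono) auto
  finally show "q (plincomb a v k) \<le> (6 * C + 2) * ?Q"
    by (simp add: algebra_simps)
  \<comment> \<open>In the lower estimate \<open>4 * C + 1\<close> comes from \<open>qr\<close>, and
    replacing P by W adds \<open>6 * C\<close>.\<close>
  have "?Q \<le>
      L2_set (\<lambda>i. cmod (a i) * r i + (4 * C + 1) * (cmod (a i) * s i)) {..<k}"
  proof (rule L2_set_mono)
    fix i assume "i \<in> {..<k}"
    then have "cmod (a i) * q (v i) \<le> cmod (a i) * (r i + (4 * C + 1) * s i)"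
      using qr by (intro mult_left_mono) auto
    then show "cmod (a i) * q (v i) \<le> cmod (a i) * r i + (4 * C + 1) * (cmod (a i) * s i)"
      by (simp add: algebra_simps)
  qed (use q0 in auto)
  also have "\<dots> \<le> L2_set (\<lambda>i. cmod (a i) * r i) {..<k} + L2_set (\<lambda>i. (4 * C + 1) * (cmod (a i) * s i)) {..<k}"
    by (rule L2_set_triangle_ineq)
  also have "\<dots> = l2_norm P + (4 * C + 1) * l2_norm Y"
    using C_nonneg by (simp add: nP nY L2_set_right_distrib)
  also have "\<dots> \<le> l2_norm W + (10 * C + 1) * l2_norm Y" using diff by (simp add: algebra_simps)
  also have "\<dots> \<le> (10 * C + 2) * (l2_norm W + l2_norm Y)"
    using C_nonneg l2_norm_nonneg[OF Wl] l2_norm_nonneg[OF Yl] by (simp add: algebra_simps)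
  finally show "?Q \<le> (10 * C + 2) * q (plincomb a v k)"
    by (simp add: qW)
qed

end

text \<open>Diagonal extraction. Dividing the coordinate i by \<open>K i + 1\<close> supplies the
  uniform bound under which \<open>function_convergent_subsequence\<close> applies.\<close>

lemma coordinatewise_convergent_subsequence:
  fixes f :: "nat \<Rightarrow> 'i::countable \<Rightarrow> complex"
  assumes bdd: "\<And>i. \<exists>K. \<forall>k. cmod (f k i) \<le> K"
  shows "\<exists>s x. strict_mono (s :: nat \<Rightarrow> nat) \<and> (\<forall>i. (\<lambda>k. f (s k) i) \<longlonglongrightarrow> x i)"
proof -
  obtain K where K: "\<And>i k. cmod (f k i) \<le> K i" using bdd by metis
  have K0: "0 \<le> K i" for i using K[of 0 i] norm_ge_zero order_trans by blast
  define g where "g k i = f k i / of_real (K i + 1)" for k i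
  have g1: "cmod (g k i) \<le> 1" for k i
    using K[of k i] K0[of i] unfolding g_def norm_divide norm_of_real by (simp add: divide_le_eq)
  obtain s where s: "strict_mono (s :: nat \<Rightarrow> nat)" "\<And>i. \<exists>l. (\<lambda>k. g (s k) i) \<longlonglongrightarrow> l"
    using function_convergent_subsequence[of "UNIV :: 'i set" g 1] g1 by (metis UNIV_I countableI_type)
  have "\<exists>l. (\<lambda>k. f (s k) i) \<longlonglongrightarrow> l" for i
  proof -
    obtain l where "(\<lambda>k. g (s k) i) \<longlonglongrightarrow> l" using s(2) by blast
    then have "(\<lambda>k. g (s k) i * of_real (K i + 1)) \<longlonglongrightarrow> l * of_real (K i + 1)" by (intro tendsto_intros)
    moreover have "of_real (K i + 1) \<noteq> (0 :: complex)"
      using K0[of i] by (metis add_nonneg_pos less_irrefl of_real_eq_0_iff zero_less_one)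
    ultimately show ?thesis by (auto simp: g_def)
  qed
  then show ?thesis using s(1) by metis
qed

lemma null_sequence_less:
  assumes "f \<longlonglongrightarrow> (0::real)" "0 < e" shows "\<exists>n0. \<forall>n\<ge>n0. f n < e"
  using order_tendstoD(2)[OF assms] by (simp add: eventually_sequentially)

lemma padd_assoc_diff: "w = padd (pdiff w v) v"
  by (simp add: p_defs)

section \<open>The twisted sum under an equivalent norm\<close>

text \<open>The two gauges share the work: N is exactly homogeneous and subadditive, as spreading
  models require, while q has the explicit formula on which block estimates rest.\<close>

locale normed_twisted_sum = twisted_sum +
  fixes N :: "cseq \<times> cseq \<Rightarrow> real" and c1 c2 :: real
  assumes is_norm: "is_norm_on (Z_space B) N"
    and c1: "0 < c1" and c2: "0 < c2"
    and N_lower: "w \<in> Z \<Longrightarrow> c1 * q w \<le> N w" and N_upper: "w \<in> Z \<Longrightarrow> N w \<le> c2 * q w"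
begin

lemma N_nonneg: "w \<in> Z \<Longrightarrow> 0 \<le> N w"
  using is_norm by (simp add: is_norm_on_def)

lemma N_eq_0: "w \<in> Z \<Longrightarrow> N w = 0 \<longleftrightarrow> w = (\<lambda>j. 0, \<lambda>j. 0)"
  using is_norm by (simp add: is_norm_on_def Z_space_ops)

lemma N_add: "w \<in> Z \<Longrightarrow> v \<in> Z \<Longrightarrow> N (padd w v) \<le> N w + N v"
  using is_norm by (simp add: is_norm_on_def Z_space_ops)

lemma N_scale: "w \<in> Z \<Longrightarrow> N (pscale a w) = cmod a * N w"
  using is_norm by (simp add: is_norm_on_def Z_space_ops)

lemma N_diff: "w \<in> Z \<Longrightarrow> v \<in> Z \<Longrightarrow> N (pdiff w v) \<le> N w + N v"
  unfolding pdiff_eq using N_add[of w "pscale (-1) v"] by (simp add: Z_scale N_scale)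

lemma N_diff_ge: "w \<in> Z \<Longrightarrow> v \<in> Z \<Longrightarrow> N w - N v \<le> N (pdiff w v)"
  using N_add[of "pdiff w v" v] by (simp add: Z_diff padd_assoc_diff[symmetric])

lemma N_diff_commute: "w \<in> Z \<Longrightarrow> v \<in> Z \<Longrightarrow> N (pdiff w v) = N (pdiff v w)"
  using N_scale[of "pdiff w v" "-1"] by (simp add: Z_diff) (simp add: p_defs)

lemma N_triangle_diff: "w \<in> Z \<Longrightarrow> v \<in> Z \<Longrightarrow> \<bar>N w - N v\<bar> \<le> N (pdiff w v)"
  using N_diff_ge[of w v] N_diff_ge[of v w] N_diff_commute[of w v] by linarith

lemma N_lincomb_le:
  assumes "\<And>i. i < n \<Longrightarrow> v i \<in> Z"
  shows "N (plincomb a v n) \<le> (\<Sum>i<n. cmod (a i) * N (v i))"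
  using assms
proof (induction n)
  case 0
  then show ?case using N_eq_0[OF Z_zero] by (simp add: plincomb_0)
next
  case (Suc n)
  have "N (padd (plincomb a v n) (pscale (a n) (v n))) \<le> N (plincomb a v n) + cmod (a n) * N (v n)"
    using N_add[of "plincomb a v n" "pscale (a n) (v n)"] Suc.prems
    by (simp add: Z_lincomb Z_scale N_scale)
  then show ?case using Suc by (fastforce simp: plincomb_Suc)
qed

text \<open>A common bound, with respect to N, for all restrictions to sets of coordinates.\<close>

definition K0 :: real where "K0 = c2 * (4 * C + 1) / c1"

lemma K0_nonneg: "0 \<le> K0"
  using c1 c2 C_nonneg by (simp add: K0_def)

lemma N_restr:
  assumes w: "w \<in> Z" shows "N (prestr A w) \<le> K0 * N w"
proof -
  have "N (prestr A w) \<le> c2 * ((4 * C + 1) * q w)"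
    using N_upper[OF Z_restr(1)[OF w]] mult_left_mono[OF Z_restr(2)[OF w]] c2 by (meson less_imp_le order_trans)
  also have "\<dots> \<le> c2 * ((4 * C + 1) * (N w / c1))"
    using N_lower[OF w] c1 c2 C_nonneg by (intro mult_left_mono) (auto simp: field_simps)
  finally show ?thesis by (simp add: K0_def)
qed

lemma N_coord: "\<exists>K\<ge>0. \<forall>w\<in>Z. cmod (fst w i) \<le> K * N w \<and> cmod (snd w i) \<le> K * N w"
proof -
  obtain K where K: "0 \<le> K" "\<forall>w\<in>Z. cmod (fst w i) \<le> K * q w \<and> cmod (snd w i) \<le> K * q w"
    using q_coord by blast
  have "K * q w \<le> K / c1 * N w" if "w \<in> Z" for w
  proof -
    have "q w \<le> N w / c1" using N_lower[OF that] c1 by (simp add: field_simps)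
    from mult_left_mono[OF this K(1)] show ?thesis by simp
  qed
  then show ?thesis using K c1 by (intro exI[of _ "K / c1"]) (fastforce intro: order_trans)
qed

lemma N_finite:
  "N (prestr {..<n} w) \<le> (\<Sum>i<n. cmod (fst w i) * N (unit_seq i, \<lambda>j. 0) + cmod (snd w i) * N (\<lambda>j. 0, unit_seq i))"
proof (induction n)
  case 0
  have "prestr {..<0} w = (\<lambda>j. 0, \<lambda>j. 0)" by (auto simp: prestr_def restr_def)
  then show ?case using N_eq_0[OF Z_zero] by simp
next
  case (Suc n)
  have e: "prestr {..<Suc n} w = padd (prestr {..<n} w)
      (padd (pscale (fst w n) (unit_seq n, \<lambda>j. 0)) (pscale (snd w n) (\<lambda>j. 0, unit_seq n)))"
    by (auto simp: p_defs restr_def unit_seq_def fun_eq_iff less_Suc_eq)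
  have u: "prestr {n} (unit_seq n, \<lambda>j. 0) = (unit_seq n, \<lambda>j. 0)"
    "prestr {n} (\<lambda>j. 0, unit_seq n) = (\<lambda>j. 0, unit_seq n)"
    by (auto simp: p_defs restr_def unit_seq_def fun_eq_iff)
  then have z: "(unit_seq n, \<lambda>j. 0) \<in> Z" "(\<lambda>j. 0, unit_seq n) \<in> Z"
    using Z_finite[of "{n}"] by (metis finite.emptyI finite_insert)+
  have "N (prestr {..<Suc n} w) \<le> N (prestr {..<n} w) +
     N (padd (pscale (fst w n) (unit_seq n, \<lambda>j. 0)) (pscale (snd w n) (\<lambda>j. 0, unit_seq n)))"
    unfolding e by (intro N_add Z_add Z_scale z Z_finite) simp
  moreover have "N (padd (pscale (fst w n) (unit_seq n, \<lambda>j. 0)) (pscale (snd w n) (\<lambda>j. 0, unit_seq n))) \<le>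
     cmod (fst w n) * N (unit_seq n, \<lambda>j. 0) + cmod (snd w n) * N (\<lambda>j. 0, unit_seq n)"
    using N_add[OF Z_scale[OF z(1)] Z_scale[OF z(2)]] by (simp add: N_scale z)
  ultimately show ?case using Suc by simp
qed

text \<open>Only \<open>2 * n\<close> scalar coordinates are involved, and on them coordinatewise
  convergence is norm convergence.\<close>

lemma null_truncation:
  assumes "\<And>i. (\<lambda>k. fst (u k) i) \<longlonglongrightarrow> 0" "\<And>i. (\<lambda>k. snd (u k) i) \<longlonglongrightarrow> 0"
  shows "(\<lambda>k. N (prestr {..<n} (u k))) \<longlonglongrightarrow> 0"
proof (rule tendsto_sandwich)
  let ?S = "\<lambda>k. \<Sum>i<n. cmod (fst (u k) i) * N (unit_seq i, \<lambda>j. 0) + cmod (snd (u k) i) * N (\<lambda>j. 0, unit_seq i)"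
  show "\<forall>\<^sub>F k in sequentially. 0 \<le> N (prestr {..<n} (u k))" by (simp add: N_nonneg Z_finite)
  show "\<forall>\<^sub>F k in sequentially. N (prestr {..<n} (u k)) \<le> ?S k"
    using N_finite by simp
  have "?S \<longlonglongrightarrow> (\<Sum>i<n. cmod 0 * N (unit_seq i, \<lambda>j. 0) + cmod 0 * N (\<lambda>j. 0, unit_seq i))"
    by (intro tendsto_intros assms)
  then show "?S \<longlonglongrightarrow> 0" by simp
qed simp

text \<open>A vector splits as \<open>w = w' + (\<Omega> z, z)\<close> with a short tail \<open>z\<close> of its second component, whence
  \<open>(\<Omega> z, z)\<close> is small and both components of \<open>w'\<close> lie in \<open>\<ell>\<^sub>2\<close>.\<close>

lemma N_truncation:
  assumes w: "w \<in> Z"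
  shows "(\<lambda>n. N (pdiff w (prestr {..<n} w))) \<longlonglongrightarrow> 0"
proof (rule LIMSEQ_I)
  fix e :: real assume e: "0 < e"
  define y where "y = snd w"
  have y: "y \<in> l2_seqs" using w by (simp add: Z_iff y_def)
  \<comment> \<open>Chosen so that \<open>(1 + K0) * (c2 * \<eta>)\<close> equals
    \<open>e / 2\<close>, which bounds the vector \<open>v\<close> together with its
    truncation.\<close>
  define \<eta> where "\<eta> = e / 2 / (c2 * (1 + K0))"
  have \<eta>: "0 < \<eta>" using e c2 K0_nonneg unfolding \<eta>_def by (intro divide_pos_pos mult_pos_pos) auto
  obtain m where m: "l2_norm (\<lambda>j. y j - restr {..<m} y j) < \<eta>"
    using null_sequence_less[OF l2_tail[OF y] \<eta>] by blast
  define z where "z = (\<lambda>j. y j - restr {..<m} y j)"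
  have z: "z \<in> l2_seqs" unfolding z_def by (intro l2_diff l2_restr y)
  define v where "v = (Omega B z, z)"
  have v: "v \<in> Z" and qv: "q v = l2_norm z" using z by (simp_all add: v_def Z_iff q_def l2_zero l2_norm_0)
  define w' where "w' = pdiff w v"
  have w': "w' \<in> Z" unfolding w'_def by (rule Z_diff[OF w v])
  have sw': "snd w' = restr {..<m} y" by (simp add: w'_def v_def z_def pdiff_def y_def)
  define x where "x = fst w'"
  have "(\<lambda>j. (x j - Omega B (restr {..<m} y) j) + Omega B (restr {..<m} y) j) \<in> l2_seqs"
    using w' unfolding Z_iff sw' x_def
    by (intro l2_add Omega_c00 c00_restr_finite) auto
  then have x: "x \<in> l2_seqs" by simp
  have "0 < e / 2 / c2" using e c2 by simp
  from null_sequence_less[OF l2_tail[OF x] this] obtain n0 where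
    n0: "\<And>n. n \<ge> n0 \<Longrightarrow> l2_norm (\<lambda>j. x j - restr {..<n} x j) < e / 2 / c2" by blast
  have "norm (N (pdiff w (prestr {..<n} w)) - 0) < e" if n: "n \<ge> max m n0" for n
  proof -
    \<comment> \<open>For \<open>n >= m\<close> the second component of \<open>w'\<close> is already
      truncated, so the difference lies in the copy of l2, where N is at most c2 times the l2
      norm.\<close>
    have "pdiff w' (prestr {..<n} w') = ((\<lambda>j. x j - restr {..<n} x j), \<lambda>j. 0)"
      using n by (auto simp: p_defs sw' x_def fun_eq_iff) (auto simp: restr_def)
    then have "N (pdiff w' (prestr {..<n} w')) \<le> c2 * l2_norm (\<lambda>j. x j - restr {..<n} x j)"
      using N_upper[OF Z_l2(1)[OF l2_diff[OF x l2_restr[OF x, of "{..<n}"]]]] by (simp add: Z_l2(2))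
    also have "\<dots> < e / 2" using n0[of n] n c2 by (simp add: field_simps)
    finally have 1: "N (pdiff w' (prestr {..<n} w')) < e / 2" .
    have "N v \<le> c2 * \<eta>"
      using N_upper[OF v] mult_left_mono[OF less_imp_le[OF m] less_imp_le[OF c2]] by (simp add: qv z_def)
    then have "N v + K0 * N v \<le> (1 + K0) * (c2 * \<eta>)"
      using mult_left_mono[of "N v" "c2 * \<eta>" "1 + K0"] K0_nonneg by (simp add: algebra_simps)
    also have "\<dots> = e / 2"
    proof -
      have "c2 * (1 + K0) \<noteq> 0" using c2 K0_nonneg by simp
      then have "\<eta> * (c2 * (1 + K0)) = e / 2"
        by (rule nonzero_eq_divide_eq[THEN iffD1, OF _ \<eta>_def])
      then show ?thesis by (simp only: mult_ac)
    qed
    finally have 2: "N (pdiff v (prestr {..<n} v)) \<le> e / 2"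
      using N_diff[OF v Z_restr(1)[OF v, of "{..<n}"]] N_restr[OF v, of "{..<n}"] by linarith
    have "pdiff w (prestr {..<n} w) = padd (pdiff w' (prestr {..<n} w')) (pdiff v (prestr {..<n} v))"
      by (auto simp: w'_def p_defs fun_eq_iff restr_def)
    then have "N (pdiff w (prestr {..<n} w)) \<le> N (pdiff w' (prestr {..<n} w')) + N (pdiff v (prestr {..<n} v))"
      by (simp add: N_add Z_diff Z_restr(1) w' v)
    then show ?thesis using 1 2 N_nonneg[OF Z_diff[OF w Z_restr(1)[OF w]], of "{..<n}"] by simp
  qed
  then show "\<exists>no. \<forall>n\<ge>no. norm (N (pdiff w (prestr {..<n} w)) - 0) < e" by blast
qed

text \<open>A Fatou property. Truncations of w are norm limits of truncations of the
  \<open>v k\<close>, hence uniformly bounded, and uniform bounds on the finite sections of both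
  parts place w in the twisted sum.\<close>

lemma coordinatewise_limit:
  assumes v: "\<And>k. v k \<in> Z" and bdd: "\<And>k. N (v k) \<le> K"
    and lim: "\<And>i. (\<lambda>k. fst (v k) i) \<longlonglongrightarrow> fst w i" "\<And>i. (\<lambda>k. snd (v k) i) \<longlonglongrightarrow> snd w i"
  shows "w \<in> Z"
proof -
  define K1 where "K1 = K0 * K / c1"
  have q1: "q (prestr {..<n} w) \<le> K1" for n
  proof -
    have null: "(\<lambda>k. fst (pdiff (v k) w) i) \<longlonglongrightarrow> 0" "(\<lambda>k. snd (pdiff (v k) w) i) \<longlonglongrightarrow> 0" for i
      using lim[of i] by (auto simp: pdiff_def LIM_zero)
    have "N (prestr {..<n} w) - N (prestr {..<n} (pdiff (v k) w)) \<le> K0 * K" for k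
    proof -
      have "prestr {..<n} w = pdiff (prestr {..<n} (v k)) (prestr {..<n} (pdiff (v k) w))"
        by (auto simp: p_defs restr_def fun_eq_iff)
      then have "N (prestr {..<n} w) \<le> N (prestr {..<n} (v k)) + N (prestr {..<n} (pdiff (v k) w))"
        by (metis N_diff Z_finite finite_lessThan)
      moreover have "N (prestr {..<n} (v k)) \<le> K0 * K"
        using N_restr[OF v, of "{..<n}" k] mult_left_mono[OF bdd K0_nonneg, of k] by linarith
      ultimately show ?thesis by linarith
    qed
    moreover have "(\<lambda>k. N (prestr {..<n} w) - N (prestr {..<n} (pdiff (v k) w))) \<longlonglongrightarrow> N (prestr {..<n} w) - 0"
      by (intro tendsto_diff tendsto_const null_truncation null)
    ultimately have "N (prestr {..<n} w) \<le> K0 * K" by (intro LIMSEQ_le_const2) auto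
    then have "c1 * q (prestr {..<n} w) \<le> K0 * K" using N_lower[OF Z_finite, of "{..<n}" w] by simp
    then show ?thesis using c1 by (simp add: K1_def field_simps)
  qed
  have parts: "l2_norm (restr {..<n} (snd w)) \<le> K1"
    "l2_norm (\<lambda>j. restr {..<n} (fst w) j - Omega B (restr {..<n} (snd w)) j) \<le> K1" for n
  proof -
    have Z: "prestr {..<n} w \<in> Z" by (rule Z_finite) simp
    have n: "0 \<le> l2_norm (restr {..<n} (snd w))"
      "0 \<le> l2_norm (\<lambda>j. restr {..<n} (fst w) j - Omega B (restr {..<n} (snd w)) j)"
      using Z by (auto simp: Z_iff prestr_def intro: l2_norm_nonneg)
    show "l2_norm (restr {..<n} (snd w)) \<le> K1"
      "l2_norm (\<lambda>j. restr {..<n} (fst w) j - Omega B (restr {..<n} (snd w)) j) \<le> K1"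
      using q1[of n] n by (auto simp: q_def prestr_def)
  qed
  have cut: "L2_set (\<lambda>j. cmod (restr {..<n} x j)) {..<n} = L2_set (\<lambda>j. cmod (x j)) {..<n}" for x n
    by (rule L2_set_cong) (auto simp: restr_def)
  have "l2_le K1 (snd w)" unfolding l2_le_def
  proof
    fix n
    have "l2_le K1 (restr {..<n} (snd w))"
      using parts(1) c00_restr_finite[of "{..<n}"] c00_subset_l2 by (auto simp: l2_le_iff)
    then show "L2_set (\<lambda>j. cmod (snd w j)) {..<n} \<le> K1"
      using cut[of n "snd w"] unfolding l2_le_def by metis
  qed
  then have y: "snd w \<in> l2_seqs" by (rule l2_leD)
  \<comment> \<open>The truncations control \<open>Omega\<close> of the truncated second component;
    passing to the truncation of \<open>Omega\<close> adds the commutator bound.\<close>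
  have "l2_le (K1 + 4 * C * l2_norm (snd w)) (\<lambda>j. fst w j - Omega B (snd w) j)" unfolding l2_le_def
  proof
    fix n
    have Z: "prestr {..<n} w \<in> Z" by (rule Z_finite) simp
    have "l2_le K1 (\<lambda>j. restr {..<n} (fst w) j - Omega B (restr {..<n} (snd w)) j)"
      using parts(2) Z by (auto simp: l2_le_iff Z_iff prestr_def)
    from l2_le_diff[OF this Omega_restr[OF y, of "{..<n}"]]
    have "l2_le (K1 + 4 * C * l2_norm (snd w)) (restr {..<n} (\<lambda>j. fst w j - Omega B (snd w) j))"
      by (simp add: restr_diff)
    then show "L2_set (\<lambda>j. cmod (fst w j - Omega B (snd w) j)) {..<n} \<le> K1 + 4 * C * l2_norm (snd w)"
      using cut[of n "\<lambda>j. fst w j - Omega B (snd w) j"] unfolding l2_le_def by metis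
  qed
  then show ?thesis using y by (auto simp: Z_iff dest: l2_leD)
qed

text \<open>A late index makes the initial segment small because the coordinates tend to 0, and a
  large right end makes the tail small by \<open>N_truncation\<close>. The freely chosen error e is
  the same for all i.\<close>

lemma gliding_hump:
  assumes u: "\<And>k. u k \<in> Z"
    and null: "\<And>i. (\<lambda>k. fst (u k) i) \<longlonglongrightarrow> 0" "\<And>i. (\<lambda>k. snd (u k) i) \<longlonglongrightarrow> 0"
    and e: "0 < e" and n: "1 \<le> n"
  shows "\<exists>(k :: nat \<Rightarrow> nat) A. strict_mono k \<and> (\<forall>i. \<nu> \<le> k i) \<and> admissible n A \<and>
    (\<forall>i. N (pdiff (u (k i)) (prestr (A i) (u (k i)))) < e)"
proof -
  have step: "\<exists>k m'. \<nu> \<le> k \<and> m < m' \<and> N (pdiff (u k) (prestr {m..<m'} (u k))) < e" for m \<nu>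
  proof -
    have e2: "0 < e / 2" using e by simp
    obtain k0 where "\<And>k. k \<ge> k0 \<Longrightarrow> N (prestr {..<m} (u k)) < e / 2"
      using null_sequence_less[OF null_truncation[OF null] e2] by blast
    then have 1: "N (prestr {..<m} (u (k0 + \<nu>))) < e / 2" by simp
    let ?u = "u (k0 + \<nu>)"
    obtain m0 where "\<And>m'. m' \<ge> m0 \<Longrightarrow> N (pdiff ?u (prestr {..<m'} ?u)) < e / 2"
      using null_sequence_less[OF N_truncation[OF u] e2] by blast
    then have 2: "N (pdiff ?u (prestr {..<m0 + Suc m} ?u)) < e / 2" by simp
    have "pdiff ?u (prestr {m..<m0 + Suc m} ?u) =
        padd (pdiff ?u (prestr {..<m0 + Suc m} ?u)) (prestr {..<m} ?u)"
      by (auto simp: p_defs restr_def fun_eq_iff)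
    then have "N (pdiff ?u (prestr {m..<m0 + Suc m} ?u)) \<le>
        N (pdiff ?u (prestr {..<m0 + Suc m} ?u)) + N (prestr {..<m} ?u)"
      by (simp add: N_add Z_diff Z_finite u)
    then show ?thesis using 1 2
      by (intro exI[of "\<lambda>k. \<exists>m'. \<nu> \<le> k \<and> m < m' \<and> N (pdiff (u k) (prestr {m..<m'} (u k))) < e" "k0 + \<nu>"]
          exI[of _ "m0 + Suc m"]) auto
  qed
  \<comment> \<open>A state holds the last index and the left end of the next window. Window i runs
    between the second entries of states i and i + 1 and belongs to the index of state i + 1.
    Starting at n makes n blocks admissible.\<close>
  have "\<exists>f :: nat \<Rightarrow> nat \<times> nat. \<forall>i. (\<nu> \<le> fst (f i) \<and> n \<le> snd (f i)) \<and>
      (fst (f i) < fst (f (Suc i)) \<and> snd (f i) < snd (f (Suc i)) \<and>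
       N (pdiff (u (fst (f (Suc i)))) (prestr {snd (f i)..<snd (f (Suc i))} (u (fst (f (Suc i)))))) < e)"
  proof (rule dependent_nat_choice)
    show "\<exists>x :: nat \<times> nat. \<nu> \<le> fst x \<and> n \<le> snd x" by (intro exI[of _ "(\<nu>, n)"]) simp
  next
    fix x :: "nat \<times> nat" and i :: nat
    assume x: "\<nu> \<le> fst x \<and> n \<le> snd x"
    obtain k m' where k: "max \<nu> (Suc (fst x)) \<le> k" "snd x < m'"
      "N (pdiff (u k) (prestr {snd x..<m'} (u k))) < e" using step by blast
    show "\<exists>y. (\<nu> \<le> fst y \<and> n \<le> snd y) \<and> fst x < fst y \<and> snd x < snd y \<and>
        N (pdiff (u (fst y)) (prestr {snd x..<snd y} (u (fst y)))) < e"
      using k x by (intro exI[of _ "(k, m')"]) auto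
  qed
  then obtain f :: "nat \<Rightarrow> nat \<times> nat" where f: "\<And>i. \<nu> \<le> fst (f i)" "\<And>i. n \<le> snd (f i)"
    "\<And>i. fst (f i) < fst (f (Suc i))" "\<And>i. snd (f i) < snd (f (Suc i))"
    "\<And>i. N (pdiff (u (fst (f (Suc i)))) (prestr {snd (f i)..<snd (f (Suc i))} (u (fst (f (Suc i)))))) < e"
    by blast
  define A where "A i = {snd (f i)..<snd (f (Suc i))}" for i
  have sm: "strict_mono (\<lambda>i. fst (f (Suc i)))" using f(3) by (simp add: strict_mono_Suc_iff)
  have fin: "finite (A j)" and ne: "A j \<noteq> {}" for j
    using f(4)[of j] by (auto simp: A_def)
  have "admissible n A" unfolding admissible_def
  proof (intro conjI allI impI n)
    fix j show "finite (A j)" "A j \<noteq> {}" by (fact fin, fact ne)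
    show "Max (A j) < Min (A (Suc j))"
      using Max_in[OF fin ne, of j] Min_in[OF fin ne, of "Suc j"] unfolding A_def by simp
  next
    show "n \<le> Suc (Min (A 0))"
      using Min_in[OF fin ne, of 0] f(2)[of 0] unfolding A_def by simp
  qed
  then show ?thesis using f sm
    by (intro exI[of _ "\<lambda>i. fst (f (Suc i))"] exI[of _ A]) (auto simp: A_def)
qed

text \<open>One constant for both directions of the block estimate; \<open>10 * C + 2\<close>
  dominates the upper constant \<open>6 * C + 2\<close>.\<close>

definition \<kappa> :: real where "\<kappa> = c2 * (10 * C + 2) / c1"

lemma kappa_pos: "0 < \<kappa>"
  using c1 c2 C_nonneg by (simp add: \<kappa>_def)

lemma N_blocks:
  assumes A: "admissible n A" and v: "\<And>i. i < n \<Longrightarrow> v i \<in> Z"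
    and supp: "\<And>i. i < n \<Longrightarrow> prestr (A i) (v i) = v i"
  shows "N (plincomb a v n) \<le> \<kappa> * L2_set (\<lambda>i. cmod (a i) * N (v i)) {..<n}"
    and "L2_set (\<lambda>i. cmod (a i) * N (v i)) {..<n} \<le> \<kappa> * N (plincomb a v n)"
proof -
  note b = block_estimate[OF A v supp, where a = a]
  let ?Q = "L2_set (\<lambda>i. cmod (a i) * q (v i)) {..<n}" and ?N = "L2_set (\<lambda>i. cmod (a i) * N (v i)) {..<n}"
  have Zl: "plincomb a v n \<in> Z" by (rule Z_lincomb[OF v])
  have 1: "c1 * ?Q \<le> ?N"
    unfolding L2_set_right_distrib[OF less_imp_le[OF c1]]
    by (rule L2_set_mono) (use mult_left_mono[OF N_lower[OF v] norm_ge_zero] c1 q_nonneg[OF v] in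
        \<open>auto simp: mult.left_commute\<close>)
  have 2: "?N \<le> c2 * ?Q"
    unfolding L2_set_right_distrib[OF less_imp_le[OF c2]]
    by (rule L2_set_mono) (use mult_left_mono[OF N_upper[OF v] norm_ge_zero] c2 N_nonneg[OF v] in
        \<open>auto simp: mult.left_commute\<close>)
  have Q: "?Q \<le> ?N / c1" using 1 c1 by (simp add: field_simps)
  have "N (plincomb a v n) \<le> c2 * q (plincomb a v n)" by (rule N_upper[OF Zl])
  also have "\<dots> \<le> c2 * ((6 * C + 2) * ?Q)" using b(1) c2 by (intro mult_left_mono) auto
  also have "\<dots> \<le> c2 * ((10 * C + 2) * (?N / c1))"
    using Q C_nonneg c2 by (intro mult_left_mono mult_mono) auto
  finally show "N (plincomb a v n) \<le> \<kappa> * ?N" by (simp add: \<kappa>_def)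
  have "q (plincomb a v n) \<le> N (plincomb a v n) / c1" using N_lower[OF Zl] c1 by (simp add: field_simps)
  then have "c2 * ((10 * C + 2) * q (plincomb a v n)) \<le> c2 * ((10 * C + 2) * (N (plincomb a v n) / c1))"
    using C_nonneg c2 by (intro mult_left_mono) auto
  moreover have "c2 * ?Q \<le> c2 * ((10 * C + 2) * q (plincomb a v n))" using b(2) c2 by (intro mult_left_mono) auto
  ultimately show "?N \<le> \<kappa> * N (plincomb a v n)" using 2 by (simp add: \<kappa>_def)
qed

end


section \<open>Spreading models\<close>

text \<open>Realises the direct sum of the scalars and l2 inside l2 itself, by shifting the sequence
  to free the coordinate 0.\<close>

definition scons :: "complex \<Rightarrow> cseq \<Rightarrow> cseq" where
  "scons z x = (\<lambda>j. case j of 0 \<Rightarrow> z | Suc j \<Rightarrow> x j)"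

lemma scons_l2: "scons z x \<in> l2_seqs \<longleftrightarrow> x \<in> l2_seqs"
  using summable_Suc_iff[of "\<lambda>j. (cmod (scons z x j))\<^sup>2"] by (simp add: l2_seqs_def scons_def)

lemma scons_l2_norm:
  assumes x: "x \<in> l2_seqs"
  shows "l2_norm (scons z x) = sqrt ((cmod z)\<^sup>2 + (l2_norm x)\<^sup>2)"
proof -
  have "summable (\<lambda>j. (cmod (scons z x j))\<^sup>2)" using x scons_l2[of z x] by (simp add: l2_seqs_def)
  from suminf_split_head[OF this]
  have "(\<Sum>j. (cmod (scons z x j))\<^sup>2) = (cmod z)\<^sup>2 + (\<Sum>j. (cmod (x j))\<^sup>2)" by (simp add: scons_def)
  moreover have "(l2_norm x)\<^sup>2 = (\<Sum>j. (cmod (x j))\<^sup>2)"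
    using x by (simp add: l2_norm_def l2_seqs_def suminf_nonneg)
  ultimately show ?thesis by (simp add: l2_norm_def)
qed

lemma scons_l2_norm_bounds:
  assumes x: "x \<in> l2_seqs"
  shows "cmod z \<le> l2_norm (scons z x)" "l2_norm x \<le> l2_norm (scons z x)"
    "l2_norm (scons z x) \<le> cmod z + l2_norm x"
  using l2_norm_nonneg[OF x] sqrt_sum_squares_le_sum[of "cmod z" "l2_norm x"]
  by (auto simp: scons_l2_norm[OF x] intro: real_le_rsqrt)

definition csum :: "cseq \<Rightarrow> complex" where
  "csum a = (\<Sum>j\<in>{j. a j \<noteq> 0}. a j)"

lemma csum_eq: "finite A \<Longrightarrow> (\<And>j. j \<notin> A \<Longrightarrow> a j = 0) \<Longrightarrow> csum a = (\<Sum>j\<in>A. a j)"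
  unfolding csum_def by (rule sum.mono_neutral_left) auto

lemma csum_restr: "restr {..<n} a = a \<Longrightarrow> csum a = (\<Sum>j<n. a j)"
  by (rule csum_eq) (simp, metis lessThan_iff restr_def)

lemma csum_add:
  assumes "a \<in> c00" "b \<in> c00" shows "csum (\<lambda>j. a j + b j) = csum a + csum b"
proof -
  let ?A = "{j. a j \<noteq> 0} \<union> {j. b j \<noteq> 0}"
  have f: "finite ?A" using assms by (simp add: c00_def)
  have "csum (\<lambda>j. a j + b j) = (\<Sum>j\<in>?A. a j + b j)" "csum a = (\<Sum>j\<in>?A. a j)" "csum b = (\<Sum>j\<in>?A. b j)"
    by (rule csum_eq[OF f]; auto)+
  then show ?thesis by (simp add: sum.distrib)
qed

lemma csum_scale:
  assumes "a \<in> c00" shows "csum (\<lambda>j. c * a j) = c * csum a"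
proof -
  have "csum (\<lambda>j. c * a j) = (\<Sum>j\<in>{j. a j \<noteq> 0}. c * a j)"
    by (rule csum_eq) (use assms in \<open>auto simp: c00_def\<close>)
  then show ?thesis by (simp add: csum_def sum_distrib_left)
qed

text \<open>Summation is not continuous on \<open>\<ell>\<^sub>2\<close>: any value of the sum is reached by adding a long flat
  block of small norm.\<close>

lemma csum_dense:
  assumes x: "x \<in> l2_seqs" and e: "0 < e"
  shows "\<exists>a\<in>c00. l2_norm (\<lambda>j. scons (csum a) a j - x j) < e"
proof -
  define y where "y = (\<lambda>j. x (Suc j))"
  have xs: "x = scons (x 0) y" by (auto simp: scons_def y_def fun_eq_iff split: nat.splits)
  have y: "y \<in> l2_seqs" using x scons_l2 xs by metis
  obtain n where n: "l2_norm (\<lambda>j. y j - restr {..<n} y j) < e / 2"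
    using null_sequence_less[OF l2_tail[OF y], of "e/2"] e by auto
  define b where "b = restr {..<n} y"
  have b: "b \<in> c00" by (simp add: b_def c00_restr_finite)
  define s where "s = x 0 - csum b"
  \<comment> \<open>A flat block of length m with sum s has l2 norm \<open>cmod s / sqrt m\<close>;
    this m makes it smaller than \<open>e / 2\<close>. The block is placed beyond n, clear of
    b.\<close>
  obtain m where m: "(cmod s / (e / 2))\<^sup>2 < real m" using reals_Archimedean2 by blast
  have m0: "0 < real m" using m zero_le_power2 by (meson le_less_trans)
  define d where "d = (\<lambda>j. if j \<in> {n..<n+m} then s / of_nat m else 0)"
  have d: "d \<in> c00" by (auto simp: c00_def d_def)
  have sd: "csum d = s"
  proof -
    have "csum d = (\<Sum>j\<in>{n..<n+m}. d j)" by (rule csum_eq) (auto simp: d_def)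
    also have "\<dots> = s" using m0 by (simp add: d_def)
    finally show ?thesis .
  qed
  have nd: "l2_norm d < e / 2"
  proof -
    have "l2_norm d = L2_set (\<lambda>j. cmod (d j)) {n..<n+m}" by (rule l2_norm_finite) (auto simp: d_def)
    also have "\<dots> = L2_set (\<lambda>j. cmod s / real m) {n..<n+m}"
      by (rule L2_set_cong) (auto simp: d_def norm_divide)
    also have "\<dots> = cmod s / sqrt (real m)"
      using m0 by (simp add: L2_set_constant real_div_sqrt field_simps)
    finally have l: "l2_norm d = cmod s / sqrt (real m)" .
    have "cmod s / (e / 2) < sqrt (real m)" using m by (rule real_less_rsqrt)
    then show ?thesis using e m0 by (simp add: l field_simps)
  qed
  define a where "a = (\<lambda>j. b j + d j)"
  have a: "a \<in> c00" unfolding a_def by (rule c00_add[OF b d])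
  have "csum a = x 0" unfolding a_def csum_add[OF b d] sd by (simp add: s_def)
  then have eq: "(\<lambda>j. scons (csum a) a j - x j) = scons 0 (\<lambda>j. d j - (y j - b j))"
    by (auto simp: scons_def a_def y_def fun_eq_iff split: nat.splits)
  have l: "d \<in> l2_seqs" "(\<lambda>j. y j - b j) \<in> l2_seqs"
    using b d c00_subset_l2 y by (auto intro: l2_diff)
  have "l2_norm (scons 0 (\<lambda>j. d j - (y j - b j))) \<le> l2_norm (\<lambda>j. d j - (y j - b j))"
    using scons_l2_norm_bounds(3)[OF l2_diff[OF l], of 0] by simp
  also have "\<dots> \<le> l2_norm d + l2_norm (\<lambda>j. y j - b j)" by (rule l2_norm_diff[OF l])
  also have "\<dots> < e" using nd n by (simp add: b_def)
  finally show ?thesis using a eq by metis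
qed

context normed_twisted_sum
begin

abbreviation "ZN \<equiv> (Z_space B)\<lparr>cs_norm := N\<rparr>"

lemma spreading_limit:
  assumes gen: "generates_spreading_norm ZN X L" and a: "restr {..<n} a = a"
    and e: "0 < e"
  shows "\<exists>\<nu>. \<forall>k::nat \<Rightarrow> nat. (\<forall>i<n. \<nu> \<le> k i) \<and> strict_mono_on {..<n} k \<longrightarrow>
    \<bar>N (plincomb a (\<lambda>i. X (k i)) n) - L a\<bar> < e"
  using gen[unfolded generates_spreading_norm_def, rule_format, OF e, of n a]
  unfolding Z_space_lincomb a by simp

text \<open>Consecutive indices starting at m turn L into an ordinary limit of sequences, through
  which homogeneity and subadditivity pass from N to L.\<close>

lemma spreading_tendsto:
  assumes gen: "generates_spreading_norm ZN X L" and a: "restr {..<n} a = a"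
  shows "(\<lambda>m. N (plincomb a (\<lambda>i. X (m + i)) n)) \<longlonglongrightarrow> L a"
proof (rule LIMSEQ_I)
  fix e :: real assume "0 < e"
  from spreading_limit[OF gen a this] obtain \<nu> where
    \<nu>: "\<And>k::nat \<Rightarrow> nat. (\<forall>i<n. \<nu> \<le> k i) \<and> strict_mono_on {..<n} k \<Longrightarrow>
      \<bar>N (plincomb a (\<lambda>i. X (k i)) n) - L a\<bar> < e" by blast
  have "norm (N (plincomb a (\<lambda>i. X (m + i)) n) - L a) < e" if "m \<ge> \<nu>" for m
    using \<nu>[of "\<lambda>i. m + i"] that by (simp add: strict_mono_on_def)
  then show "\<exists>no. \<forall>m\<ge>no. norm (N (plincomb a (\<lambda>i. X (m + i)) n) - L a) < e" by blast
qed

lemma spreading_seminorm: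
  assumes gen: "generates_spreading_norm ZN X L" and X: "\<And>j. X j \<in> Z"
  shows "c00_seminorm L"
proof
  fix x c assume x: "x \<in> c00"
  then obtain n where n: "restr {..<n} x = x" using c00_bounded_support by blast
  then have n': "restr {..<n} (\<lambda>j. c * x j) = (\<lambda>j. c * x j)" by (simp add: restr_scale)
  have "plincomb (\<lambda>j. c * x j) v n = pscale c (plincomb x v n)" for v
    by (simp add: p_defs sum_distrib_left mult.assoc)
  then have "(\<lambda>m. cmod c * N (plincomb x (\<lambda>i. X (m + i)) n)) \<longlonglongrightarrow> L (\<lambda>j. c * x j)"
    using spreading_tendsto[OF gen n'] by (simp add: N_scale Z_lincomb X)
  moreover have "(\<lambda>m. cmod c * N (plincomb x (\<lambda>i. X (m + i)) n)) \<longlonglongrightarrow> cmod c * L x"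
    by (intro tendsto_mult_left spreading_tendsto gen n)
  ultimately show "L (\<lambda>j. c * x j) = cmod c * L x" by (rule LIMSEQ_unique)
next
  fix x y assume x: "x \<in> c00" and y: "y \<in> c00"
  obtain n1 where n1: "\<forall>m\<ge>n1. restr {..<m} x = x" using c00_bounded_support[OF x] by blast
  obtain n2 where n2: "\<forall>m\<ge>n2. restr {..<m} y = y" using c00_bounded_support[OF y] by blast
  define n where "n = max n1 n2"
  have n: "restr {..<n} x = x" "restr {..<n} y = y" using n1 n2 by (auto simp: n_def)
  then have n': "restr {..<n} (\<lambda>j. x j + y j) = (\<lambda>j. x j + y j)" by (simp add: restr_add)
  have "plincomb (\<lambda>j. x j + y j) v n = padd (plincomb x v n) (plincomb y v n)" for v
    by (simp add: p_defs sum.distrib distrib_right)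
  then have "N (plincomb (\<lambda>j. x j + y j) (\<lambda>i. X (m + i)) n) \<le>
      N (plincomb x (\<lambda>i. X (m + i)) n) + N (plincomb y (\<lambda>i. X (m + i)) n)" for m
    by (simp add: N_add Z_lincomb X)
  then show "L (\<lambda>j. x j + y j) \<le> L x + L y"
    by (intro LIMSEQ_le[OF spreading_tendsto[OF gen n'] tendsto_add[OF spreading_tendsto[OF gen n(1)] spreading_tendsto[OF gen n(2)]]]) blast
qed

text \<open>If \<open>u\<close> were not bounded away from \<open>0\<close>, a subsequence of \<open>X\<close> would converge to \<open>w\<close>.\<close>

lemma coordinatewise_splitting:
  assumes X: "\<And>j. X j \<in> Z" and bdd: "\<And>j. N (X j) \<le> K"
    and nc: "\<not> (\<exists>s l. strict_mono s \<and> l \<in> Z \<and> (\<lambda>n. N (pdiff (X (s n)) l)) \<longlonglongrightarrow> 0)"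
  shows "\<exists>s w u \<delta>. strict_mono (s :: nat \<Rightarrow> nat) \<and> w \<in> Z \<and> 0 < \<delta> \<and>
    (\<forall>k. u k \<in> Z \<and> X (s k) = padd w (u k) \<and> \<delta> \<le> N (u k) \<and> N (u k) \<le> K + N w) \<and>
    (\<forall>i. (\<lambda>k. fst (u k) i) \<longlonglongrightarrow> 0) \<and> (\<forall>i. (\<lambda>k. snd (u k) i) \<longlonglongrightarrow> 0)"
proof -
  \<comment> \<open>The index set \<open>bool \<times> nat\<close> treats both components at once,
    so that one subsequence serves for all coordinates.\<close>
  define f where "f k = (\<lambda>(b, i). if b then fst (X k) i else snd (X k) i)" for k
  have "\<exists>K'. \<forall>k. cmod (f k p) \<le> K'" for p :: "bool \<times> nat"
  proof -
    obtain b i where p: "p = (b, i)" by (cases p)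
    obtain D where D: "0 \<le> D" "\<forall>w\<in>Z. cmod (fst w i) \<le> D * N w \<and> cmod (snd w i) \<le> D * N w"
      using N_coord by blast
    have "cmod (f k p) \<le> D * K" for k
    proof -
      have "cmod (f k p) \<le> D * N (X k)" using D(2) X[of k] by (auto simp: f_def p)
      also have "\<dots> \<le> D * K" using D(1) bdd by (rule mult_left_mono[rotated])
      finally show ?thesis .
    qed
    then show ?thesis by blast
  qed
  then obtain s0 g where s0: "strict_mono (s0 :: nat \<Rightarrow> nat)" "\<And>p. (\<lambda>k. f (s0 k) p) \<longlonglongrightarrow> g p"
    using coordinatewise_convergent_subsequence[of f] by blast
  define w where "w = (\<lambda>i. g (True, i), \<lambda>i. g (False, i))"
  have lim: "(\<lambda>k. fst (X (s0 k)) i) \<longlonglongrightarrow> fst w i" "(\<lambda>k. snd (X (s0 k)) i) \<longlonglongrightarrow> snd w i" for i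
    using s0(2)[of "(True, i)"] s0(2)[of "(False, i)"] by (simp_all add: f_def w_def)
  have w: "w \<in> Z" by (rule coordinatewise_limit[OF X bdd lim])
  define u where "u k = pdiff (X (s0 k)) w" for k
  have u: "u k \<in> Z" for k unfolding u_def by (intro Z_diff X w)
  have null: "(\<lambda>k. fst (u k) i) \<longlonglongrightarrow> 0" "(\<lambda>k. snd (u k) i) \<longlonglongrightarrow> 0" for i
    using lim[of i] by (auto simp: u_def pdiff_def LIM_zero)
  have "\<exists>\<delta>>0. \<exists>\<nu>. \<forall>k\<ge>\<nu>. \<delta> \<le> N (u k)"
  proof (rule ccontr)
    assume "\<not> ?thesis"
    then have small: "\<exists>k\<ge>\<nu>. N (u k) < \<delta>" if "0 < \<delta>" for \<delta> \<nu>
      using that by (meson not_le)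
    have "\<exists>h :: nat \<Rightarrow> nat. \<forall>n. N (u (h n)) < 1 / real (Suc n) \<and> h n < h (Suc n)"
    proof (rule dependent_nat_choice)
      show "\<exists>x. N (u x) < 1 / real (Suc 0)" using small[of 1 0] by auto
      show "\<exists>y. N (u y) < 1 / real (Suc (Suc n)) \<and> x < y" for x n
        using small[of "1 / real (Suc (Suc n))" "Suc x"] by (auto simp: Suc_le_eq)
    qed
    then obtain h :: "nat \<Rightarrow> nat" where h: "\<And>n. N (u (h n)) < 1 / real (Suc n)" "\<And>n. h n < h (Suc n)"
      by blast
    have "(\<lambda>n. N (u (h n))) \<longlonglongrightarrow> 0"
      by (rule tendsto_sandwich[OF _ _ tendsto_const LIMSEQ_Suc[OF lim_1_over_n]])
        (use h(1) in \<open>auto simp: N_nonneg u intro!: always_eventually less_imp_le\<close>)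
    moreover have "strict_mono (s0 \<circ> h)"
      using h(2) by (intro strict_mono_o s0(1)) (simp add: strict_mono_Suc_iff)
    ultimately show False using nc w unfolding u_def comp_def by blast
  qed
  then obtain \<delta> \<nu> where \<delta>: "0 < \<delta>" "\<And>k. k \<ge> \<nu> \<Longrightarrow> \<delta> \<le> N (u k)" by blast
  have le: "N (u k) \<le> K + N w" for k
    using N_diff[OF X w, of "s0 k"] bdd[of "s0 k"] by (simp add: u_def)
  have eq: "X (s0 k) = padd w (u k)" for k by (simp add: u_def p_defs)
  show ?thesis
  proof (intro exI[of _ "\<lambda>k. s0 (k + \<nu>)"] exI[of _ w] exI[of _ "\<lambda>k. u (k + \<nu>)"] exI[of _ \<delta>] conjI allI)
    show "strict_mono (\<lambda>k. s0 (k + \<nu>))" using s0(1) by (simp add: strict_mono_def)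
    show "(\<lambda>k. fst (u (k + \<nu>)) i) \<longlonglongrightarrow> 0" "(\<lambda>k. snd (u (k + \<nu>)) i) \<longlonglongrightarrow> 0" for i
      using null[of i] by (auto intro: LIMSEQ_ignore_initial_segment)
  qed (use w \<delta> u eq le in auto)
qed

text \<open>U is a combination of the null parts \<open>u\<close>, so that a combination of the X is
  \<open>csum a\<close> times w plus U. The bounds on U come from nearby blocks; the smallness of U
  at the coordinate p allows \<open>csum a\<close> to be read off from w at p.\<close>

lemma spreading_approximation:
  assumes gen: "generates_spreading_norm ZN X L" and s: "strict_mono s" and w: "w \<in> Z"
    and \<delta>: "0 < \<delta>" and u: "\<And>k. u k \<in> Z" and split: "\<And>k. X (s k) = padd w (u k)"
    and lower: "\<And>k. \<delta> \<le> N (u k)" and upper: "\<And>k. N (u k) \<le> K"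
    and null: "\<And>i. (\<lambda>k. fst (u k) i) \<longlonglongrightarrow> 0" "\<And>i. (\<lambda>k. snd (u k) i) \<longlonglongrightarrow> 0"
    and a: "a \<in> c00" and e: "0 < e"
  shows "\<exists>U\<in>Z. \<bar>N (padd (pscale (csum a) w) U) - L a\<bar> < e \<and>
    N U \<le> \<kappa> * K0 * K * l2_norm a + e \<and> \<delta> / (2 * \<kappa>) * l2_norm a \<le> N U + e \<and>
    cmod (fst U p) \<le> e \<and> cmod (snd U p) \<le> e"
proof -
  obtain n0 where "\<forall>m\<ge>n0. restr {..<m} a = a" using c00_bounded_support[OF a] by blast
  then obtain n where n: "1 \<le> n" "restr {..<n} a = a" by (metis max.cobounded1 max.cobounded2)
  have a0: "a j = 0" if "j \<notin> {..<n}" for j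
    using that fun_cong[OF n(2), of j] by (simp add: restr_def)
  have na: "l2_norm a = L2_set (\<lambda>i. cmod (a i)) {..<n}" by (rule l2_norm_finite[OF a0]) auto
  have ca: "csum a = (\<Sum>j<n. a j)" by (rule csum_restr[OF n(2)])
  define t where "t = (\<Sum>i<n. cmod (a i))"
  have t: "0 \<le> t" by (simp add: t_def sum_nonneg)
  \<comment> \<open>The first entry keeps the total error of n terms, weighted by the coefficients,
    below e; the second keeps each block of norm at least \<open>\<delta> / 2\<close>.\<close>
  define e' where "e' = min (e / (t + 1)) (\<delta> / 2)"
  have e': "0 < e'" "e' \<le> \<delta> / 2" "t * e' \<le> e"
  proof -
    show "0 < e'" using e \<delta> t by (auto simp: e'_def intro!: divide_pos_pos)
    show "e' \<le> \<delta> / 2" unfolding e'_def by (rule min.cobounded2)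
    have "t * e' \<le> t * (e / (t + 1))" using t by (intro mult_left_mono) (auto simp: e'_def)
    also have "\<dots> \<le> e" using t e by (simp add: field_simps)
    finally show "t * e' \<le> e" .
  qed
  obtain \<nu>1 where \<nu>1: "\<And>k::nat \<Rightarrow> nat. (\<forall>i<n. \<nu>1 \<le> k i) \<and> strict_mono_on {..<n} k \<Longrightarrow>
      \<bar>N (plincomb a (\<lambda>i. X (k i)) n) - L a\<bar> < e"
    using spreading_limit[OF gen n(2) e] by blast
  have "(\<lambda>k. cmod (fst (u k) p)) \<longlonglongrightarrow> 0" "(\<lambda>k. cmod (snd (u k) p)) \<longlonglongrightarrow> 0"
    using null by (auto intro: tendsto_norm_zero)
  from null_sequence_less[OF this(1) e'(1)] null_sequence_less[OF this(2) e'(1)]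
  obtain \<nu>2 \<nu>3 where \<nu>2: "\<And>k. k \<ge> \<nu>2 \<Longrightarrow> cmod (fst (u k) p) < e'"
    and \<nu>3: "\<And>k. k \<ge> \<nu>3 \<Longrightarrow> cmod (snd (u k) p) < e'" by blast
  \<comment> \<open>The hump starts beyond all three thresholds; since \<open>s j >= j\<close>, the
    indices \<open>s (k i)\<close> exceed the first threshold as well.\<close>
  obtain k A where k: "strict_mono k" "\<And>i. \<nu>1 + \<nu>2 + \<nu>3 \<le> k i" and A: "admissible n A"
    and near: "\<And>i. N (pdiff (u (k i)) (prestr (A i) (u (k i)))) < e'"
    using gliding_hump[OF u null e'(1) n(1), of "\<nu>1 + \<nu>2 + \<nu>3"] by blast
  define U where "U = plincomb a (\<lambda>i. u (k i)) n"
  define v where "v i = prestr (A i) (u (k i))" for i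
  define V where "V = plincomb a v n"
  have v: "v i \<in> Z" for i unfolding v_def by (rule Z_restr(1)[OF u])
  have vsupp: "prestr (A i) (v i) = v i" for i by (simp add: v_def prestr_def restr_restr)
  have U: "U \<in> Z" and V: "V \<in> Z" unfolding U_def V_def by (intro Z_lincomb u v)+
  have "\<nu>1 \<le> s (k i)" for i
    using k(2)[of i] seq_suble[OF s, of "k i"] by linarith
  moreover have "strict_mono_on {..<n} (\<lambda>i. s (k i))"
    using s k(1) by (simp add: strict_mono_on_def strict_mono_def)
  moreover have "plincomb a (\<lambda>i. X (s (k i))) n = padd (pscale (csum a) w) U"
    unfolding U_def split ca
    by (simp add: p_defs sum.distrib distrib_left sum_distrib_right)
  ultimately have 1: "\<bar>N (padd (pscale (csum a) w) U) - L a\<bar> < e"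
    using \<nu>1[of "\<lambda>i. s (k i)"] by simp
  have "pdiff U V = plincomb a (\<lambda>i. pdiff (u (k i)) (v i)) n"
    by (simp add: U_def V_def p_defs right_diff_distrib sum_subtractf)
  then have "N (pdiff U V) \<le> (\<Sum>i<n. cmod (a i) * N (pdiff (u (k i)) (v i)))"
    by (simp add: N_lincomb_le Z_diff u v)
  also have "\<dots> \<le> (\<Sum>i<n. cmod (a i) * e')"
    using near by (intro sum_mono mult_left_mono) (auto simp: v_def intro: less_imp_le)
  also have "\<dots> \<le> e" using e'(3) by (simp add: t_def sum_distrib_right)
  finally have UV: "\<bar>N U - N V\<bar> \<le> e" using N_triangle_diff[OF U V] by linarith
  have Nv: "\<delta> / 2 \<le> N (v i)" "N (v i) \<le> K0 * K" for i
  proof -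
    have "N (u (k i)) - N (v i) \<le> N (pdiff (u (k i)) (v i))" by (rule N_diff_ge[OF u v])
    then show "\<delta> / 2 \<le> N (v i)" using near[of i] lower[of "k i"] e'(2) by (simp add: v_def)
    show "N (v i) \<le> K0 * K"
      unfolding v_def using N_restr[OF u, of "A i" "k i"] mult_left_mono[OF upper K0_nonneg, of "k i"] by linarith
  qed
  have "0 \<le> K" using N_nonneg[OF u] upper by (meson order_trans)
  note blocks = N_blocks[OF A v vsupp, where a = a, folded V_def]
  let ?N = "L2_set (\<lambda>i. cmod (a i) * N (v i)) {..<n}"
  have "?N \<le> L2_set (\<lambda>i. K0 * K * cmod (a i)) {..<n}"
  proof (rule L2_set_mono)
    fix i
    have "cmod (a i) * N (v i) \<le> cmod (a i) * (K0 * K)" by (intro mult_left_mono Nv) simp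
    then show "cmod (a i) * N (v i) \<le> K0 * K * cmod (a i)" by (simp add: mult_ac)
  qed (simp add: N_nonneg v)
  also have "\<dots> = K0 * K * l2_norm a"
    using K0_nonneg \<open>0 \<le> K\<close> by (simp add: na L2_set_right_distrib)
  finally have "\<kappa> * ?N \<le> \<kappa> * (K0 * K * l2_norm a)"
    using kappa_pos by (intro mult_left_mono) auto
  then have 2: "N U \<le> \<kappa> * K0 * K * l2_norm a + e" using blocks(1) UV by (simp add: mult.assoc)
  have "\<delta> / 2 * l2_norm a = L2_set (\<lambda>i. \<delta> / 2 * cmod (a i)) {..<n}"
    unfolding na by (rule L2_set_right_distrib) (use \<delta> in simp)
  also have "\<dots> \<le> ?N"
  proof (rule L2_set_mono)
    fix i
    have "cmod (a i) * (\<delta> / 2) \<le> cmod (a i) * N (v i)" by (intro mult_left_mono Nv) simp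
    then show "\<delta> / 2 * cmod (a i) \<le> cmod (a i) * N (v i)" by (simp add: mult_ac)
  qed (use \<delta> in simp)
  also have "\<dots> \<le> \<kappa> * N V" by (rule blocks(2))
  finally have "\<delta> / (2 * \<kappa>) * l2_norm a \<le> N V" using kappa_pos by (simp add: field_simps)
  then have 3: "\<delta> / (2 * \<kappa>) * l2_norm a \<le> N U + e" using UV by linarith
  have "cmod (\<Sum>i<n. a i * x i) \<le> e" if "\<And>i. cmod (x i) < e'" for x
  proof -
    have "cmod (\<Sum>i<n. a i * x i) \<le> (\<Sum>i<n. cmod (a i) * e')"
      using less_imp_le[OF that] by (intro sum_norm_le) (auto simp: norm_mult intro!: mult_left_mono)
    then show ?thesis using e'(3) by (simp add: t_def sum_distrib_right)
  qed
  moreover have "cmod (fst (u (k i)) p) < e'" "cmod (snd (u (k i)) p) < e'" for i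
    using \<nu>2[of "k i"] \<nu>3[of "k i"] k(2)[of i] by auto
  ultimately have "cmod (fst U p) \<le> e" "cmod (snd U p) \<le> e" by (simp_all add: U_def plincomb_def)
  with U 1 2 3 show ?thesis by blast
qed

lemma spreading_isomorphic_l2:
  assumes gen: "generates_spreading_norm ZN X L"
    and X: "\<And>j. X j \<in> Z" and bdd: "\<And>j. N (X j) \<le> K"
    and nc: "\<not> (\<exists>s l. strict_mono s \<and> l \<in> Z \<and> (\<lambda>n. N (pdiff (X (s n)) l)) \<longlonglongrightarrow> 0)"
  shows "isomorphic (completion (sequence_space c00 L)) l2_space"
proof -
  interpret L: c00_seminorm L by (rule spreading_seminorm[OF gen X])
  obtain s w u \<delta> where s: "strict_mono (s :: nat \<Rightarrow> nat)" and w: "w \<in> Z" and \<delta>: "0 < \<delta>"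
    and u: "\<And>k. u k \<in> Z" and split: "\<And>k. X (s k) = padd w (u k)"
    and lower: "\<And>k. \<delta> \<le> N (u k)" and upper: "\<And>k. N (u k) \<le> K + N w"
    and null: "\<And>i. (\<lambda>k. fst (u k) i) \<longlonglongrightarrow> 0" "\<And>i. (\<lambda>k. snd (u k) i) \<longlonglongrightarrow> 0"
    using coordinatewise_splitting[OF X bdd nc] by blast
  note approx = spreading_approximation[OF gen s w \<delta> u split lower upper null]
  define K3 where "K3 = \<kappa> * K0 * (K + N w) + 1"
  define c3 where "c3 = \<delta> / (2 * \<kappa>)"
  have KN: "0 \<le> K + N w" using N_nonneg[OF u] upper by (meson order_trans)
  have K3: "0 < K3" unfolding K3_def using kappa_pos K0_nonneg KN
    by (intro add_nonneg_pos mult_nonneg_nonneg) auto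
  have c3: "0 < c3" using \<delta> kappa_pos by (simp add: c3_def)
  have Nw: "0 \<le> N w" by (rule N_nonneg[OF w])
  have Ns: "N (pscale (csum a) w) = cmod (csum a) * N w" for a by (rule N_scale[OF w])
  have L0: "0 \<le> L a" if "a \<in> c00" for a by (rule L.N_nonneg[OF that])
  have l0: "0 \<le> l2_norm a" if "a \<in> c00" for a using that c00_subset_l2 l2_norm_nonneg by blast
  have up: "L a \<le> cmod (csum a) * N w + K3 * l2_norm a" if a: "a \<in> c00" for a
  proof (rule field_le_epsilon)
    fix e :: real assume "0 < e"
    then have "0 < e / 2" by simp
    from approx[OF a this] obtain U where U: "U \<in> Z" "\<bar>N (padd (pscale (csum a) w) U) - L a\<bar> < e / 2"
      "N U \<le> \<kappa> * K0 * (K + N w) * l2_norm a + e / 2" by blast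
    have "N (padd (pscale (csum a) w) U) \<le> cmod (csum a) * N w + N U"
      using N_add[OF Z_scale[OF w] U(1), of "csum a"] by (simp add: Ns)
    moreover have "\<kappa> * K0 * (K + N w) * l2_norm a \<le> K3 * l2_norm a"
      using l0[OF a] by (intro mult_right_mono) (auto simp: K3_def)
    ultimately show "L a \<le> cmod (csum a) * N w + K3 * l2_norm a + e" using U by linarith
  qed
  have low: "c3 * l2_norm a \<le> L a + cmod (csum a) * N w" if a: "a \<in> c00" for a
  proof (rule field_le_epsilon)
    fix e :: real assume "0 < e"
    then have "0 < e / 2" by simp
    from approx[OF a this] obtain U where U: "U \<in> Z" "\<bar>N (padd (pscale (csum a) w) U) - L a\<bar> < e / 2"
      "c3 * l2_norm a \<le> N U + e / 2" unfolding c3_def by blast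
    have "U = pdiff (padd (pscale (csum a) w) U) (pscale (csum a) w)" by (simp add: p_defs)
    then have "N U \<le> N (padd (pscale (csum a) w) U) + cmod (csum a) * N w"
      using N_diff[OF Z_add[OF Z_scale[OF w] U(1)] Z_scale[OF w]] by (metis Ns)
    then show "c3 * l2_norm a \<le> L a + cmod (csum a) * N w + e" using U by linarith
  qed
  show ?thesis
  proof (cases "w = (\<lambda>j. 0, \<lambda>j. 0)")
    case True
    then have Nw0: "N w = 0" using N_eq_0[OF w] by simp
    show ?thesis
    proof (rule L.isomorphic_l2[of "\<lambda>a. a" "1 / K3" "1 / c3"])
      show "1 / K3 * L a \<le> l2_norm a" "l2_norm a \<le> 1 / c3 * L a" if "a \<in> c00" for a
        using up[OF that] low[OF that] K3 c3 by (simp_all add: Nw0 field_simps)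
      show "\<exists>a\<in>c00. l2_norm (\<lambda>j. a j - x j) < e" if x: "x \<in> l2_seqs" and e: "0 < e" for x e
      proof -
        obtain n where "l2_norm (\<lambda>j. x j - restr {..<n} x j) < e"
          using null_sequence_less[OF l2_tail[OF x] e] by blast
        moreover have "l2_norm (\<lambda>j. restr {..<n} x j - x j) = l2_norm (\<lambda>j. x j - restr {..<n} x j)"
          by (simp add: l2_norm_def norm_minus_commute)
        ultimately show ?thesis using c00_restr_finite[of "{..<n}" x] by (metis finite_lessThan)
      qed
    qed (use K3 c3 c00_subset_l2 in auto)
  next
    case False
    \<comment> \<open>At a coordinate where w does not vanish, the multiple of w in the
      approximating vector cannot be cancelled by U.\<close>
    then obtain p where p: "fst w p \<noteq> 0 \<or> snd w p \<noteq> 0" by (metis ext prod.collapse)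
    define W where "W = cmod (fst w p) + cmod (snd w p)"
    have W: "0 < W" using p unfolding W_def by (metis add_nonneg_pos add_pos_nonneg norm_ge_zero zero_less_norm_iff)
    obtain D where D: "0 \<le> D" "\<And>v. v \<in> Z \<Longrightarrow> cmod (fst v p) \<le> D * N v"
      "\<And>v. v \<in> Z \<Longrightarrow> cmod (snd v p) \<le> D * N v" using N_coord by blast
    \<comment> \<open>Continuity of the coordinates at p, used on both components, shows that the
      sum of the coefficients is a bounded functional for L.\<close>
    have sum: "cmod (csum a) * W \<le> 2 * D * L a" if a: "a \<in> c00" for a
    proof (rule field_le_epsilon)
      fix e :: real assume e: "0 < e"
      \<comment> \<open>Each component contributes the error \<open>D * e' + e'\<close>, in total
        \<open>(2 * D + 2) * e'\<close>.\<close>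
      define e' where "e' = e / (2 * D + 2)"
      have e': "0 < e'" using e D(1) by (simp add: e'_def)
      from approx[OF a e', of p] obtain U where U: "U \<in> Z" "\<bar>N (padd (pscale (csum a) w) U) - L a\<bar> < e'"
        "cmod (fst U p) \<le> e'" "cmod (snd U p) \<le> e'" by blast
      define V where "V = padd (pscale (csum a) w) U"
      have V: "V \<in> Z" unfolding V_def by (intro Z_add Z_scale w U)
      have "D * N V \<le> D * (L a + e')" using U(2) D(1) by (intro mult_left_mono) (auto simp: V_def)
      then have b: "cmod (fst V p) \<le> D * (L a + e')" "cmod (snd V p) \<le> D * (L a + e')"
        using D(2)[OF V] D(3)[OF V] by linarith+
      have "csum a * fst w p = fst V p - fst U p" "csum a * snd w p = snd V p - snd U p"
        by (simp_all add: V_def p_defs)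
      then have "cmod (csum a) * cmod (fst w p) \<le> cmod (fst V p) + cmod (fst U p)"
        "cmod (csum a) * cmod (snd w p) \<le> cmod (snd V p) + cmod (snd U p)"
        by (metis norm_mult norm_triangle_ineq4)+
      then have "cmod (csum a) * W \<le> 2 * (D * (L a + e') + e')"
        using b U(3,4) by (simp add: W_def distrib_left)
      also have "\<dots> = 2 * D * L a + (2 * D + 2) * e'" by (simp add: algebra_simps)
      also have "(2 * D + 2) * e' = e" using D(1) by (simp add: e'_def)
      finally show "cmod (csum a) * W \<le> 2 * D * L a + e" .
    qed
    define K4 where "K4 = 2 * D / W"
    have K4: "0 \<le> K4" using D(1) W by (simp add: K4_def)
    have sum': "cmod (csum a) \<le> K4 * L a" if a: "a \<in> c00" for a
      using sum[OF a] W by (simp add: K4_def field_simps)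
    \<comment> \<open>The two summands bound the prepended coordinate and the l2 norm of a; the
      second combines \<open>low\<close> with the bound just found for the sum.\<close>
    define C' where "C' = K4 + (1 + K4 * N w) / c3"
    have C': "0 < C'" unfolding C'_def using K4 Nw c3
      by (intro add_nonneg_pos divide_pos_pos add_pos_nonneg mult_nonneg_nonneg) auto
    show ?thesis
    proof (rule L.isomorphic_l2[of "\<lambda>a. scons (csum a) a" "1 / (N w + K3)" C'])
      show "scons (csum a) a \<in> l2_seqs" if "a \<in> c00" for a
        using that c00_subset_l2 scons_l2 by auto
      show "scons (csum (\<lambda>j. a j + b j)) (\<lambda>j. a j + b j) = (\<lambda>j. scons (csum a) a j + scons (csum b) b j)"
        if "a \<in> c00" "b \<in> c00" for a b
        using csum_add[OF that] by (auto simp: scons_def fun_eq_iff split: nat.splits)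
      show "scons (csum (\<lambda>j. c * a j)) (\<lambda>j. c * a j) = (\<lambda>j. c * scons (csum a) a j)"
        if "a \<in> c00" for a c
        using csum_scale[OF that] by (auto simp: scons_def fun_eq_iff split: nat.splits)
      show "0 < 1 / (N w + K3)" "0 < C'" using Nw K3 C' by auto
      fix a assume a: "a \<in> c00"
      then have al: "a \<in> l2_seqs" using c00_subset_l2 by blast
      note b = scons_l2_norm_bounds[OF al, of "csum a"]
      have "L a \<le> l2_norm (scons (csum a) a) * N w + K3 * l2_norm (scons (csum a) a)"
        using up[OF a] mult_right_mono[OF b(1) Nw] mult_left_mono[OF b(2), of K3] K3 by linarith
      then show "1 / (N w + K3) * L a \<le> l2_norm (scons (csum a) a)"
        using Nw K3 by (simp add: field_simps)
      have "c3 * l2_norm a \<le> L a + K4 * L a * N w"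
        using low[OF a] mult_right_mono[OF sum'[OF a] Nw] by linarith
      then have "l2_norm a \<le> (1 + K4 * N w) / c3 * L a" using c3 by (simp add: field_simps)
      then show "l2_norm (scons (csum a) a) \<le> C' * L a"
        using b(3) sum'[OF a] by (simp add: C'_def distrib_right)
    qed (use csum_dense in blast)
  qed
qed

end

theorem proposition6:
  fixes B :: "cseq \<Rightarrow> complex \<Rightarrow> cseq"
    and N :: "cseq \<times> cseq \<Rightarrow> real"
    and M :: "(nat \<Rightarrow> cseq) set cspace"
  assumes "homogeneous_selection (coefficient_space tsirelson2 tsirelson2_basis)
             (dual_sequence_space tsirelson2 tsirelson2_basis) B"
    and "is_norm_on (Z_space B) N"
    and "equivalent_on (cs_carrier (Z_space B)) N (cs_norm (Z_space B))"
    and "spreading_model ((Z_space B)\<lparr>cs_norm := N\<rparr>) M"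
  shows "isomorphic M l2_space"
proof -
  from assms(1) obtain C where B: "\<And>x. x \<in> l2_seqs \<Longrightarrow> B x \<in> calF X2 Y2" "\<And>x. x \<in> l2_seqs \<Longrightarrow> B x (1/2) = x"
    and C: "\<And>x. x \<in> l2_seqs \<Longrightarrow> calF_norm X2 Y2 (B x) \<le> C * l2_norm x"
    unfolding homogeneous_selection_def by blast
  \<comment> \<open>Enlarging the constant to \<open>max C 0\<close> provides the nonnegativity on
    which the later estimates depend.\<close>
  have "calF_norm X2 Y2 (B x) \<le> max C 0 * l2_norm x" if "x \<in> l2_seqs" for x
    using C[OF that] mult_right_mono[OF max.cobounded1[of C 0] l2_norm_nonneg[OF that]] by linarith
  then interpret twisted_sum B "max C 0"
    by unfold_locales (use B in \<open>auto intro: strip_le_mono[OF calF_strip_le]\<close>)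
  from assms(3) obtain c1 c2 where c: "0 < c1" "0 < c2" "\<forall>w\<in>Z. c1 * q w \<le> N w \<and> N w \<le> c2 * q w"
    unfolding equivalent_on_def q_eq by blast
  interpret normed_twisted_sum B "max C 0" N c1 c2
    by unfold_locales (use assms(2) c in auto)
  from assms(4) obtain x r L where x: "\<And>j. x j \<in> Z" "bounded (range (\<lambda>j. N (x j)))"
    and nc: "\<not> (\<exists>s l. strict_mono s \<and> l \<in> Z \<and> (\<lambda>n. N (pdiff (x (s n)) l)) \<longlonglongrightarrow> 0)"
    and r: "strict_mono (r :: nat \<Rightarrow> nat)" and gen: "generates_spreading_norm ZN (x \<circ> r) L"
    and M: "M = completion (sequence_space c00 L)"
    unfolding spreading_model_def cs_tendsto_def Z_space_diff by (auto simp del: split_paired_Ex split_paired_All)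
  obtain K where K: "\<And>j. N (x j) \<le> K"
    using x(2) unfolding bounded_iff by (metis abs_le_D1 rangeI real_norm_def)
  show ?thesis unfolding M
  proof (rule spreading_isomorphic_l2[OF gen])
    \<comment> \<open>A convergent subsequence of \<open>x \<circ> r\<close> would be one of x, by
      composing the index maps.\<close>
    show "\<not> (\<exists>s l. strict_mono s \<and> l \<in> Z \<and> (\<lambda>n. N (pdiff ((x \<circ> r) (s n)) l)) \<longlonglongrightarrow> 0)"
    proof
      assume "\<exists>s l. strict_mono s \<and> l \<in> Z \<and> (\<lambda>n. N (pdiff ((x \<circ> r) (s n)) l)) \<longlonglongrightarrow> 0"
      then obtain s l where s: "strict_mono s" "l \<in> Z" "(\<lambda>n. N (pdiff (x ((r \<circ> s) n)) l)) \<longlonglongrightarrow> 0"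
        by auto
      with nc strict_mono_o[OF r s(1)] show False by blast
    qed
  qed (use x K in auto)
qed

end
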